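(* Let $p,q\in[0,1]$, let $\{\alpha_n\}_{n\ge1}$ and $\{\beta_n\}_{n\ge1}$ be sequences in $[0,1]$, and let $\{S_n\}_{n=0}^\infty$ be the dynamic elephant random walk (DERW) with parameters $p,q,\{\alpha_n\},\{\beta_n\}$. Assume that $\alpha_n=\frac{1}{4p-2}$ for all $n\ge1$ and that $\beta_n\to\beta$ as $n\to\infty$, and suppose one of the following two conditions holds: (i) $3/4\le p<1$; (ii) $p=1$ and $0<\beta<1$. Set $$C_{\beta,p}':=1-4\left(1-\frac{1}{4p-2}\right)^2(2\beta-1)^2.$$ Then, as $n\to\infty$, the following convergence in distribution holds in $D([0,\infty))$: $$\left(\frac{S_{[n^t]}-E[S_{[n^t]}]}{\sqrt{n^t\log n}},\ t\ge0\right)\Longrightarrow\left(\sqrt{C_{\beta,p}'}\,B_t,\ t\ge0\right),$$ where $(B_t,t\ge0)$ is a standard Brownian motion. In particular, $\frac{S_n-E[S_n]}{\sqrt{n\log n}}$ converges in distribution to $N(0,C_{\beta,p}')$ as $n\to\infty$.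
   Context: The dynamic elephant random walk (DERW) with parameters $p,q\in[0,1]$ and sequences $\{\alpha_n\}_{n\ge1},\{\beta_n\}_{n\ge1}$ in $[0,1]$ is a $\mathbb{Z}$-valued stochastic process $\{S_n\}_{n=0}^\infty$ on a probability space $(\Omega,\mathcal{F},P)$ with $S_0:=0$, whose increments $X_n:=S_n-S_{n-1}$ ($n\ge1$) take values in $\{-1,+1\}$ and satisfy $$E[X_1]=\alpha_1(2q-1)+(1-\alpha_1)(2\beta_1-1)$$ and, for all $n\ge1$, $$E[X_{n+1}\mid\mathcal{F}_n^X]=\frac{\alpha_{n+1}(2p-1)}{n}S_n+(1-\alpha_{n+1})(2\beta_{n+1}-1),$$ where $\mathcal{F}_n^X:=\sigma(X_1,\ldots,X_n)$. $D([0,\infty))$ denotes the Skorokhod space of right-continuous real functions on $[0,\infty)$ with left-hand limits, equipped with the Skorokhod topology. $[x]$ denotes the integer part of $x$. $N(0,\sigma^2)$ is the centered normal law with variance $\sigma^2$. The normalized processes are considered for $n\ge2$, so that $\log n>0$. *)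

theory Defs
  imports "HOL-Probability.Probability"
begin

section \<open>The dynamic elephant random walk\<close>

definition increment :: "(nat \<Rightarrow> 'a \<Rightarrow> int) \<Rightarrow> nat \<Rightarrow> 'a \<Rightarrow> int" where
  "increment S n \<omega> = S n \<omega> - S (n - 1) \<omega>"

definition history :: "'a measure \<Rightarrow> (nat \<Rightarrow> 'a \<Rightarrow> int) \<Rightarrow> nat \<Rightarrow> 'a measure" where
  "history M S n =
     sigma (space M)
       (\<Union>i\<in>{1..n}. {increment S i -` A \<inter> space M | A. A \<in> sets (count_space UNIV)})"

text \<open>Only the values \<open>\<alpha> n\<close>, \<open>\<beta> n\<close> with \<open>n \<ge> 1\<close> are used; the entries at index 0 are irrelevant.\<close>

locale dynamic_elephant_random_walk = prob_space M
  for M :: "'a measure" +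
  fixes p q :: real and \<alpha> \<beta> :: "nat \<Rightarrow> real" and S :: "nat \<Rightarrow> 'a \<Rightarrow> int"
  assumes p_range: "p \<in> {0..1}"
    and q_range: "q \<in> {0..1}"
    and \<alpha>_range: "\<And>n. n \<ge> 1 \<Longrightarrow> \<alpha> n \<in> {0..1}"
    and \<beta>_range: "\<And>n. n \<ge> 1 \<Longrightarrow> \<beta> n \<in> {0..1}"
    and S_measurable: "\<And>n. S n \<in> M \<rightarrow>\<^sub>M count_space UNIV"
    and S_0: "\<And>\<omega>. \<omega> \<in> space M \<Longrightarrow> S 0 \<omega> = 0"
    and increment_range:
      "\<And>n \<omega>. n \<ge> 1 \<Longrightarrow> \<omega> \<in> space M \<Longrightarrow> increment S n \<omega> \<in> {-1, 1}"
    and expectation_first: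
      "expectation (\<lambda>\<omega>. real_of_int (increment S 1 \<omega>))
         = \<alpha> 1 * (2 * q - 1) + (1 - \<alpha> 1) * (2 * \<beta> 1 - 1)"
    and cond_exp_next:
      "\<And>n. n \<ge> 1 \<Longrightarrow>
         AE \<omega> in M. real_cond_exp M (history M S n)
                       (\<lambda>\<omega>. real_of_int (increment S (n + 1) \<omega>)) \<omega>
           = \<alpha> (n + 1) * (2 * p - 1) / real n * real_of_int (S n \<omega>)
             + (1 - \<alpha> (n + 1)) * (2 * \<beta> (n + 1) - 1)"

section \<open>Standard Brownian motion\<close>

text \<open>All paths are taken to be continuous, so that they are elements of the Skorokhod space.
  Values at negative times are irrelevant.\<close>

locale standard_brownian_motion = prob_space N
  for N :: "'b measure" +
  fixes B :: "real \<Rightarrow> 'b \<Rightarrow> real"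
  assumes B_measurable: "\<And>t. t \<ge> 0 \<Longrightarrow> B t \<in> borel_measurable N"
    and B_0: "AE \<omega> in N. B 0 \<omega> = 0"
    and B_continuous: "\<And>\<omega>. \<omega> \<in> space N \<Longrightarrow> continuous_on {0..} (\<lambda>t. B t \<omega>)"
    and B_increment_normal:
      "\<And>s t. 0 \<le> s \<Longrightarrow> s < t \<Longrightarrow>
         distributed N lborel (\<lambda>\<omega>. B t \<omega> - B s \<omega>) (normal_density 0 (sqrt (t - s)))"
    and B_indep_increments:
      "\<And>(k :: nat) (\<tau> :: nat \<Rightarrow> real). 0 \<le> \<tau> 0 \<Longrightarrow> mono \<tau> \<Longrightarrow>
         indep_vars (\<lambda>_. borel) (\<lambda>i \<omega>. B (\<tau> (Suc i)) \<omega> - B (\<tau> i) \<omega>) {..<k}"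

section \<open>The Skorokhod space on the half-line\<close>

text \<open>Functions on \<open>[0, \<infinity>)\<close> are represented as elements of \<open>extensional {0..}\<close>.\<close>

definition skorokhod_space :: "(real \<Rightarrow> real) set" where
  "skorokhod_space =
     {x \<in> extensional {0..}.
        (\<forall>t\<ge>0. (x \<longlongrightarrow> x t) (at_right t)) \<and>
        (\<forall>t>0. \<exists>l. (x \<longlongrightarrow> l) (at_left t))}"

text \<open>Strictly increasing bijections of \<open>[0, \<infinity>)\<close>; continuity and \<open>\<lambda> 0 = 0\<close> are automatic.\<close>

definition time_changes :: "(real \<Rightarrow> real) set" where
  "time_changes = {\<mu>. strict_mono_on {0..} \<mu> \<and> bij_betw \<mu> {0..} {0..}}"

definition skorokhod_nbhd :: "(real \<Rightarrow> real) \<Rightarrow> real \<Rightarrow> real \<Rightarrow> (real \<Rightarrow> real) set" where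
  "skorokhod_nbhd x T \<epsilon> =
     {y \<in> skorokhod_space. \<exists>\<mu>\<in>time_changes.
        (\<forall>t\<ge>0. \<bar>\<mu> t - t\<bar> < \<epsilon>) \<and> (\<forall>t\<in>{0..T}. \<bar>y (\<mu> t) - x t\<bar> < \<epsilon>)}"

text \<open>The Skorokhod (J1) topology.  A sequence \<open>y n\<close> lies eventually in each
  \<open>skorokhod_nbhd x T \<epsilon>\<close> iff there are time changes \<open>\<mu> n\<close> with
  \<open>sup {\<bar>\<mu> n t - t\<bar> | t. t \<ge> 0} \<longlongrightarrow> 0\<close> and
  \<open>sup {\<bar>y n (\<mu> n t) - x t\<bar> | t. 0 \<le> t \<le> T} \<longlongrightarrow> 0\<close> for every \<open>T\<close>, which is the usual
  description of convergence for the (metrizable) Skorokhod topology on \<open>D([0, \<infinity>))\<close>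
  (Billingsley, Convergence of Probability Measures, 2nd ed., Theorem 16.1).\<close>

definition skorokhod_topology :: "(real \<Rightarrow> real) topology" where
  "skorokhod_topology =
     topology (\<lambda>U. U \<subseteq> skorokhod_space \<and>
                    (\<forall>x\<in>U. \<exists>T>0. \<exists>\<epsilon>>0. skorokhod_nbhd x T \<epsilon> \<subseteq> U))"

lemma skorokhod_nbhd_mono:
  assumes "T' \<le> T" "\<epsilon> \<le> \<epsilon>'"
  shows "skorokhod_nbhd x T \<epsilon> \<subseteq> skorokhod_nbhd x T' \<epsilon>'"
proof
  fix y assume "y \<in> skorokhod_nbhd x T \<epsilon>"
  then obtain \<mu> where \<mu>: "y \<in> skorokhod_space" "\<mu> \<in> time_changes"
      "\<And>t. t \<ge> 0 \<Longrightarrow> \<bar>\<mu> t - t\<bar> < \<epsilon>" "\<And>t. t \<in> {0..T} \<Longrightarrow> \<bar>y (\<mu> t) - x t\<bar> < \<epsilon>"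
    unfolding skorokhod_nbhd_def by blast
  have "\<bar>\<mu> t - t\<bar> < \<epsilon>'" if "t \<ge> 0" for t
    using \<mu>(3)[OF that] assms(2) by linarith
  moreover have "\<bar>y (\<mu> t) - x t\<bar> < \<epsilon>'" if "t \<in> {0..T'}" for t
  proof -
    from that assms(1) have "t \<in> {0..T}" by simp
    from \<mu>(4)[OF this] assms(2) show ?thesis by linarith
  qed
  ultimately show "y \<in> skorokhod_nbhd x T' \<epsilon>'"
    using \<mu>(1,2) unfolding skorokhod_nbhd_def by blast
qed

lemma openin_skorokhod_topology:
  "openin skorokhod_topology U \<longleftrightarrow>
     U \<subseteq> skorokhod_space \<and> (\<forall>x\<in>U. \<exists>T>0. \<exists>\<epsilon>>0. skorokhod_nbhd x T \<epsilon> \<subseteq> U)"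
proof -
  let ?L = "\<lambda>U. U \<subseteq> skorokhod_space \<and>
              (\<forall>x\<in>U. \<exists>T>0. \<exists>\<epsilon>>0. skorokhod_nbhd x T \<epsilon> \<subseteq> U)"
  have "?L (U \<inter> V)" if U: "?L U" and V: "?L V" for U V
  proof (intro conjI ballI)
    show "U \<inter> V \<subseteq> skorokhod_space" using U by blast
  next
    fix x assume x: "x \<in> U \<inter> V"
    obtain T1 e1 where 1: "T1 > 0" "e1 > 0" "skorokhod_nbhd x T1 e1 \<subseteq> U" using U x by blast
    obtain T2 e2 where 2: "T2 > 0" "e2 > 0" "skorokhod_nbhd x T2 e2 \<subseteq> V" using V x by blast
    have "skorokhod_nbhd x (max T1 T2) (min e1 e2) \<subseteq> U \<inter> V"
      using skorokhod_nbhd_mono[of T1 "max T1 T2" "min e1 e2" e1 x]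
        skorokhod_nbhd_mono[of T2 "max T1 T2" "min e1 e2" e2 x] 1 2 by auto
    moreover have "max T1 T2 > 0" "min e1 e2 > 0" using 1 2 by auto
    ultimately show "\<exists>T>0. \<exists>\<epsilon>>0. skorokhod_nbhd x T \<epsilon> \<subseteq> U \<inter> V" by blast
  qed
  moreover have "?L (\<Union>\<K>)" if \<K>: "\<forall>K\<in>\<K>. ?L K" for \<K>
  proof (intro conjI ballI)
    show "\<Union>\<K> \<subseteq> skorokhod_space" using \<K> by blast
  next
    fix x assume "x \<in> \<Union>\<K>"
    then obtain K where "K \<in> \<K>" "x \<in> K" by blast
    then obtain T e where "T > 0" "e > 0" "skorokhod_nbhd x T e \<subseteq> K" using \<K> by blast
    with \<open>K \<in> \<K>\<close> show "\<exists>T>0. \<exists>\<epsilon>>0. skorokhod_nbhd x T \<epsilon> \<subseteq> \<Union>\<K>" by blast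
  qed
  ultimately have "istopology ?L" unfolding istopology_def by (intro conjI allI impI) presburger+
  then show ?thesis unfolding skorokhod_topology_def by (simp add: topology_inverse')
qed

lemma topspace_skorokhod_topology: "topspace skorokhod_topology = skorokhod_space"
proof
  show "topspace skorokhod_topology \<subseteq> skorokhod_space"
    using openin_skorokhod_topology[of "topspace skorokhod_topology"] by simp
  have "skorokhod_nbhd x 1 1 \<subseteq> skorokhod_space" for x
    by (auto simp: skorokhod_nbhd_def)
  then have "openin skorokhod_topology skorokhod_space"
    unfolding openin_skorokhod_topology
    by (intro conjI ballI subset_refl exI[of _ 1]) auto
  then show "skorokhod_space \<subseteq> topspace skorokhod_topology" by (rule openin_subset)
qed

section \<open>Convergence in distribution in a topological space\<close>

definition borel_of :: "'c topology \<Rightarrow> 'c measure" where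
  "borel_of \<T> = sigma (topspace \<T>) {U. openin \<T> U}"

definition converges_in_distribution ::
  "'c topology \<Rightarrow> 'a measure \<Rightarrow> (nat \<Rightarrow> 'a \<Rightarrow> 'c) \<Rightarrow> 'b measure \<Rightarrow> ('b \<Rightarrow> 'c) \<Rightarrow> bool" where
  "converges_in_distribution \<T> M X N Y \<longleftrightarrow>
     (\<forall>n. X n \<in> M \<rightarrow>\<^sub>M borel_of \<T>) \<and>
     Y \<in> N \<rightarrow>\<^sub>M borel_of \<T> \<and>
     (\<forall>f. continuous_map \<T> euclideanreal f \<and> bounded (f ` topspace \<T>) \<longrightarrow>
        (\<lambda>n. \<integral>\<omega>. f (X n \<omega>) \<partial>M) \<longlonglongrightarrow> (\<integral>\<omega>. f (Y \<omega>) \<partial>N))"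

section \<open>The normalized processes\<close>

text \<open>For \<open>n < 2\<close> this is the zero path (division by \<open>0\<close>), which does not affect limits.\<close>

definition normalized_path :: "'a measure \<Rightarrow> (nat \<Rightarrow> 'a \<Rightarrow> int) \<Rightarrow> nat \<Rightarrow> 'a \<Rightarrow> real \<Rightarrow> real" where
  "normalized_path M S n \<omega> =
     (\<lambda>t\<in>{0..}.
        (real_of_int (S (nat \<lfloor>real n powr t\<rfloor>) \<omega>)
           - (\<integral>\<omega>'. real_of_int (S (nat \<lfloor>real n powr t\<rfloor>) \<omega>') \<partial>M))
        / sqrt (real n powr t * ln (real n)))"

definition limit_variance :: "real \<Rightarrow> real \<Rightarrow> real" where
  "limit_variance \<beta> p = 1 - 4 * (1 - 1 / (4 * p - 2))\<^sup>2 * (2 * \<beta> - 1)\<^sup>2"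

end

theory Submission
  imports Defs
begin

text \<open>
  Since \<open>\<alpha> (2 p - 1) = 1 / 2\<close>, the walk is critical: the centered walk satisfies
  \<open>E[C\<^sub>n\<^sub>+\<^sub>1 | F\<^sub>n] = (1 + 1 / (2 n)) C\<^sub>n\<close>. With \<open>a\<^sub>n\<close> the product of these factors
  (\<open>critical_growth\<close>), \<open>C\<^sub>n / a\<^sub>n\<close> is a martingale with increments bounded by \<open>2 / a\<^sub>n\<close>
  (\<open>centered_walk\<close>), and \<open>a\<^sub>n\<^sup>2 / n\<close> converges to a positive constant \<open>\<kappa>\<close>. The conditional
  mean of the \<open>n\<close>th step tends in mean to twice the limiting drift, so the conditional variance of the
  \<open>n\<close>th martingale increment is asymptotically \<open>C' / a\<^sub>n\<^sup>2 \<approx> C' / (\<kappa> n)\<close>, where \<open>C'\<close> is the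
  limit variance (\<open>cond_var_limit\<close>). Summing up to \<open>n\<^sup>t\<close> gives \<open>(C' / \<kappa>) t ln n\<close>. This
  explains both the normalization and the time scale of the functional limit theorem.

  The martingale central limit theorem is obtained from characteristic functions. Because the
  conditional variances converge in \<open>L\<^sup>1\<close> one by one, replacing them by their limits costs only a sum
  of small errors (\<open>block_char_estimate\<close>). The estimate carries a weight from the past. Hence it
  describes the conditional laws of successive blocks, and by induction expectations of products of
  functions of the blocks converge (\<open>product_convergence\<close>). A partition of unity by products of tent
  functions extends this to Lipschitz functions of several blocks
  (\<open>lipschitz_convergence_from_products\<close>).

  To pass to functionals of the whole path, a bounded Skorokhod continuous function is approximated
  from below by its Lipschitz envelopes for the uniform distance on \<open>[0, k]\<close>
  (\<open>envelope_limit\<close>). The envelopes are stable under replacing a path by its step function on a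
  fine grid, as long as the path oscillates little between grid points, and on step functions they
  depend on finitely many increments (\<open>skorokhod_liminf_criterion\<close>). The control of oscillations is a fourth moment bound combined with
  Doob's maximal inequality (\<open>maximal_inequality\<close>, \<open>path_oscillation\<close>). Envelopes also show that a
  process with continuous paths is a random element of the Skorokhod space
  (\<open>continuous_path_measurable\<close>).
\<close>

section \<open>Bounded martingale differences\<close>

definition bounded_adapted :: "'a measure \<Rightarrow> ('a \<Rightarrow> real) \<Rightarrow> bool" where
  "bounded_adapted F Z \<longleftrightarrow> Z \<in> borel_measurable F \<and> (\<exists>C. \<forall>\<omega>\<in>space F. \<bar>Z \<omega>\<bar> \<le> C)"

lemma bounded_adaptedI:
  "Z \<in> borel_measurable F \<Longrightarrow> (\<And>\<omega>. \<omega> \<in> space F \<Longrightarrow> \<bar>Z \<omega>\<bar> \<le> C) \<Longrightarrow> bounded_adapted F Z"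
  by (auto simp: bounded_adapted_def)

lemma bounded_adapted_const: "bounded_adapted F (\<lambda>_. c)"
  by (auto simp: bounded_adapted_def)

lemma bounded_adapted_add:
  assumes "bounded_adapted F X" "bounded_adapted F Y"
  shows "bounded_adapted F (\<lambda>\<omega>. X \<omega> + Y \<omega>)"
proof -
  obtain A B where "\<forall>\<omega>\<in>space F. \<bar>X \<omega>\<bar> \<le> A" "\<forall>\<omega>\<in>space F. \<bar>Y \<omega>\<bar> \<le> B"
    using assms by (auto simp: bounded_adapted_def)
  then have "\<forall>\<omega>\<in>space F. \<bar>X \<omega> + Y \<omega>\<bar> \<le> A + B" by (metis abs_triangle_ineq add_mono order_trans)
  then show ?thesis using assms unfolding bounded_adapted_def by auto
qed

lemma bounded_adapted_mult:
  assumes "bounded_adapted F X" "bounded_adapted F Y"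
  shows "bounded_adapted F (\<lambda>\<omega>. X \<omega> * Y \<omega>)"
proof -
  obtain A B where AB: "\<forall>\<omega>\<in>space F. \<bar>X \<omega>\<bar> \<le> A" "\<forall>\<omega>\<in>space F. \<bar>Y \<omega>\<bar> \<le> B"
    using assms by (auto simp: bounded_adapted_def)
  then have "\<forall>\<omega>\<in>space F. \<bar>X \<omega> * Y \<omega>\<bar> \<le> A * B"
    unfolding abs_mult by (meson abs_ge_zero mult_mono order_trans)
  then show ?thesis using assms unfolding bounded_adapted_def by auto
qed

lemma bounded_adapted_power: "bounded_adapted F X \<Longrightarrow> bounded_adapted F (\<lambda>\<omega>. X \<omega> ^ k)"
  by (induction k) (auto intro: bounded_adapted_const bounded_adapted_mult)

lemma bounded_adapted_sum:
  "(\<And>i. i \<in> I \<Longrightarrow> bounded_adapted F (X i)) \<Longrightarrow> bounded_adapted F (\<lambda>\<omega>. \<Sum>i\<in>I. X i \<omega>)"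
  by (induction I rule: infinite_finite_induct)
     (auto intro: bounded_adapted_const bounded_adapted_add)

lemmas bounded_adapted_intros =
  bounded_adapted_const bounded_adapted_add bounded_adapted_mult bounded_adapted_power
  bounded_adapted_sum

lemma bounded_adapted_mono:
  assumes "bounded_adapted F Z" "space F = space G" "sets F \<subseteq> sets G"
  shows "bounded_adapted G Z"
  using assms measurable_mono[of borel borel F G] by (auto simp: bounded_adapted_def)

lemma bounded_adapted_prod:
  "(\<And>i. i \<in> I \<Longrightarrow> bounded_adapted G (X i)) \<Longrightarrow> bounded_adapted G (\<lambda>\<omega>. \<Prod>i\<in>I. X i \<omega>)"
  by (induction I rule: infinite_finite_induct)
     (auto intro: bounded_adapted_const bounded_adapted_mult)

lemma norm_diff_triangle3:
  fixes x y z w :: "'z :: real_normed_vector"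
  shows "norm (x - w) \<le> norm (x - y) + norm (y - z) + norm (z - w)"
  by norm

lemma exp_minus_quadratic_bound:
  fixes x :: real
  assumes "0 \<le> x"
  shows "\<bar>1 - x - exp (- x)\<bar> \<le> x\<^sup>2 / 2"
proof -
  have "1 - x \<le> exp (- x)" using exp_ge_add_one_self[of "- x"] by simp
  moreover have "exp (- x) \<le> 1 - x + x\<^sup>2 / 2"
  proof -
    let ?g = "\<lambda>x. 1 - x + x\<^sup>2 / 2 - exp (- x) :: real"
    have "?g 0 \<le> ?g x"
    proof (rule DERIV_nonneg_imp_nondecreasing[OF assms])
      fix y :: real assume "0 \<le> y" "y \<le> x"
      have "(?g has_real_derivative (- 1 + y + exp (- y))) (at y)"
        by (auto intro!: derivative_eq_intros)
      moreover have "- 1 + y + exp (- y) \<ge> 0" using exp_ge_add_one_self[of "- y"] by simp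
      ultimately show "\<exists>z. (?g has_real_derivative z) (at y) \<and> z \<ge> 0" by blast
    qed
    then show ?thesis by simp
  qed
  ultimately show ?thesis by simp
qed

text \<open>The martingale property is stated in its weak form, orthogonality to the bounded variables of
  the past. All estimates below use it in exactly this form.\<close>

locale bounded_martingale_differences = prob_space M
  for M :: "'a measure" +
  fixes F :: "nat \<Rightarrow> 'a measure" and d :: "nat \<Rightarrow> 'a \<Rightarrow> real" and b :: "nat \<Rightarrow> real"
  assumes space_F: "space (F j) = space M"
    and sets_F: "sets (F j) \<subseteq> sets M"
    and F_mono: "i \<le> j \<Longrightarrow> sets (F i) \<subseteq> sets (F j)"
    and d_adapted: "d j \<in> borel_measurable (F j)"
    and d_bound: "\<omega> \<in> space M \<Longrightarrow> \<bar>d j \<omega>\<bar> \<le> b j"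
    and orthogonal: "bounded_adapted (F j) Z \<Longrightarrow> expectation (\<lambda>\<omega>. Z \<omega> * d (Suc j) \<omega>) = 0"
begin

lemma adapted_mono: "bounded_adapted (F i) Z \<Longrightarrow> i \<le> j \<Longrightarrow> bounded_adapted (F j) Z"
  by (rule bounded_adapted_mono[of "F i"]) (simp_all add: space_F F_mono)

lemma adapted_M: "bounded_adapted (F i) Z \<Longrightarrow> bounded_adapted M Z"
  by (rule bounded_adapted_mono[of "F i"]) (simp_all add: space_F sets_F)

lemma integrable_bounded: "bounded_adapted M Z \<Longrightarrow> integrable M Z"
  unfolding bounded_adapted_def by (auto intro!: integrable_const_bound AE_I2)

lemma integrable_adapted: "bounded_adapted (F i) Z \<Longrightarrow> integrable M Z"
  by (intro integrable_bounded adapted_M)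

lemma adapted_d: "i \<le> j \<Longrightarrow> bounded_adapted (F j) (d i)"
  by (rule adapted_mono[OF bounded_adaptedI]) (use d_adapted d_bound space_F in auto)

definition block :: "nat \<Rightarrow> nat \<Rightarrow> 'a \<Rightarrow> real" where
  "block N j \<omega> = (\<Sum>i\<in>{N<..j}. d i \<omega>)"

lemma block_Suc: "N \<le> j \<Longrightarrow> block N (Suc j) \<omega> = block N j \<omega> + d (Suc j) \<omega>"
proof -
  assume "N \<le> j"
  then have "{N<..Suc j} = insert (Suc j) {N<..j}" by auto
  then show ?thesis by (simp add: block_def)
qed

lemma block_self [simp]: "block N N \<omega> = 0"
  by (simp add: block_def)

lemma block_diff: "i \<le> j \<Longrightarrow> j \<le> k \<Longrightarrow> block i k \<omega> - block i j \<omega> = block j k \<omega>"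
proof -
  assume "i \<le> j" "j \<le> k"
  then have "{i<..k} = {i<..j} \<union> {j<..k}" "{i<..j} \<inter> {j<..k} = {}" by auto
  then show ?thesis by (simp add: block_def sum.union_disjoint)
qed

lemma adapted_block: "bounded_adapted (F j) (block N j)"
  unfolding block_def[abs_def] by (intro bounded_adapted_sum adapted_d) auto

lemma sum_Suc_block:
  fixes c :: "nat \<Rightarrow> real"
  shows "N \<le> j \<Longrightarrow> (\<Sum>i\<in>{N<..Suc j}. c i) = (\<Sum>i\<in>{N<..j}. c i) + c (Suc j)"
proof -
  assume "N \<le> j"
  then have "{N<..Suc j} = insert (Suc j) {N<..j}" by auto
  then show ?thesis by simp
qed

lemma d_sq_bound: "\<omega> \<in> space M \<Longrightarrow> d j \<omega> ^ 2 \<le> b j ^ 2"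
  using d_bound[of \<omega> j] by (metis abs_ge_zero power2_abs power_mono)

lemma second_moment:
  assumes "N \<le> j"
  shows "expectation (\<lambda>\<omega>. block N j \<omega> ^ 2) \<le> (\<Sum>i\<in>{N<..j}. b i ^ 2)"
  using assms
proof (induction j rule: dec_induct)
  case (step j)
  have "expectation (\<lambda>\<omega>. block N (Suc j) \<omega> ^ 2) \<le>
        expectation (\<lambda>\<omega>. block N j \<omega> ^ 2 + 2 * (block N j \<omega> * d (Suc j) \<omega>) + b (Suc j) ^ 2)"
  proof (rule integral_mono)
    show "integrable M (\<lambda>\<omega>. block N (Suc j) \<omega> ^ 2)"
      by (rule integrable_adapted[of "Suc j"]) (intro bounded_adapted_intros adapted_block)
    show "integrable M (\<lambda>\<omega>. block N j \<omega> ^ 2 + 2 * (block N j \<omega> * d (Suc j) \<omega>) + b (Suc j) ^ 2)"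
      by (rule integrable_adapted[of "Suc j"])
         (intro bounded_adapted_intros adapted_mono[OF adapted_block[of j]] adapted_d; simp)
  qed (use step d_sq_bound in \<open>auto simp: block_Suc power2_eq_square algebra_simps\<close>)
  also have "\<dots> = expectation (\<lambda>\<omega>. block N j \<omega> ^ 2) + b (Suc j) ^ 2"
    using orthogonal[OF adapted_block[of j N]]
      integrable_adapted[OF bounded_adapted_power[OF adapted_block[of j N], of 2]]
      integrable_adapted[of "Suc j" "\<lambda>\<omega>. block N j \<omega> * d (Suc j) \<omega>"]
      bounded_adapted_mult[OF adapted_mono[OF adapted_block[of j N], of "Suc j"] adapted_d[of "Suc j" "Suc j"]]
    by (simp add: prob_space)
  finally show ?case using step by (simp add: sum_Suc_block)
qed simp

text \<open>Expanding the fourth power, the term that is linear in the new difference vanishes by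
  orthogonality and the cubic one is absorbed by \<open>4 x d\<^sup>3 \<le> 2 d\<^sup>2 (x\<^sup>2 + d\<^sup>2)\<close>.\<close>

lemma fourth_moment:
  assumes "N \<le> j"
  shows "expectation (\<lambda>\<omega>. block N j \<omega> ^ 4) \<le> 11 * (\<Sum>i\<in>{N<..j}. b i ^ 2) ^ 2"
  using assms
proof (induction j rule: dec_induct)
  case (step j)
  let ?s = "\<Sum>i\<in>{N<..j}. b i ^ 2" and ?b = "b (Suc j)"
  note ad = adapted_mono[OF adapted_block[of j N], of "Suc j", simplified]
  have "expectation (\<lambda>\<omega>. block N (Suc j) \<omega> ^ 4) \<le>
        expectation (\<lambda>\<omega>. block N j \<omega> ^ 4 + 4 * (block N j \<omega> ^ 3 * d (Suc j) \<omega>)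
          + 8 * ?b ^ 2 * block N j \<omega> ^ 2 + 3 * ?b ^ 4)"
  proof (rule integral_mono)
    show "integrable M (\<lambda>\<omega>. block N (Suc j) \<omega> ^ 4)"
      by (rule integrable_adapted[of "Suc j"]) (intro bounded_adapted_intros adapted_block)
    show "integrable M (\<lambda>\<omega>. block N j \<omega> ^ 4 + 4 * (block N j \<omega> ^ 3 * d (Suc j) \<omega>)
          + 8 * ?b ^ 2 * block N j \<omega> ^ 2 + 3 * ?b ^ 4)"
      by (rule integrable_adapted[of "Suc j"])
         (intro bounded_adapted_intros ad adapted_d; simp)
    fix \<omega> assume w: "\<omega> \<in> space M"
    define x y where "x = block N j \<omega>" and "y = d (Suc j) \<omega>"
    have y2: "y ^ 2 \<le> ?b ^ 2" unfolding y_def by (rule d_sq_bound[OF w])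
    have y4: "y ^ 4 \<le> ?b ^ 4"
      using power_mono[OF y2, of 2] by simp
    have "4 * x * y ^ 3 \<le> 2 * y ^ 2 * (x ^ 2 + y ^ 2)"
    proof -
      have "2 * y ^ 2 * (x ^ 2 + y ^ 2) - 4 * x * y ^ 3 = 2 * y ^ 2 * (x - y) ^ 2"
        by (simp add: power2_eq_square power3_eq_cube algebra_simps)
      then show ?thesis by (smt (verit) mult_nonneg_nonneg zero_le_power2)
    qed
    moreover have "(x + y) ^ 4 = x ^ 4 + 4 * x ^ 3 * y + 6 * x ^ 2 * y ^ 2 + 4 * x * y ^ 3 + y ^ 4"
      by (simp add: power2_eq_square power3_eq_cube power4_eq_xxxx algebra_simps)
    moreover have "x ^ 2 * y ^ 2 \<le> x ^ 2 * ?b ^ 2" using y2 by (simp add: mult_left_mono)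
    moreover have "2 * y ^ 2 * (x ^ 2 + y ^ 2) = 2 * (x ^ 2 * y ^ 2) + 2 * y ^ 4"
      by (simp add: power2_eq_square power4_eq_xxxx algebra_simps)
    ultimately have "(x + y) ^ 4 \<le> x ^ 4 + 4 * (x ^ 3 * y) + 8 * ?b ^ 2 * x ^ 2 + 3 * ?b ^ 4"
      using y4 by (simp add: algebra_simps)
    then show "block N (Suc j) \<omega> ^ 4 \<le> block N j \<omega> ^ 4 + 4 * (block N j \<omega> ^ 3 * d (Suc j) \<omega>)
          + 8 * ?b ^ 2 * block N j \<omega> ^ 2 + 3 * ?b ^ 4"
      using step(1) by (simp add: block_Suc x_def y_def)
  qed
  also have "\<dots> = expectation (\<lambda>\<omega>. block N j \<omega> ^ 4) + 8 * ?b ^ 2 * expectation (\<lambda>\<omega>. block N j \<omega> ^ 2)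
      + 3 * ?b ^ 4"
    using orthogonal[OF bounded_adapted_power[OF adapted_block[of j N], of 3]]
      integrable_adapted[OF bounded_adapted_power[OF adapted_block[of j N], of 2]]
      integrable_adapted[OF bounded_adapted_power[OF adapted_block[of j N], of 4]]
      integrable_adapted[OF bounded_adapted_mult[OF bounded_adapted_power[OF ad, of 3] adapted_d[of "Suc j" "Suc j"]]]
    by (simp add: prob_space)
  also have "\<dots> \<le> 11 * ?s ^ 2 + 8 * ?b ^ 2 * ?s + 3 * ?b ^ 4"
    using step.IH second_moment[OF step(1)] by (intro add_mono mult_left_mono) auto
  also have "\<dots> \<le> 11 * (?s + ?b ^ 2) ^ 2"
  proof -
    have "0 \<le> ?s" by (intro sum_nonneg) auto
    then have "0 \<le> ?b ^ 2 * ?s" by simp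
    moreover have "11 * (?s + ?b ^ 2) ^ 2 = 11 * ?s ^ 2 + 22 * (?b ^ 2 * ?s) + 11 * ?b ^ 4"
      by (simp add: power2_eq_square power4_eq_xxxx algebra_simps)
    moreover have "0 \<le> ?b ^ 4" by simp
    ultimately show ?thesis by linarith
  qed
  finally show ?case using step by (simp add: sum_Suc_block)
qed simp

text \<open>Doob's maximal inequality for the fourth power. Let \<open>H\<close> be the event that the level has been
  reached. Since \<open>(x + y)\<^sup>4 \<ge> x\<^sup>4 + 4 x\<^sup>3 y\<close>, the variable \<open>(T\<^sup>4 - c\<^sup>4) 1\<^sub>H\<close> has a
  nondecreasing, hence nonnegative, expectation.\<close>

lemma maximal_inequality:
  assumes "N \<le> K" and "c > 0"
  shows "prob {\<omega>\<in>space M. \<exists>j\<in>{N..K}. \<bar>block N j \<omega>\<bar> \<ge> c} * c ^ 4 \<le>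
         expectation (\<lambda>\<omega>. block N K \<omega> ^ 4)"
proof -
  define H where "H k \<omega> = (if \<exists>j\<in>{N..k}. \<bar>block N j \<omega>\<bar> \<ge> c then 1 else 0 :: real)" for k \<omega>
  have H: "bounded_adapted (F k) (H k)" for k
  proof (rule bounded_adaptedI)
    have "block N j \<in> borel_measurable (F k)" if "j \<le> k" for j
      using adapted_mono[OF adapted_block[of j N] that] by (auto simp: bounded_adapted_def)
    then have "Measurable.pred (F k) (\<lambda>\<omega>. \<bar>block N j \<omega>\<bar> \<ge> c)" if "j \<in> {N..k}" for j
      using that by auto
    then have "Measurable.pred (F k) (\<lambda>\<omega>. \<exists>j\<in>{N..k}. \<bar>block N j \<omega>\<bar> \<ge> c)"
      by (intro pred_intros_finite) auto
    then show "H k \<in> borel_measurable (F k)" unfolding H_def[abs_def] by measurable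
  qed (auto simp: H_def)
  define \<Psi> where "\<Psi> k \<omega> = (block N k \<omega> ^ 4 + (- (c ^ 4))) * H k \<omega>" for k \<omega>
  have int\<Psi>: "integrable M (\<Psi> k)" for k
    unfolding \<Psi>_def[abs_def]
    by (rule integrable_adapted[of k]) (intro bounded_adapted_intros adapted_block H)
  have "0 \<le> expectation (\<Psi> K)"
    using assms(1)
  proof (induction K rule: dec_induct)
    case base
    show ?case using assms(2) by (simp add: \<Psi>_def H_def)
  next
    case (step j)
    let ?Z = "\<lambda>\<omega>. 4 * block N j \<omega> ^ 3 * H j \<omega>"
    have Z: "bounded_adapted (F j) ?Z" by (intro bounded_adapted_intros adapted_block H)
    have intZ: "integrable M (\<lambda>\<omega>. ?Z \<omega> * d (Suc j) \<omega>)"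
      by (rule integrable_adapted[of "Suc j"], rule bounded_adapted_mult[OF adapted_mono[OF Z] adapted_d])
         auto
    have "expectation (\<lambda>\<omega>. \<Psi> j \<omega> + ?Z \<omega> * d (Suc j) \<omega>) \<le> expectation (\<Psi> (Suc j))"
    proof (intro integral_mono Bochner_Integration.integrable_add int\<Psi> intZ)
      fix \<omega>
      define x y where "x = block N j \<omega>" and "y = d (Suc j) \<omega>"
      have eq: "{N..Suc j} = insert (Suc j) {N..j}" using step(1) by auto
      have "0 \<le> y ^ 2 * (2 * x ^ 2 + (2 * x + y) ^ 2)" by simp
      also have "\<dots> = (x + y) ^ 4 - (x ^ 4 + 4 * x ^ 3 * y)"
        by (simp add: power2_eq_square power3_eq_cube power4_eq_xxxx algebra_simps)
      finally have conv: "x ^ 4 + 4 * x ^ 3 * y \<le> (x + y) ^ 4" by simp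
      have "c ^ 4 \<le> (x + y) ^ 4" if "c \<le> \<bar>x + y\<bar>"
        using power_mono[OF that, of 4] assms(2) by simp
      then show "\<Psi> j \<omega> + ?Z \<omega> * d (Suc j) \<omega> \<le> \<Psi> (Suc j) \<omega>"
        using conv unfolding \<Psi>_def H_def eq using step(1)
        by (auto simp: block_Suc x_def y_def)
    qed
    then show ?case using step.IH orthogonal[OF Z] int\<Psi> intZ by simp
  qed
  also have "expectation (\<Psi> K) \<le> expectation (\<lambda>\<omega>. block N K \<omega> ^ 4 + (- (c ^ 4)) * H K \<omega>)"
  proof (intro integral_mono int\<Psi>)
    show "integrable M (\<lambda>\<omega>. block N K \<omega> ^ 4 + (- (c ^ 4)) * H K \<omega>)"
      by (rule integrable_adapted[of K]) (intro bounded_adapted_intros adapted_block H)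
  qed (auto simp: \<Psi>_def H_def)
  also have "\<dots> = expectation (\<lambda>\<omega>. block N K \<omega> ^ 4) - c ^ 4 * expectation (H K)"
    using integrable_adapted[OF H[of K]] integrable_adapted[OF bounded_adapted_power[OF adapted_block[of K N], of 4]]
    by simp
  also have "expectation (H K) = prob {\<omega>\<in>space M. \<exists>j\<in>{N..K}. \<bar>block N j \<omega>\<bar> \<ge> c}"
  proof -
    have "expectation (H K) = expectation (indicator {\<omega>\<in>space M. \<exists>j\<in>{N..K}. \<bar>block N j \<omega>\<bar> \<ge> c})"
      by (intro Bochner_Integration.integral_cong) (auto simp: H_def indicator_def)
    also have "\<dots> = prob ({\<omega>\<in>space M. \<exists>j\<in>{N..K}. \<bar>block N j \<omega>\<bar> \<ge> c} \<inter> space M)"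
      by (rule Bochner_Integration.integral_indicator)
    finally show ?thesis by (simp add: Int_absorb2 Collect_restrict)
  qed
  finally show ?thesis by (simp add: mult.commute)
qed

text \<open>Conditioning on the past replaces \<open>iexp (u d)\<close> by \<open>1 - u\<^sup>2 v / 2\<close> up to a cubic error, where
  \<open>v\<close> is the conditional variance. A deterministic \<open>\<tau>\<close> may then replace \<open>v\<close> at the cost of
  its expected distance to \<open>v\<close>.\<close>

lemma char_step:
  fixes Y :: "'a \<Rightarrow> complex"
  assumes Re: "bounded_adapted (F j) (\<lambda>\<omega>. Re (Y \<omega>))" and Im: "bounded_adapted (F j) (\<lambda>\<omega>. Im (Y \<omega>))"
    and Y1: "\<And>\<omega>. \<omega> \<in> space M \<Longrightarrow> cmod (Y \<omega>) \<le> 1"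
    and v: "bounded_adapted (F j) v"
    and cond_var: "\<And>Z. bounded_adapted (F j) Z \<Longrightarrow>
       expectation (\<lambda>\<omega>. Z \<omega> * d (Suc j) \<omega> ^ 2) = expectation (\<lambda>\<omega>. Z \<omega> * v \<omega>)"
  shows "cmod (expectation (\<lambda>\<omega>. Y \<omega> * iexp (u * d (Suc j) \<omega>)) - (1 - u\<^sup>2 * \<tau> / 2) * expectation Y)
     \<le> u\<^sup>2 * expectation (\<lambda>\<omega>. \<bar>v \<omega> - \<tau>\<bar>) / 2 + \<bar>u\<bar> ^ 3 * b (Suc j) ^ 3 / 6"
proof -
  let ?d = "d (Suc j)"
  have cplx: "complex_integrable M (\<lambda>\<omega>. Y \<omega> * of_real (Z \<omega>))"
    "expectation (\<lambda>\<omega>. Y \<omega> * of_real (Z \<omega>)) =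
       Complex (expectation (\<lambda>\<omega>. Re (Y \<omega>) * Z \<omega>)) (expectation (\<lambda>\<omega>. Im (Y \<omega>) * Z \<omega>))"
    if Z: "bounded_adapted (F (Suc j)) Z" for Z
  proof -
    have 1: "integrable M (\<lambda>\<omega>. Re (Y \<omega>) * Z \<omega>)" "integrable M (\<lambda>\<omega>. Im (Y \<omega>) * Z \<omega>)"
      by (rule integrable_adapted[of "Suc j"], intro bounded_adapted_mult Z adapted_mono[OF Re] adapted_mono[OF Im]; simp)+
    have eq: "(\<lambda>\<omega>. Y \<omega> * of_real (Z \<omega>)) =
        (\<lambda>\<omega>. complex_of_real (Re (Y \<omega>) * Z \<omega>) + \<i> * complex_of_real (Im (Y \<omega>) * Z \<omega>))"
      by (auto simp: complex_eq_iff)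
    show 2: "complex_integrable M (\<lambda>\<omega>. Y \<omega> * of_real (Z \<omega>))"
      unfolding eq
      by (rule Bochner_Integration.integrable_add[OF integrable_of_real[OF 1(1)]
            integrable_mult_right[OF integrable_of_real[OF 1(2)]]])
    then show "expectation (\<lambda>\<omega>. Y \<omega> * of_real (Z \<omega>)) =
       Complex (expectation (\<lambda>\<omega>. Re (Y \<omega>) * Z \<omega>)) (expectation (\<lambda>\<omega>. Im (Y \<omega>) * Z \<omega>))"
      by (auto simp: complex_eq_iff integral_Re[symmetric] integral_Im[symmetric])
  qed
  have Zc: "bounded_adapted (F (Suc j)) (\<lambda>_. c)" "bounded_adapted (F (Suc j)) ?d"
    "bounded_adapted (F (Suc j)) (\<lambda>\<omega>. ?d \<omega> ^ 2)" "bounded_adapted (F (Suc j)) v" for c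
    by (intro bounded_adapted_intros adapted_d adapted_mono[OF v]; simp)+
  have linear: "expectation (\<lambda>\<omega>. Y \<omega> * of_real (?d \<omega>)) = 0"
    unfolding cplx(2)[OF Zc(2)] using orthogonal[OF Re] orthogonal[OF Im] by (simp add: complex_eq_iff)
  have quad: "expectation (\<lambda>\<omega>. Y \<omega> * of_real (?d \<omega> ^ 2)) = expectation (\<lambda>\<omega>. Y \<omega> * of_real (v \<omega>))"
    unfolding cplx(2)[OF Zc(3)] cplx(2)[OF Zc(4)] using cond_var[OF Re] cond_var[OF Im] by simp
  have intY: "complex_integrable M Y" using cplx(1)[OF Zc(1), of 1] by simp
  have intE: "complex_integrable M (\<lambda>\<omega>. Y \<omega> * iexp (u * ?d \<omega>))"
  proof (rule Bochner_Integration.integrable_bound[OF intY])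
    show "(\<lambda>\<omega>. Y \<omega> * iexp (u * ?d \<omega>)) \<in> borel_measurable M"
      using intY integrable_adapted[OF Zc(2)] by measurable
  qed (simp add: norm_mult)
  define R where "R \<omega> = Y \<omega> * iexp (u * ?d \<omega>) - (Y \<omega> + \<i> * u * (Y \<omega> * ?d \<omega>)
      - u\<^sup>2 / 2 * (Y \<omega> * of_real (?d \<omega> ^ 2)))" for \<omega>
  have intR: "complex_integrable M R"
    unfolding R_def[abs_def] using intY intE cplx(1)[OF Zc(2)] cplx(1)[OF Zc(3)]
    by (intro Bochner_Integration.integrable_diff Bochner_Integration.integrable_add integrable_mult_right) auto
  have R_le: "cmod (R \<omega>) \<le> \<bar>u\<bar> ^ 3 * b (Suc j) ^ 3 / 6" if w: "\<omega> \<in> space M" for \<omega>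
  proof -
    let ?x = "u * ?d \<omega>"
    have "R \<omega> = Y \<omega> * (iexp ?x - (\<Sum>k\<le>2. (\<i> * ?x) ^ k / fact k))"
      by (simp add: R_def numeral_2_eq_2 power2_eq_square algebra_simps)
    then have "cmod (R \<omega>) = cmod (Y \<omega>) * cmod (iexp ?x - (\<Sum>k\<le>2. (\<i> * ?x) ^ k / fact k))"
      by (simp only: norm_mult)
    also have "\<dots> \<le> 1 * (\<bar>?x\<bar> ^ Suc 2 / fact (Suc 2))"
      by (rule mult_mono[OF Y1[OF w] iexp_approx1]) auto
    also have "\<dots> = \<bar>?x\<bar> ^ 3 / 6" by (simp add: fact_numeral eval_nat_numeral)
    also have "\<dots> \<le> \<bar>u\<bar> ^ 3 * b (Suc j) ^ 3 / 6"
      using d_bound[OF w, of "Suc j"]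
      by (auto simp: abs_mult power_mult_distrib intro!: divide_right_mono mult_left_mono power_mono)
    finally show ?thesis .
  qed
  have ER: "cmod (expectation R) \<le> \<bar>u\<bar> ^ 3 * b (Suc j) ^ 3 / 6"
  proof -
    have "cmod (expectation R) \<le> expectation (\<lambda>\<omega>. cmod (R \<omega>))"
      by (rule integral_norm_bound)
    also have "\<dots> \<le> expectation (\<lambda>_. \<bar>u\<bar> ^ 3 * b (Suc j) ^ 3 / 6)"
      using intR R_le by (intro integral_mono) auto
    finally show ?thesis by (simp add: prob_space)
  qed
  have EV: "cmod (expectation (\<lambda>\<omega>. Y \<omega> * of_real (v \<omega> - \<tau>))) \<le> expectation (\<lambda>\<omega>. \<bar>v \<omega> - \<tau>\<bar>)"
  proof -
    have vt: "bounded_adapted (F (Suc j)) (\<lambda>\<omega>. v \<omega> + (- \<tau>))"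
      by (intro bounded_adapted_intros adapted_mono[OF v]) auto
    have "cmod (expectation (\<lambda>\<omega>. Y \<omega> * of_real (v \<omega> - \<tau>))) \<le>
      expectation (\<lambda>\<omega>. cmod (Y \<omega> * of_real (v \<omega> - \<tau>)))"
      by (rule integral_norm_bound)
    also have "\<dots> \<le> expectation (\<lambda>\<omega>. \<bar>v \<omega> - \<tau>\<bar>)"
    proof (rule integral_mono)
      show "integrable M (\<lambda>\<omega>. cmod (Y \<omega> * of_real (v \<omega> - \<tau>)))"
        using cplx(1)[OF vt] by simp
      show "integrable M (\<lambda>\<omega>. \<bar>v \<omega> - \<tau>\<bar>)" using integrable_adapted[OF vt] by simp
      fix \<omega> assume w: "\<omega> \<in> space M"
      show "cmod (Y \<omega> * of_real (v \<omega> - \<tau>)) \<le> \<bar>v \<omega> - \<tau>\<bar>"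
        unfolding norm_mult norm_of_real using Y1[OF w] by (simp add: mult_left_le_one_le)
    qed
    finally show ?thesis .
  qed
  have "expectation (\<lambda>\<omega>. Y \<omega> * of_real (v \<omega> - \<tau>)) =
        expectation (\<lambda>\<omega>. Y \<omega> * of_real (v \<omega>) - \<tau> * Y \<omega>)"
    by (simp add: algebra_simps)
  also have "\<dots> = expectation (\<lambda>\<omega>. Y \<omega> * of_real (v \<omega>)) - \<tau> * expectation Y"
    using cplx(1)[OF Zc(4)] intY by simp
  finally have vt: "expectation (\<lambda>\<omega>. Y \<omega> * of_real (v \<omega> - \<tau>)) =
     expectation (\<lambda>\<omega>. Y \<omega> * of_real (v \<omega>)) - \<tau> * expectation Y" .
  have "expectation R = expectation (\<lambda>\<omega>. Y \<omega> * iexp (u * ?d \<omega>)) -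
     (expectation Y + \<i> * u * expectation (\<lambda>\<omega>. Y \<omega> * ?d \<omega>)
      - u\<^sup>2 / 2 * expectation (\<lambda>\<omega>. Y \<omega> * of_real (?d \<omega> ^ 2)))"
    unfolding R_def[abs_def] using intY intE cplx(1)[OF Zc(2)] cplx(1)[OF Zc(3)]
    by simp
  then have "expectation (\<lambda>\<omega>. Y \<omega> * iexp (u * ?d \<omega>)) - (1 - u\<^sup>2 * \<tau> / 2) * expectation Y =
    expectation R - of_real (u\<^sup>2 / 2) * expectation (\<lambda>\<omega>. Y \<omega> * of_real (v \<omega> - \<tau>))"
    unfolding vt linear quad by (simp add: algebra_simps)
  then have "cmod (expectation (\<lambda>\<omega>. Y \<omega> * iexp (u * ?d \<omega>)) - (1 - u\<^sup>2 * \<tau> / 2) * expectation Y) \<le>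
    cmod (expectation R) + cmod (of_real (u\<^sup>2 / 2) * expectation (\<lambda>\<omega>. Y \<omega> * of_real (v \<omega> - \<tau>)))"
    by (simp only:) (rule norm_triangle_ineq4)
  also have "\<dots> \<le> \<bar>u\<bar> ^ 3 * b (Suc j) ^ 3 / 6 + (u\<^sup>2 / 2) * expectation (\<lambda>\<omega>. \<bar>v \<omega> - \<tau>\<bar>)"
  proof (rule add_mono[OF ER])
    show "cmod (of_real (u\<^sup>2 / 2) * expectation (\<lambda>\<omega>. Y \<omega> * of_real (v \<omega> - \<tau>))) \<le>
        (u\<^sup>2 / 2) * expectation (\<lambda>\<omega>. \<bar>v \<omega> - \<tau>\<bar>)"
      unfolding norm_mult norm_of_real abs_of_nonneg[OF divide_nonneg_nonneg[OF zero_le_power2 zero_le_numeral]]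
      by (rule mult_left_mono[OF EV]) simp
  qed
  finally show ?thesis by simp
qed

text \<open>The weight \<open>Z\<close> belongs to the past of the block. It makes the estimate a statement about the
  conditional law of the block, which is what yields the joint law of successive blocks.\<close>

lemma block_char_estimate:
  fixes Z :: "'a \<Rightarrow> real"
  assumes NK: "N \<le> K" and Z: "bounded_adapted (F N) Z" and Z1: "\<And>\<omega>. \<omega> \<in> space M \<Longrightarrow> \<bar>Z \<omega>\<bar> \<le> 1"
    and v: "\<And>j. bounded_adapted (F j) (v (Suc j))"
    and cond_var: "\<And>j Z. bounded_adapted (F j) Z \<Longrightarrow>
       expectation (\<lambda>\<omega>. Z \<omega> * d (Suc j) \<omega> ^ 2) = expectation (\<lambda>\<omega>. Z \<omega> * v (Suc j) \<omega>)"
    and \<tau>: "\<And>j. 0 \<le> \<tau> j"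
  shows "cmod (expectation (\<lambda>\<omega>. of_real (Z \<omega>) * iexp (u * block N K \<omega>))
            - of_real (exp (- u\<^sup>2 * (\<Sum>j\<in>{N<..K}. \<tau> j) / 2) * expectation Z))
     \<le> (\<Sum>j\<in>{N<..K}. u\<^sup>2 * expectation (\<lambda>\<omega>. \<bar>v j \<omega> - \<tau> j\<bar>) / 2 + \<bar>u\<bar> ^ 3 * b j ^ 3 / 6
            + u ^ 4 * (\<tau> j)\<^sup>2 / 8)"
    (is "_ \<le> (\<Sum>j\<in>_. ?err j)")
  using NK
proof (induction K rule: dec_induct)
  case base
  have "expectation (\<lambda>\<omega>. complex_of_real (Z \<omega>)) = of_real (expectation Z)"
    by (rule integral_complex_of_real)
  then show ?case by simp
next
  case (step j)
  define Y where "Y \<omega> = of_real (Z \<omega>) * iexp (u * block N j \<omega>)" for \<omega>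
  let ?x = "u\<^sup>2 * \<tau> (Suc j) / 2" and ?S = "\<Sum>i\<in>{N<..j}. \<tau> i"
  have x0: "0 \<le> ?x" using \<tau> by simp
  have Y_Suc: "of_real (Z \<omega>) * iexp (u * block N (Suc j) \<omega>) = Y \<omega> * iexp (u * d (Suc j) \<omega>)" for \<omega>
    using step(1) by (simp add: Y_def block_Suc algebra_simps exp_add)
  have Yn: "cmod (Y \<omega>) \<le> 1" if "\<omega> \<in> space M" for \<omega>
    using Z1[OF that] by (simp add: Y_def norm_mult)
  have [measurable]: "Z \<in> borel_measurable (F j)" "block N j \<in> borel_measurable (F j)"
    using adapted_mono[OF Z step(1)] adapted_block[of j N] by (auto simp: bounded_adapted_def)
  have Ym [measurable]: "Y \<in> borel_measurable (F j)" unfolding Y_def[abs_def] by measurable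
  have Re: "bounded_adapted (F j) (\<lambda>\<omega>. Re (Y \<omega>))" and Im: "bounded_adapted (F j) (\<lambda>\<omega>. Im (Y \<omega>))"
    using Yn order_trans[OF abs_Re_le_cmod] order_trans[OF abs_Im_le_cmod] space_F[of j]
    by (auto intro!: bounded_adaptedI[where C = 1])
  have 1: "cmod (expectation (\<lambda>\<omega>. Y \<omega> * iexp (u * d (Suc j) \<omega>)) - (1 - ?x) * expectation Y)
     \<le> u\<^sup>2 * expectation (\<lambda>\<omega>. \<bar>v (Suc j) \<omega> - \<tau> (Suc j)\<bar>) / 2 + \<bar>u\<bar> ^ 3 * b (Suc j) ^ 3 / 6"
    using char_step[OF Re Im Yn v cond_var, of u "\<tau> (Suc j)"] by simp
  have EY: "cmod (expectation Y) \<le> 1"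
  proof -
    have "cmod (expectation Y) \<le> expectation (\<lambda>\<omega>. cmod (Y \<omega>))" by (rule integral_norm_bound)
    also have "\<dots> \<le> expectation (\<lambda>_. 1)"
      using Yn measurable_mono[of borel borel "F j" M] Ym space_F[of j] sets_F[of j]
      by (intro integral_mono integrable_const integrable_const_bound[where B = 1]) auto
    finally show ?thesis by (simp add: prob_space)
  qed
  let ?c = complex_of_real
  have 2: "cmod (?c (1 - ?x) * expectation Y - ?c (exp (- ?x)) * expectation Y) \<le> u ^ 4 * (\<tau> (Suc j))\<^sup>2 / 8"
  proof -
    have "?c (1 - ?x) * expectation Y - ?c (exp (- ?x)) * expectation Y =
        ?c (1 - ?x - exp (- ?x)) * expectation Y"
      by (simp only: left_diff_distrib of_real_diff)
    then have "cmod (?c (1 - ?x) * expectation Y - ?c (exp (- ?x)) * expectation Y) =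
        \<bar>1 - ?x - exp (- ?x)\<bar> * cmod (expectation Y)"
      by (simp only: norm_mult norm_of_real)
    also have "\<dots> \<le> ?x\<^sup>2 / 2 * 1"
      by (rule mult_mono[OF exp_minus_quadratic_bound[OF x0] EY]) auto
    also have "\<dots> = u ^ 4 * (\<tau> (Suc j))\<^sup>2 / 8"
      by (simp add: power_divide power_mult_distrib)
    finally show ?thesis .
  qed
  have 3: "cmod (?c (exp (- ?x)) * expectation Y - ?c (exp (- ?x)) *
      ?c (exp (- u\<^sup>2 * ?S / 2) * expectation Z)) \<le> (\<Sum>i\<in>{N<..j}. ?err i)"
  proof -
    have "cmod (?c (exp (- ?x)) * (expectation Y - ?c (exp (- u\<^sup>2 * ?S / 2) * expectation Z)))
      \<le> 1 * (\<Sum>i\<in>{N<..j}. ?err i)"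
      unfolding norm_mult norm_of_real
    proof (rule mult_mono)
      show "\<bar>exp (- ?x)\<bar> \<le> 1" using x0 by simp
      show "cmod (expectation Y - ?c (exp (- u\<^sup>2 * ?S / 2) * expectation Z)) \<le> (\<Sum>i\<in>{N<..j}. ?err i)"
        using step.IH unfolding Y_def[abs_def] .
    qed (rule zero_le_one norm_ge_zero)+
    then show ?thesis by (simp only: right_diff_distrib mult_1)
  qed
  have 4: "of_real (exp (- ?x)) * of_real (exp (- u\<^sup>2 * ?S / 2) * expectation Z) =
     complex_of_real (exp (- u\<^sup>2 * (\<Sum>i\<in>{N<..Suc j}. \<tau> i) / 2) * expectation Z)"
  proof -
    have "- ?x + - u\<^sup>2 * ?S / 2 = - u\<^sup>2 * (\<Sum>i\<in>{N<..Suc j}. \<tau> i) / 2"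
      unfolding sum_Suc_block[OF step(1)] by (simp add: field_simps)
    then show ?thesis
      by (simp only: of_real_mult[symmetric] exp_add[symmetric] mult.assoc[symmetric])
  qed
  show ?case
    unfolding Y_Suc 4[symmetric] sum_Suc_block[OF step(1), of ?err]
  proof -
    let ?A = "expectation (\<lambda>\<omega>. Y \<omega> * iexp (u * d (Suc j) \<omega>))"
    let ?B = "?c (1 - ?x) * expectation Y"
    let ?C = "?c (exp (- ?x)) * expectation Y"
    let ?D = "?c (exp (- ?x)) * ?c (exp (- u\<^sup>2 * ?S / 2) * expectation Z)"
    have "cmod (?A - ?D) \<le> cmod (?A - ?B) + cmod (?B - ?C) + cmod (?C - ?D)"
      by (rule norm_diff_triangle3)
    also have "\<dots> \<le> ?err (Suc j) + (\<Sum>i\<in>{N<..j}. ?err i)"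
      by (rule add_mono[OF add_mono[OF 1 2] 3])
    also have "\<dots> = (\<Sum>i\<in>{N<..j}. ?err i) + ?err (Suc j)" by (rule add.commute)
    finally show "cmod (?A - ?D) \<le> (\<Sum>i\<in>{N<..j}. ?err i) + ?err (Suc j)" .
  qed
qed

end

section \<open>Logarithmic averages and the normalizing sequence\<close>

lemma weighted_average_null:
  fixes w y :: "nat \<Rightarrow> real"
  assumes w: "\<And>j. 0 \<le> w j" and W: "filterlim (\<lambda>N. \<Sum>j=1..N. w j) at_top sequentially"
    and y: "y \<longlonglongrightarrow> 0"
  shows "(\<lambda>N. (\<Sum>j=1..N. w j * y j) / (\<Sum>j=1..N. w j)) \<longlonglongrightarrow> 0"
proof (rule LIMSEQ_I)
  fix e :: real assume e: "0 < e"
  obtain n0 where n0: "\<And>j. j \<ge> n0 \<Longrightarrow> \<bar>y j\<bar> < e / 2"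
    using LIMSEQ_D[OF y, of "e / 2"] e by auto
  define A where "A = (\<Sum>j=1..n0. w j * \<bar>y j\<bar>)"
  have bound: "\<bar>\<Sum>j=1..N. w j * y j\<bar> \<le> A + e / 2 * (\<Sum>j=1..N. w j)" if "N \<ge> n0" for N
  proof -
    have "\<bar>\<Sum>j=1..N. w j * y j\<bar> \<le> (\<Sum>j=1..N. w j * \<bar>y j\<bar>)"
      using w by (intro order_trans[OF sum_abs]) (simp add: abs_mult)
    also have "\<dots> = A + (\<Sum>j=Suc n0..N. w j * \<bar>y j\<bar>)"
    proof -
      have "{1..N} = {1..n0} \<union> {Suc n0..N}" using that by auto
      then show ?thesis unfolding A_def by (simp add: sum.union_disjoint)
    qed
    also have "(\<Sum>j=Suc n0..N. w j * \<bar>y j\<bar>) \<le> (\<Sum>j=Suc n0..N. w j * (e / 2))"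
      using n0 w by (intro sum_mono mult_left_mono) (auto intro: less_imp_le)
    also have "\<dots> \<le> (\<Sum>j=1..N. w j * (e / 2))"
      using w e by (intro sum_mono2) auto
    also have "\<dots> = e / 2 * (\<Sum>j=1..N. w j)" by (simp add: sum_distrib_left mult.commute)
    finally show ?thesis by simp
  qed
  have A0: "0 \<le> A" unfolding A_def using w by (intro sum_nonneg) auto
  have "\<forall>\<^sub>F N in sequentially. 2 * A / e < (\<Sum>j=1..N. w j) \<and> N \<ge> n0"
    using W filterlim_at_top_dense[of "\<lambda>N. \<Sum>j=1..N. w j" sequentially] eventually_ge_at_top[of n0]
    by (auto intro: eventually_conj)
  then obtain n1 where n1: "\<And>N. N \<ge> n1 \<Longrightarrow> 2 * A / e < (\<Sum>j=1..N. w j) \<and> N \<ge> n0"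
    unfolding eventually_sequentially by blast
  show "\<exists>no. \<forall>N\<ge>no. norm ((\<Sum>j=1..N. w j * y j) / (\<Sum>j=1..N. w j) - 0) < e"
  proof (intro exI allI impI)
    fix N assume "N \<ge> n1"
    let ?W = "\<Sum>j=1..N. w j"
    have "2 * A / e < ?W" "N \<ge> n0" using n1[OF \<open>N \<ge> n1\<close>] by auto
    moreover have "0 \<le> 2 * A / e" using A0 e by simp
    ultimately have W0: "0 < ?W" and "A < e / 2 * ?W" using e by (linarith, simp add: field_simps)
    then have "\<bar>\<Sum>j=1..N. w j * y j\<bar> < e * ?W"
      using bound[OF \<open>N \<ge> n0\<close>] by linarith
    then show "norm ((\<Sum>j=1..N. w j * y j) / ?W - 0) < e"
      using W0 by (simp add: pos_divide_less_eq)
  qed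
qed

lemma harm_over_ln: "(\<lambda>n. harm n / ln (real n) :: real) \<longlonglongrightarrow> 1"
proof -
  have ln: "filterlim (\<lambda>n. ln (real n)) at_top sequentially"
    by (rule filterlim_compose[OF ln_at_top filterlim_real_sequentially])
  have "(\<lambda>n. (harm n - ln (real n)) / ln (real n) + 1) \<longlonglongrightarrow> 0 + 1"
    by (intro tendsto_add tendsto_const real_tendsto_divide_at_top[OF euler_mascheroni_LIMSEQ ln])
  moreover have "\<forall>\<^sub>F n in sequentially. (harm n - ln (real n)) / ln (real n) + 1 = harm n / ln (real n)"
    using eventually_gt_at_top[of 1] by eventually_elim (simp add: field_simps)
  ultimately show ?thesis by (simp add: tendsto_cong)
qed

lemma logarithmic_average:
  fixes x :: "nat \<Rightarrow> real"
  assumes "x \<longlonglongrightarrow> l"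
  shows "(\<lambda>N. (\<Sum>j=1..N. x j / real j) / ln (real N)) \<longlonglongrightarrow> l"
proof -
  have h: "(\<Sum>j=1..N. 1 / real j) = harm N" for N
    by (simp add: harm_def inverse_eq_divide)
  have "(\<lambda>j. x j - l) \<longlonglongrightarrow> 0" using assms by (simp add: LIM_zero_iff)
  from weighted_average_null[of "\<lambda>j. 1 / real j", OF _ _ this]
  have "(\<lambda>N. (\<Sum>j=1..N. 1 / real j * (x j - l)) / harm N) \<longlonglongrightarrow> 0"
    using harm_at_top unfolding h by simp
  from tendsto_mult[OF tendsto_add[OF this tendsto_const[of l]] harm_over_ln]
  have "(\<lambda>N. ((\<Sum>j=1..N. 1 / real j * (x j - l)) / harm N + l) * (harm N / ln (real N))) \<longlonglongrightarrow> l"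
    by simp
  moreover have "\<forall>\<^sub>F N in sequentially.
      ((\<Sum>j=1..N. 1 / real j * (x j - l)) / harm N + l) * (harm N / ln (real N)) =
      (\<Sum>j=1..N. x j / real j) / ln (real N)"
    using eventually_gt_at_top[of 1]
  proof eventually_elim
    case (elim N)
    have "(\<Sum>j=1..N. 1 / real j * (x j - l)) = (\<Sum>j=1..N. x j / real j) - l * harm N"
      unfolding h[symmetric] sum_distrib_left sum_subtractf[symmetric]
      by (intro sum.cong) (auto simp: field_simps)
    moreover have "(harm N :: real) \<noteq> 0" using harm_pos[of N, where 'a = real] elim by (metis less_irrefl less_trans zero_less_one)
    ultimately show ?case by (simp add: divide_add_eq_iff)
  qed
  ultimately show ?thesis by (rule Lim_transform_eventually)
qed

abbreviation power_time :: "nat \<Rightarrow> real \<Rightarrow> nat" where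
  "power_time n t \<equiv> nat \<lfloor>real n powr t\<rfloor>"

lemma power_time_ge_1: "n \<ge> 1 \<Longrightarrow> 0 \<le> t \<Longrightarrow> 1 \<le> power_time n t"
  using ge_one_powr_ge_zero[of "real n" t] by (simp add: le_nat_iff le_floor_iff)

lemma power_time_le: "real (power_time n t) \<le> real n powr t"
  by simp

lemma power_time_gt: "real n powr t < real (power_time n t) + 1"
  by simp

lemma power_time_mono: "s \<le> t \<Longrightarrow> power_time n s \<le> power_time n t"
  by (cases "n = 0") (auto intro!: nat_mono floor_mono powr_mono)

lemma ln_at_top_seq: "filterlim (\<lambda>n. ln (real n)) at_top sequentially"
  by (rule filterlim_compose[OF ln_at_top filterlim_real_sequentially])

lemma ln_power_time:
  assumes "0 \<le> t"
  shows "(\<lambda>n. ln (real (power_time n t)) / ln (real n)) \<longlonglongrightarrow> t"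
proof (rule tendsto_sandwich)
  have "(\<lambda>n. t - ln 2 / ln (real n)) \<longlonglongrightarrow> t - 0"
    by (intro tendsto_diff tendsto_const real_tendsto_divide_at_top[OF tendsto_const ln_at_top_seq])
  then show "(\<lambda>n. t - ln 2 / ln (real n)) \<longlonglongrightarrow> t" by simp
  show "\<forall>\<^sub>F n in sequentially. t - ln 2 / ln (real n) \<le> ln (real (power_time n t)) / ln (real n)"
    using eventually_gt_at_top[of 1]
  proof eventually_elim
    case (elim n)
    have p: "real (power_time n t) \<ge> 1" using power_time_ge_1[of n t] assms elim by linarith
    then have "real n powr t / 2 \<le> real (power_time n t)" using power_time_gt[of n t] by linarith
    then have "ln (real n powr t / 2) \<le> ln (real (power_time n t))"
      using elim p by (subst ln_le_cancel_iff) auto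
    then have "t * ln (real n) - ln 2 \<le> ln (real (power_time n t))"
      using elim by (simp add: ln_div ln_powr)
    moreover have ln0: "0 < ln (real n)" using elim by simp
    ultimately have "(t * ln (real n) - ln 2) / ln (real n) \<le> ln (real (power_time n t)) / ln (real n)"
      by (intro divide_right_mono) auto
    then show ?case using ln0 by (simp only: diff_divide_distrib) simp
  qed
  show "\<forall>\<^sub>F n in sequentially. ln (real (power_time n t)) / ln (real n) \<le> t"
    using eventually_gt_at_top[of 1]
  proof eventually_elim
    case (elim n)
    have "ln (real (power_time n t)) \<le> ln (real n powr t)"
    proof (rule ln_mono)
      show "0 < real (power_time n t)" using power_time_ge_1[of n t] assms elim by linarith
    qed (rule power_time_le)
    moreover have ln0: "0 < ln (real n)" using elim by simp
    ultimately have "ln (real (power_time n t)) / ln (real n) \<le> t * ln (real n) / ln (real n)"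
      using elim by (intro divide_right_mono) (auto simp: ln_powr)
    then show ?case using ln0 by simp
  qed
qed simp

lemma power_time_at_top: "0 < t \<Longrightarrow> filterlim (\<lambda>n. power_time n t) at_top sequentially"
proof -
  assume t: "0 < t"
  have "filterlim (\<lambda>n. exp (t * ln (real n))) at_top sequentially"
    by (rule filterlim_compose[OF exp_at_top filterlim_tendsto_pos_mult_at_top[OF tendsto_const t ln_at_top_seq]])
  moreover have "\<forall>\<^sub>F n in sequentially. exp (t * ln (real n)) = real n powr t"
    using eventually_gt_at_top[of 0] by eventually_elim (simp add: powr_def)
  ultimately have "filterlim (\<lambda>n. real n powr t) at_top sequentially"
    by (simp add: filterlim_cong)
  then show ?thesis
    by (intro filterlim_compose[OF filterlim_nat_sequentially] filterlim_compose[OF filterlim_floor_sequentially])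
qed

text \<open>In the scale \<open>n\<^sup>t\<close> logarithmic averages become linear in \<open>t\<close>. This is where the time
  change of the limit theorem comes from.\<close>

lemma logarithmic_average_power_time:
  fixes x :: "nat \<Rightarrow> real"
  assumes x: "x \<longlonglongrightarrow> l" and t: "0 \<le> t"
  shows "(\<lambda>n. (\<Sum>j=1..power_time n t. x j / real j) / ln (real n)) \<longlonglongrightarrow> l * t"
proof (cases "t = 0")
  case True
  have "(\<lambda>n. (\<Sum>j=1..1. x j / real j) / ln (real n)) \<longlonglongrightarrow> 0"
    by (rule real_tendsto_divide_at_top[OF tendsto_const ln_at_top_seq])
  moreover have "\<forall>\<^sub>F n in sequentially. (\<Sum>j=1..1. x j / real j) / ln (real n) =
      (\<Sum>j=1..power_time n t. x j / real j) / ln (real n)"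
    using eventually_gt_at_top[of 0] by eventually_elim (simp add: True)
  ultimately show ?thesis using True Lim_transform_eventually by fastforce
next
  case False
  with t have t: "0 < t" by simp
  from tendsto_mult[OF filterlim_compose[OF logarithmic_average[OF x] power_time_at_top[OF t]] ln_power_time[OF less_imp_le[OF t]]]
  have "(\<lambda>n. (\<Sum>j=1..power_time n t. x j / real j) / ln (real (power_time n t)) *
      (ln (real (power_time n t)) / ln (real n))) \<longlonglongrightarrow> l * t" .
  moreover have "\<forall>\<^sub>F n in sequentially.
      (\<Sum>j=1..power_time n t. x j / real j) / ln (real (power_time n t)) *
      (ln (real (power_time n t)) / ln (real n)) = (\<Sum>j=1..power_time n t. x j / real j) / ln (real n)"
    using filterlim_at_top[THEN iffD1, OF power_time_at_top[OF t], rule_format, of 2]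
  proof eventually_elim
    case (elim n)
    then have "0 < ln (real (power_time n t))" by (intro ln_gt_zero) linarith
    moreover have "a / p * (p / l) = a / l" if "0 < p" for a p l :: real using that by simp
    ultimately show ?case by blast
  qed
  ultimately show ?thesis by (rule Lim_transform_eventually)
qed

text \<open>The solution of the noiseless critical recursion \<open>a (n + 1) = (1 + 1 / (2 n)) a n\<close>.\<close>

definition critical_growth :: "nat \<Rightarrow> real" where
  "critical_growth n = (\<Prod>k\<in>{1..<n}. 1 + 1 / (2 * real k))"

lemma critical_growth_1 [simp]: "critical_growth 1 = 1" "critical_growth (Suc 0) = 1"
  by (simp_all add: critical_growth_def)

lemma critical_growth_Suc:
  "n \<ge> 1 \<Longrightarrow> critical_growth (Suc n) = (1 + 1 / (2 * real n)) * critical_growth n"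
  by (simp add: critical_growth_def mult.commute)

lemma critical_growth_ge_1: "1 \<le> critical_growth n"
  unfolding critical_growth_def by (intro prod_ge_1) auto

lemma critical_growth_pos: "0 < critical_growth n"
  using critical_growth_ge_1[of n] by linarith

lemma critical_growth_sq_step:
  assumes "n \<ge> 1"
  shows "critical_growth (Suc n) ^ 2 / real (Suc n) =
    (1 + 1 / (4 * real n * (real n + 1))) * (critical_growth n ^ 2 / real n)"
proof -
  have n: "real n > 0" using assms by simp
  have "(1 + 1 / (2 * real n)) ^ 2 / (real n + 1) = (1 + 1 / (4 * real n * (real n + 1))) / real n"
    using n by (simp add: divide_simps power2_eq_square) (simp add: algebra_simps)
  moreover have "critical_growth (Suc n) ^ 2 / real (Suc n) =
      (1 + 1 / (2 * real n)) ^ 2 / (real n + 1) * critical_growth n ^ 2"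
    unfolding critical_growth_Suc[OF assms] by (simp add: power_mult_distrib add.commute)
  ultimately show ?thesis by simp
qed

text \<open>The square of the growth is linear up to the convergent product of
  \<open>1 + 1 / (4 k (k + 1))\<close>, whose terms telescope in the bound.\<close>

lemma critical_growth_sq_bounds:
  assumes "n \<ge> 1"
  shows "1 \<le> critical_growth n ^ 2 / real n" "critical_growth n ^ 2 / real n \<le> 2 - 1 / real n"
proof -
  have "1 \<le> critical_growth n ^ 2 / real n \<and> critical_growth n ^ 2 / real n \<le> 2 - 1 / real n"
    using assms
  proof (induction n rule: dec_induct)
    case (step n)
    define u e where "u = critical_growth n ^ 2 / real n" and "e = 1 / (4 * real n * (real n + 1))"
    have n: "real n \<ge> 1" using step by simp
    have e: "0 \<le> e" by (simp add: e_def)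
    have u: "1 \<le> u" "u \<le> 2 - 1 / real n" using step by (auto simp: u_def)
    then have u2: "u \<le> 2" using n by (smt (verit) divide_nonneg_nonneg)
    have "e * u \<le> e * 2" using u2 e by (rule mult_left_mono)
    moreover have "e * 2 \<le> 1 / real n - 1 / (real n + 1)"
      using n by (simp add: divide_simps e_def)
    moreover have "0 \<le> e * u" using u e by simp
    ultimately show ?case unfolding critical_growth_sq_step[OF step(1)] u_def[symmetric] e_def[symmetric] using u
      unfolding distrib_right of_nat_Suc add.commute[of 1 "real n"] by linarith
  qed simp
  then show "1 \<le> critical_growth n ^ 2 / real n" "critical_growth n ^ 2 / real n \<le> 2 - 1 / real n"
    by auto
qed

definition growth_constant :: real where
  "growth_constant = lim (\<lambda>n. critical_growth n ^ 2 / real n)"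

lemma critical_growth_sq_limit:
  "(\<lambda>n. critical_growth n ^ 2 / real n) \<longlonglongrightarrow> growth_constant"
proof -
  have le: "critical_growth (Suc n) ^ 2 / real (Suc n) \<le> 2" for n
  proof -
    have "0 \<le> 1 / real (Suc n)" by simp
    then show ?thesis using critical_growth_sq_bounds(2)[of "Suc n"] by linarith
  qed
  have "convergent (\<lambda>n. critical_growth (Suc n) ^ 2 / real (Suc n))"
  proof (rule Bseq_monoseq_convergent)
    show "Bseq (\<lambda>n. critical_growth (Suc n) ^ 2 / real (Suc n))"
      using le by (intro BseqI'[of _ 2]) simp
    show "monoseq (\<lambda>n. critical_growth (Suc n) ^ 2 / real (Suc n))"
    proof (intro mono_SucI1 allI)
      fix n
      have "0 \<le> critical_growth (Suc n) ^ 2 / real (Suc n)" by simp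
      moreover have "1 \<le> 1 + 1 / (4 * real (Suc n) * (real (Suc n) + 1))" by simp
      ultimately show "critical_growth (Suc n) ^ 2 / real (Suc n) \<le> critical_growth (Suc (Suc n)) ^ 2 / real (Suc (Suc n))"
        unfolding critical_growth_sq_step[of "Suc n", OF le_add1[of 1 n, unfolded plus_1_eq_Suc]]
        by (metis mult_right_mono mult_1)
    qed
  qed
  then show ?thesis
    unfolding growth_constant_def convergent_LIMSEQ_iff[symmetric]
    by (subst (asm) convergent_Suc_iff)
qed

lemma growth_constant_bounds: "1 \<le> growth_constant" "growth_constant \<le> 2"
proof -
  show "1 \<le> growth_constant"
    by (rule LIMSEQ_le_const[OF critical_growth_sq_limit]) (use critical_growth_sq_bounds in blast)
  show "growth_constant \<le> 2"
    by (rule LIMSEQ_le_const2[OF critical_growth_sq_limit])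
       (use critical_growth_sq_bounds in \<open>smt (verit) divide_nonneg_nonneg of_nat_0_le_iff\<close>)
qed

lemma critical_growth_limit: "(\<lambda>n. critical_growth n / sqrt (real n)) \<longlonglongrightarrow> sqrt growth_constant"
  using tendsto_real_sqrt[OF critical_growth_sq_limit] critical_growth_pos
  by (simp add: real_sqrt_divide less_imp_le)

lemma sum_inverse_growth_sq:
  assumes x: "x \<longlonglongrightarrow> l" and t: "0 \<le> t"
  shows "(\<lambda>n. (\<Sum>j=1..power_time n t. x j / critical_growth j ^ 2) / ln (real n))
           \<longlonglongrightarrow> l * t / growth_constant"
proof -
  have "(\<lambda>j. x j / (critical_growth j ^ 2 / real j)) \<longlonglongrightarrow> l / growth_constant"
    using growth_constant_bounds by (intro tendsto_divide x critical_growth_sq_limit) auto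
  from logarithmic_average_power_time[OF this t]
  have "(\<lambda>n. (\<Sum>j=1..power_time n t. x j / (critical_growth j ^ 2 / real j) / real j) / ln (real n))
           \<longlonglongrightarrow> l * t / growth_constant" by simp
  moreover have "(\<Sum>j=1..N. x j / (critical_growth j ^ 2 / real j) / real j) =
      (\<Sum>j=1..N. x j / critical_growth j ^ 2)" for N
    by (intro sum.cong) auto
  ultimately show ?thesis by simp
qed

text \<open>Subtracting a small constant from \<open>z\<close> absorbs the perturbation, and the positive part of the difference
  is then dominated by \<open>critical_growth n / n\<close>, which solves the homogeneous recursion.\<close>

lemma perturbed_recursion_null:
  fixes z \<delta> :: "nat \<Rightarrow> real"
  assumes rec: "\<And>n. n \<ge> 1 \<Longrightarrow>
      z (Suc n) \<le> (1 - 1 / (2 * (real n + 1))) * z n + \<delta> (Suc n) / (real n + 1)"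
    and z0: "\<And>n. 0 \<le> z n" and \<delta>: "\<delta> \<longlonglongrightarrow> 0"
  shows "z \<longlonglongrightarrow> 0"
proof (rule LIMSEQ_I)
  fix e :: real assume e: "0 < e"
  obtain n0 where n0: "\<And>n. n \<ge> n0 \<Longrightarrow> \<bar>\<delta> n\<bar> < e / 4"
    using LIMSEQ_D[OF \<delta>, of "e / 4"] e by auto
  define m where "m = max n0 1"
  define w where "w n = max (z n - e / 2) 0" for n
  define C where "C = real m * w m / critical_growth m"
  have w: "real n * w n / critical_growth n \<le> C" if "n \<ge> m" for n
    using that
  proof (induction n rule: dec_induct)
    case (step n)
    have n1: "real n \<ge> 1" and n: "n \<ge> 1" and "Suc n \<ge> n0" using step unfolding m_def by auto
    let ?q = "1 - 1 / (2 * (real n + 1))"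
    have q: "0 \<le> ?q" using n1 by (simp add: field_simps)
    have "\<delta> (Suc n) / (real n + 1) \<le> (e / 4) / (real n + 1)"
      using n0[OF \<open>Suc n \<ge> n0\<close>] by (intro divide_right_mono) auto
    moreover have "(e / 4) / (real n + 1) = 1 / (2 * (real n + 1)) * (e / 2)" by simp
    ultimately have "z (Suc n) - e / 2 \<le> ?q * (z n - e / 2)"
      using rec[OF n] by (simp only: left_diff_distrib right_diff_distrib mult_1)
    also have "\<dots> \<le> ?q * w n" using q by (intro mult_left_mono) (auto simp: w_def)
    finally have "w (Suc n) \<le> ?q * w n"
      using q unfolding w_def by (auto simp: mult_nonneg_nonneg)
    then have "(real n + 1) * w (Suc n) \<le> (real n + 1) * (?q * w n)"
      by (intro mult_left_mono) auto
    also have "\<dots> = (real n + 1 / 2) * w n" using n1 by (simp add: field_simps)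
    finally have *: "(real n + 1) * w (Suc n) \<le> (real n + 1 / 2) * w n" .
    have g: "critical_growth (Suc n) = (real n + 1 / 2) / real n * critical_growth n"
      unfolding critical_growth_Suc[OF n] using n1 by (simp add: field_simps)
    have "real (Suc n) * w (Suc n) / critical_growth (Suc n) \<le> (real n + 1 / 2) * w n / critical_growth (Suc n)"
      using * critical_growth_pos[of "Suc n"] by (intro divide_right_mono) (auto simp: add.commute)
    also have "\<dots> = real n * w n / critical_growth n"
    proof -
      have "real n + 1 / 2 \<noteq> 0" "real n \<noteq> 0" using n1 by auto
      then show ?thesis unfolding g by (simp del: of_nat_Suc)
    qed
    finally show ?case using step.IH by linarith
  qed (simp add: C_def)
  have "(\<lambda>n. C * (critical_growth n / sqrt (real n)) * (1 / sqrt (real n))) \<longlonglongrightarrow> C * sqrt growth_constant * 0"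
    by (intro tendsto_mult tendsto_const critical_growth_limit real_tendsto_divide_at_top[OF tendsto_const]
         filterlim_compose[OF sqrt_at_top filterlim_real_sequentially])
  then have "(\<lambda>n. C * critical_growth n / real n) \<longlonglongrightarrow> 0"
    by (simp add: field_simps)
  from LIMSEQ_D[OF this, of "e / 2"] e
  obtain n1 where n1: "\<And>n. n \<ge> n1 \<Longrightarrow> \<bar>C * critical_growth n / real n\<bar> < e / 2" by auto
  show "\<exists>no. \<forall>n\<ge>no. norm (z n - 0) < e"
  proof (intro exI allI impI)
    fix n assume n: "n \<ge> max m n1"
    have "real n > 0" using n unfolding m_def by auto
    then have "w n \<le> C * critical_growth n / real n"
      using w[of n] n critical_growth_pos[of n] by (simp add: field_simps)
    moreover have "\<bar>C * critical_growth n / real n\<bar> < e / 2" using n1 n by simp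
    ultimately have "w n < e / 2" by linarith
    then show "norm (z n - 0) < e" using z0[of n] by (simp add: w_def max_def split: if_splits)
  qed
qed

section \<open>Joint convergence from conditional characteristic functions\<close>

text \<open>This is Levy's continuity theorem, applied to the laws of \<open>V n\<close> under the changed measures with
  densities \<open>W n\<close>.\<close>

lemma (in prob_space) weighted_levy_continuity:
  fixes W V :: "nat \<Rightarrow> 'a \<Rightarrow> real" and h :: "real \<Rightarrow> real"
  assumes [measurable]: "\<And>n. W n \<in> borel_measurable M" "\<And>n. V n \<in> borel_measurable M"
    and W0: "\<And>n \<omega>. \<omega> \<in> space M \<Longrightarrow> 0 \<le> W n \<omega>"
    and W_int: "\<And>n. integrable M (W n)" and W1: "\<And>n. expectation (W n) = 1"
    and \<mu>: "real_distribution \<mu>"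
    and ch: "\<And>u. (\<lambda>n. expectation (\<lambda>\<omega>. of_real (W n \<omega>) * iexp (u * V n \<omega>))) \<longlonglongrightarrow> char \<mu> u"
    and h: "continuous_on UNIV h" "\<And>x. \<bar>h x\<bar> \<le> B"
  shows "(\<lambda>n. expectation (\<lambda>\<omega>. W n \<omega> * h (V n \<omega>))) \<longlonglongrightarrow> (\<integral>x. h x \<partial>\<mu>)"
proof -
  define Q where "Q n = density M (\<lambda>\<omega>. ennreal (W n \<omega>))" for n
  have W0': "AE \<omega> in M. 0 \<le> W n \<omega>" for n using W0 by auto
  have Q: "prob_space (Q n)" for n
  proof
    have "emeasure (Q n) (space (Q n)) = (\<integral>\<^sup>+\<omega>. ennreal (W n \<omega>) \<partial>M)"
      unfolding Q_def by (simp add: emeasure_density cong: nn_integral_cong)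
    also have "\<dots> = ennreal (expectation (W n))"
      by (rule nn_integral_eq_integral[OF W_int W0'])
    finally show "emeasure (Q n) (space (Q n)) = 1" by (simp add: W1)
  qed
  have [measurable]: "V n \<in> borel_measurable (Q n)" for n unfolding Q_def by simp
  have h_m [measurable]: "h \<in> borel_measurable borel"
    by (rule borel_measurable_continuous_onI[OF h(1)])
  have rd: "real_distribution (distr (Q n) borel (V n))" for n
    unfolding real_distribution_def real_distribution_axioms_def
    using prob_space.prob_space_distr[OF Q[of n], of "V n" borel] by simp
  have char_eq: "char (distr (Q n) borel (V n)) u =
      expectation (\<lambda>\<omega>. of_real (W n \<omega>) * iexp (u * V n \<omega>))" for n u
  proof -
    have "char (distr (Q n) borel (V n)) u = (\<integral>\<omega>. iexp (u * V n \<omega>) \<partial>Q n)"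
      unfolding char_def by (rule integral_distr) auto
    also have "\<dots> = expectation (\<lambda>\<omega>. W n \<omega> *\<^sub>R iexp (u * V n \<omega>))"
      unfolding Q_def by (rule integral_density[OF _ _ W0']) auto
    finally show ?thesis by (simp add: scaleR_conv_of_real)
  qed
  have int_eq: "(\<integral>x. h x \<partial>distr (Q n) borel (V n)) = expectation (\<lambda>\<omega>. W n \<omega> * h (V n \<omega>))" for n
  proof -
    have "(\<integral>x. h x \<partial>distr (Q n) borel (V n)) = (\<integral>\<omega>. h (V n \<omega>) \<partial>Q n)"
      by (rule integral_distr) auto
    also have "\<dots> = expectation (\<lambda>\<omega>. W n \<omega> *\<^sub>R h (V n \<omega>))"
      unfolding Q_def by (rule integral_density[OF _ _ W0']) auto
    finally show ?thesis by simp
  qed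
  have "weak_conv_m (\<lambda>n. distr (Q n) borel (V n)) \<mu>"
    by (rule levy_continuity[OF rd \<mu>]) (use ch in \<open>simp add: char_eq\<close>)
  from weak_conv_imp_integral_bdd_continuous_conv[OF rd \<mu> this, of h B] h
  show ?thesis unfolding int_eq by (simp add: continuous_on_eq_continuous_at)
qed

text \<open>The weight \<open>1 + Z n\<close> instead of \<open>Z n\<close> keeps the densities normalizable also when the
  expectation of \<open>Z n\<close> vanishes.\<close>

lemma (in prob_space) weighted_convergence:
  fixes Z V :: "nat \<Rightarrow> 'a \<Rightarrow> real" and h :: "real \<Rightarrow> real"
  assumes [measurable]: "\<And>n. Z n \<in> borel_measurable M" "\<And>n. V n \<in> borel_measurable M"
    and Z: "\<And>n \<omega>. \<omega> \<in> space M \<Longrightarrow> 0 \<le> Z n \<omega> \<and> Z n \<omega> \<le> 1"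
    and z: "(\<lambda>n. expectation (Z n)) \<longlonglongrightarrow> z"
    and \<mu>: "real_distribution \<mu>"
    and ch: "\<And>u. (\<lambda>n. expectation (\<lambda>\<omega>. of_real (Z n \<omega>) * iexp (u * V n \<omega>))
                 - of_real (expectation (Z n)) * char \<mu> u) \<longlonglongrightarrow> 0"
    and ch1: "\<And>u. (\<lambda>n. expectation (\<lambda>\<omega>. iexp (u * V n \<omega>))) \<longlonglongrightarrow> char \<mu> u"
    and h: "continuous_on UNIV h" "\<And>x. \<bar>h x\<bar> \<le> B"
  shows "(\<lambda>n. expectation (\<lambda>\<omega>. Z n \<omega> * h (V n \<omega>))) \<longlonglongrightarrow> z * (\<integral>x. h x \<partial>\<mu>)"
proof -
  have Zi: "integrable M (Z n)" for n
    by (rule integrable_const_bound[of _ 1]) (use Z in auto)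
  define e where "e n = 1 + expectation (Z n)" for n
  have e: "e n \<ge> 1" for n
    unfolding e_def using integral_nonneg_AE[of "Z n" M] Z by auto
  have elim: "e \<longlonglongrightarrow> 1 + z" unfolding e_def[abs_def] by (intro tendsto_intros z)
  have z1: "1 + z \<ge> 1" by (rule LIMSEQ_le_const[OF elim]) (use e in auto)
  have h_m [measurable]: "h \<in> borel_measurable borel"
    by (rule borel_measurable_continuous_onI[OF h(1)])
  have one: "(\<lambda>n. expectation (\<lambda>\<omega>. h (V n \<omega>))) \<longlonglongrightarrow> (\<integral>x. h x \<partial>\<mu>)"
    using weighted_levy_continuity[of "\<lambda>_ _. 1" V \<mu> h B, OF _ _ _ _ _ \<mu> _ h] ch1
    by (simp add: prob_space)
  have "(\<lambda>n. expectation (\<lambda>\<omega>. (1 + Z n \<omega>) / e n * h (V n \<omega>))) \<longlonglongrightarrow> (\<integral>x. h x \<partial>\<mu>)"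
  proof (rule weighted_levy_continuity[OF _ _ _ _ _ \<mu> _ h])
    show "0 \<le> (1 + Z n \<omega>) / e n" if "\<omega> \<in> space M" for n \<omega>
      using Z[OF that, of n] e[of n] by simp
    show "integrable M (\<lambda>\<omega>. (1 + Z n \<omega>) / e n)" for n using Zi by simp
    show "expectation (\<lambda>\<omega>. (1 + Z n \<omega>) / e n) = 1" for n
      using Zi e[of n] by (simp add: prob_space e_def)
    fix u
    let ?E1 = "\<lambda>n. expectation (\<lambda>\<omega>. iexp (u * V n \<omega>))"
    let ?EZ = "\<lambda>n. expectation (\<lambda>\<omega>. of_real (Z n \<omega>) * iexp (u * V n \<omega>))"
    have split: "expectation (\<lambda>\<omega>. of_real ((1 + Z n \<omega>) / e n) * iexp (u * V n \<omega>)) =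
        char \<mu> u + ((?E1 n - char \<mu> u) + (?EZ n - of_real (expectation (Z n)) * char \<mu> u)) / of_real (e n)" for n
    proof -
      have i1: "complex_integrable M (\<lambda>\<omega>. iexp (u * V n \<omega>))"
        by (rule integrable_const_bound[of _ 1]) auto
      have i2: "complex_integrable M (\<lambda>\<omega>. of_real (Z n \<omega>) * iexp (u * V n \<omega>))"
        by (rule integrable_const_bound[of _ 1]) (use Z in \<open>auto simp: norm_mult\<close>)
      have "(\<lambda>\<omega>. of_real ((1 + Z n \<omega>) / e n) * iexp (u * V n \<omega>)) =
          (\<lambda>\<omega>. (iexp (u * V n \<omega>) + of_real (Z n \<omega>) * iexp (u * V n \<omega>)) / of_real (e n))"
        by (auto simp: field_simps)
      then have "expectation (\<lambda>\<omega>. of_real ((1 + Z n \<omega>) / e n) * iexp (u * V n \<omega>)) =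
          (?E1 n + ?EZ n) / of_real (e n)"
        using i1 i2 by simp
      moreover have "complex_of_real (e n) \<noteq> 0" using e[of n] by auto
      moreover have "complex_of_real (e n) = 1 + of_real (expectation (Z n))" by (simp add: e_def)
      ultimately show ?thesis by (simp add: field_simps)
    qed
    have "(\<lambda>n. char \<mu> u + ((?E1 n - char \<mu> u) + (?EZ n - of_real (expectation (Z n)) * char \<mu> u)) / of_real (e n))
       \<longlonglongrightarrow> char \<mu> u + ((char \<mu> u - char \<mu> u) + 0) / of_real (1 + z)"
    proof (intro tendsto_intros ch1 ch elim)
      show "complex_of_real (1 + z) \<noteq> 0" using z1 by (simp only: of_real_eq_0_iff)
    qed
    then show "(\<lambda>n. expectation (\<lambda>\<omega>. of_real ((1 + Z n \<omega>) / e n) * iexp (u * V n \<omega>))) \<longlonglongrightarrow> char \<mu> u"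
      unfolding split by simp
  qed auto
  from tendsto_diff[OF tendsto_mult[OF elim this] one]
  have "(\<lambda>n. e n * expectation (\<lambda>\<omega>. (1 + Z n \<omega>) / e n * h (V n \<omega>)) - expectation (\<lambda>\<omega>. h (V n \<omega>)))
     \<longlonglongrightarrow> z * (\<integral>x. h x \<partial>\<mu>)"
    by (simp add: algebra_simps)
  moreover have "e n * expectation (\<lambda>\<omega>. (1 + Z n \<omega>) / e n * h (V n \<omega>)) - expectation (\<lambda>\<omega>. h (V n \<omega>))
     = expectation (\<lambda>\<omega>. Z n \<omega> * h (V n \<omega>))" for n
  proof -
    have i1: "integrable M (\<lambda>\<omega>. h (V n \<omega>))"
      by (rule integrable_const_bound[of _ B]) (use h in auto)
    have i2: "integrable M (\<lambda>\<omega>. Z n \<omega> * h (V n \<omega>))"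
    proof (rule integrable_const_bound[of _ "1 * B"])
      show "AE \<omega> in M. norm (Z n \<omega> * h (V n \<omega>)) \<le> 1 * B"
        unfolding real_norm_def abs_mult using Z h(2) by (intro AE_I2 mult_mono) auto
    qed auto
    have "(\<lambda>\<omega>. (1 + Z n \<omega>) / e n * h (V n \<omega>)) = (\<lambda>\<omega>. (h (V n \<omega>) + Z n \<omega> * h (V n \<omega>)) / e n)"
      by (auto simp: field_simps)
    then show ?thesis using i1 i2 e[of n] by simp
  qed
  ultimately show ?thesis by simp
qed

text \<open>Multiplying one factor at a time, the product of the earlier factors serves as the weight for the
  next one. In this way the limits of the products are determined by one-dimensional characteristic
  functions.\<close>

lemma (in prob_space) product_convergence:
  fixes V :: "nat \<Rightarrow> nat \<Rightarrow> 'a \<Rightarrow> real" and \<mu> :: "nat \<Rightarrow> real measure"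
  assumes [measurable]: "\<And>n i. V n i \<in> borel_measurable M"
    and \<mu>: "\<And>i. real_distribution (\<mu> i)"
    and ch: "\<And>h i u. (\<And>j. continuous_on UNIV (h j)) \<Longrightarrow> (\<And>j x. 0 \<le> h j x \<and> h j x \<le> 1) \<Longrightarrow>
       (\<lambda>n. expectation (\<lambda>\<omega>. of_real (\<Prod>j<i. h j (V n j \<omega>)) * iexp (u * V n i \<omega>))
            - of_real (expectation (\<lambda>\<omega>. \<Prod>j<i. h j (V n j \<omega>))) * char (\<mu> i) u) \<longlonglongrightarrow> 0"
    and h: "\<And>j. continuous_on UNIV (h j)" "\<And>j x. 0 \<le> h j x \<and> h j x \<le> (1 :: real)"
  shows "(\<lambda>n. expectation (\<lambda>\<omega>. \<Prod>i<K. h i (V n i \<omega>))) \<longlonglongrightarrow> (\<Prod>i<K. \<integral>x. h i x \<partial>\<mu> i)"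
proof (induction K)
  case (Suc K)
  have [measurable]: "h j \<in> borel_measurable borel" for j
    by (rule borel_measurable_continuous_onI[OF h(1)])
  have ch1: "(\<lambda>n. expectation (\<lambda>\<omega>. iexp (u * V n K \<omega>))) \<longlonglongrightarrow> char (\<mu> K) u" for u
    using ch[of "\<lambda>_ _. 1" K u] by (simp add: prob_space LIM_zero_iff)
  have "(\<lambda>n. expectation (\<lambda>\<omega>. (\<Prod>i<K. h i (V n i \<omega>)) * h K (V n K \<omega>)))
     \<longlonglongrightarrow> (\<Prod>i<K. \<integral>x. h i x \<partial>\<mu> i) * (\<integral>x. h K x \<partial>\<mu> K)"
  proof (rule weighted_convergence[where h = "h K" and B = 1, OF _ _ _ Suc \<mu> ch ch1])
    show "0 \<le> (\<Prod>i<K. h i (V n i \<omega>)) \<and> (\<Prod>i<K. h i (V n i \<omega>)) \<le> 1" for n \<omega>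
      using h(2) by (auto intro!: prod_nonneg prod_le_1)
    show "\<bar>h K x\<bar> \<le> 1" for x using h(2)[of K x] by auto
  qed (use h in auto)
  then show ?case by simp
qed (simp add: prob_space)

section \<open>From products to Lipschitz functions of several variables\<close>

definition ramp :: "real \<Rightarrow> real" where
  "ramp x = min 1 (max 0 x)"

text \<open>Tent functions of half-width \<open>1 / s\<close> centred at the grid point \<open>i / s - s\<close>, written as
  differences of ramps so that their sum telescopes.\<close>

definition tent :: "nat \<Rightarrow> nat \<Rightarrow> real \<Rightarrow> real" where
  "tent s i x = ramp (real s * x + real s ^ 2 - real i + 1) - ramp (real s * x + real s ^ 2 - real (Suc i) + 1)"

lemma ramp_mono: "x \<le> y \<Longrightarrow> ramp x \<le> ramp y"
  by (auto simp: ramp_def)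

lemma ramp_range: "0 \<le> ramp x" "ramp x \<le> 1"
  by (auto simp: ramp_def)

lemma tent_nonneg: "0 \<le> tent s i x"
  unfolding tent_def using ramp_mono by simp

lemma tent_le_1: "tent s i x \<le> 1"
  unfolding tent_def using ramp_range by (smt (verit))

lemma continuous_on_tent: "continuous_on UNIV (tent s i)"
  unfolding tent_def ramp_def by (intro continuous_intros)

lemma tent_support:
  assumes "s > 0" "tent s i x \<noteq> 0"
  shows "\<bar>x - (real i / real s - real s)\<bar> \<le> 1 / real s"
proof -
  have "\<bar>real s * x + real s ^ 2 - real i\<bar> \<le> 1"
    using assms(2) unfolding tent_def ramp_def by (auto split: if_splits simp: min_def max_def)
  moreover have "real s * x + real s ^ 2 - real i = real s * (x - (real i / real s - real s))"
    using assms(1) by (simp add: field_simps power2_eq_square)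
  ultimately have "real s * \<bar>x - (real i / real s - real s)\<bar> \<le> 1"
    by (simp add: abs_mult)
  then show ?thesis using assms(1) by (simp add: field_simps)
qed

lemma sum_tent:
  "(\<Sum>i<2 * s\<^sup>2 + 1. tent s i x) = ramp (real s * x + real s ^ 2 + 1) - ramp (real s * x - real s ^ 2)"
  unfolding tent_def
  using sum_lessThan_telescope'[of "\<lambda>i. ramp (real s * x + real s ^ 2 - real i + 1)" "2 * s\<^sup>2 + 1"]
  by (simp add: algebra_simps)

lemma sum_tent_le_1: "(\<Sum>i<2 * s\<^sup>2 + 1. tent s i x) \<le> 1"
  unfolding sum_tent using ramp_range by (smt (verit))

lemma sum_tent_eq_1:
  assumes "\<bar>x\<bar> \<le> real s"
  shows "(\<Sum>i<2 * s\<^sup>2 + 1. tent s i x) = 1"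
proof -
  have "\<bar>real s * x\<bar> \<le> real s ^ 2"
    using assms mult_left_mono[of "\<bar>x\<bar>" "real s" "real s"] by (simp add: abs_mult power2_eq_square)
  then show ?thesis unfolding sum_tent by (auto simp: ramp_def)
qed

definition grid :: "nat \<Rightarrow> nat \<Rightarrow> (nat \<Rightarrow> nat) set" where
  "grid K s = PiE {..<K} (\<lambda>_. {..<2 * s\<^sup>2 + 1})"

definition tent_interpolation ::
  "nat \<Rightarrow> nat \<Rightarrow> ((nat \<Rightarrow> real) \<Rightarrow> real) \<Rightarrow> (nat \<Rightarrow> real) \<Rightarrow> real" where
  "tent_interpolation K s g v =
     (\<Sum>\<iota>\<in>grid K s. g (\<lambda>i. real (\<iota> i) / real s - real s) * (\<Prod>i<K. tent s (\<iota> i) (v i)))"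

lemma sum_grid: "(\<Sum>\<iota>\<in>grid K s. \<Prod>i<K. tent s (\<iota> i) (v i)) = (\<Prod>i<K. \<Sum>j<2 * s\<^sup>2 + 1. tent s j (v i))"
  unfolding grid_def by (rule prod_sum_PiE[symmetric]) auto

lemma tent_product_nonneg: "0 \<le> (\<Prod>i<K. tent s (\<iota> i) (v i))"
  by (intro prod_nonneg) (simp add: tent_nonneg)

lemma tent_interpolation_bound:
  assumes "\<And>v. \<bar>g v\<bar> \<le> C"
  shows "\<bar>tent_interpolation K s g v\<bar> \<le> C"
proof -
  have C: "0 \<le> C" using assms[of undefined] by linarith
  have "\<bar>tent_interpolation K s g v\<bar> \<le> (\<Sum>\<iota>\<in>grid K s. C * (\<Prod>i<K. tent s (\<iota> i) (v i)))"
    unfolding tent_interpolation_def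
    by (intro order_trans[OF sum_abs] sum_mono)
       (simp only: abs_mult abs_of_nonneg[OF tent_product_nonneg] mult_right_mono[OF assms tent_product_nonneg])
  also have "\<dots> = C * (\<Prod>i<K. \<Sum>j<2 * s\<^sup>2 + 1. tent s j (v i))"
    by (simp add: sum_distrib_left[symmetric] sum_grid)
  also have "\<dots> \<le> C * 1"
    using C sum_tent_le_1 tent_nonneg
    by (intro mult_left_mono prod_le_1 ballI conjI) (simp_all only: sum_nonneg)
  finally show ?thesis by simp
qed

text \<open>Inside the cube of half-width \<open>s\<close> the weights sum to one and only see nodes within \<open>1 / s\<close>.
  Outside, the quadratic term exceeds the trivial bound.\<close>

lemma tent_interpolation_error:
  assumes s: "s > 0" and gC: "\<And>v. \<bar>g v\<bar> \<le> C"
    and lip: "\<And>v w. \<bar>g v - g w\<bar> \<le> L * (\<Sum>i<K. \<bar>v i - w i\<bar>)" and L: "0 \<le> L"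
  shows "\<bar>g v - tent_interpolation K s g v\<bar> \<le> L * real K / real s + 2 * C * (\<Sum>i<K. (v i / real s) ^ 2)"
proof (cases "\<forall>i<K. \<bar>v i\<bar> \<le> real s")
  case True
  let ?w = "\<lambda>\<iota>. \<Prod>i<K. tent s (\<iota> i) (v i)" and ?x = "\<lambda>\<iota> i. real (\<iota> i) / real s - real s"
  have one: "(\<Sum>\<iota>\<in>grid K s. ?w \<iota>) = 1"
    unfolding sum_grid using True by (intro prod.neutral ballI sum_tent_eq_1) simp
  have "\<bar>g v - tent_interpolation K s g v\<bar> = \<bar>\<Sum>\<iota>\<in>grid K s. (g v - g (?x \<iota>)) * ?w \<iota>\<bar>"
    unfolding tent_interpolation_def left_diff_distrib sum_subtractf sum_distrib_left[symmetric] one by simp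
  also have "\<dots> \<le> (\<Sum>\<iota>\<in>grid K s. L * real K / real s * ?w \<iota>)"
  proof (intro order_trans[OF sum_abs] sum_mono)
    fix \<iota>
    show "\<bar>(g v - g (?x \<iota>)) * ?w \<iota>\<bar> \<le> L * real K / real s * ?w \<iota>"
    proof (cases "?w \<iota> = 0")
      case False
      then have "tent s (\<iota> i) (v i) \<noteq> 0" if "i < K" for i using that by auto
      then have "(\<Sum>i<K. \<bar>v i - ?x \<iota> i\<bar>) \<le> (\<Sum>i<K. 1 / real s)"
        using tent_support[OF s] by (intro sum_mono) auto
      then have "L * (\<Sum>i<K. \<bar>v i - ?x \<iota> i\<bar>) \<le> L * (real K / real s)"
        using L by (intro mult_left_mono) auto
      then have "\<bar>g v - g (?x \<iota>)\<bar> \<le> L * real K / real s" using lip[of v "?x \<iota>"] by simp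
      then show ?thesis using tent_product_nonneg[of s \<iota> v K]
        by (simp only: abs_mult abs_of_nonneg[OF tent_product_nonneg]) (rule mult_right_mono)
    next
      case True
      then show ?thesis by (simp only: mult_zero_right abs_zero)
    qed
  qed
  also have "\<dots> = L * real K / real s" by (simp only: sum_distrib_left[symmetric] one mult_1_right)
  also have "\<dots> \<le> L * real K / real s + 2 * C * (\<Sum>i<K. (v i / real s) ^ 2)"
    using gC[of v] by (simp add: sum_nonneg)
  finally show ?thesis .
next
  case False
  then obtain i where i: "i < K" "real s < \<bar>v i\<bar>" by auto
  have C: "0 \<le> C" using gC[of v] by linarith
  have "1 \<le> (v i / real s) ^ 2"
    using i s by (metis abs_divide abs_of_nat less_eq_real_def of_nat_0_less_iff one_le_power pos_le_divide_eq mult_1 power2_abs)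
  also have "\<dots> \<le> (\<Sum>i<K. (v i / real s) ^ 2)"
    using i by (intro member_le_sum) auto
  finally have "2 * C * 1 \<le> 2 * C * (\<Sum>i<K. (v i / real s) ^ 2)"
    using C by (intro mult_left_mono) auto
  moreover have "0 \<le> L * real K / real s" using L by simp
  ultimately show ?thesis
    using gC[of v] tent_interpolation_bound[of g C K s v, OF gC] by linarith
qed

lemma lipschitz_function_measurable:
  fixes V :: "nat \<Rightarrow> 'a \<Rightarrow> real" and K :: nat
  assumes gC: "\<And>v. \<bar>g v\<bar> \<le> C"
    and lip: "\<And>v w. \<bar>g v - g w\<bar> \<le> L * (\<Sum>i<K. \<bar>v i - w i\<bar>)" and L: "0 \<le> L"
    and [measurable]: "\<And>i. i < K \<Longrightarrow> V i \<in> borel_measurable M"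
  shows "(\<lambda>\<omega>. g (\<lambda>i. V i \<omega>)) \<in> borel_measurable M"
proof (rule borel_measurable_LIMSEQ_real[where u = "\<lambda>s \<omega>. tent_interpolation K (Suc s) g (\<lambda>i. V i \<omega>)"])
  have [measurable]: "tent s i \<in> borel_measurable borel" for s i
    by (rule borel_measurable_continuous_onI[OF continuous_on_tent])
  show "(\<lambda>\<omega>. tent_interpolation K (Suc s) g (\<lambda>i. V i \<omega>)) \<in> borel_measurable M" for s
    unfolding tent_interpolation_def by measurable
  fix \<omega>
  let ?v = "\<lambda>i. V i \<omega>"
  have "(\<lambda>s. L * real K / real (Suc s) + 2 * C * (\<Sum>i<K. (?v i / real (Suc s)) ^ 2)) \<longlonglongrightarrow>
      0 + 2 * C * (\<Sum>i<K. 0 ^ 2)"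
    by (intro tendsto_intros tendsto_add tendsto_mult tendsto_sum tendsto_power
        LIMSEQ_Suc[OF lim_const_over_n])
  then have "(\<lambda>s. L * real K / real (Suc s) + 2 * C * (\<Sum>i<K. (?v i / real (Suc s)) ^ 2)) \<longlonglongrightarrow> 0" by simp
  then have "(\<lambda>s. g ?v - tent_interpolation K (Suc s) g ?v) \<longlonglongrightarrow> 0"
    by (rule Lim_null_comparison[rotated], intro always_eventually allI, unfold real_norm_def)
       (rule tent_interpolation_error[OF zero_less_Suc gC lip L])
  from tendsto_diff[OF tendsto_const[of "g ?v"] this]
  show "(\<lambda>s. tent_interpolation K (Suc s) g ?v) \<longlonglongrightarrow> g ?v" by simp
qed

lemma expectation_tent_interpolation_error:
  fixes V :: "nat \<Rightarrow> 'a \<Rightarrow> real" and K :: nat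
  assumes "prob_space M" and s: "s > 0" and gC: "\<And>v. \<bar>g v\<bar> \<le> C"
    and lip: "\<And>v w. \<bar>g v - g w\<bar> \<le> L * (\<Sum>i<K. \<bar>v i - w i\<bar>)" and L: "0 \<le> L"
    and V [measurable]: "\<And>i. i < K \<Longrightarrow> V i \<in> borel_measurable M"
    and sq: "\<And>i. i < K \<Longrightarrow> integrable M (\<lambda>\<omega>. V i \<omega> ^ 2)"
    and m: "\<And>i. i < K \<Longrightarrow> (\<integral>\<omega>. V i \<omega> ^ 2 \<partial>M) \<le> m"
  shows "\<bar>(\<integral>\<omega>. g (\<lambda>i. V i \<omega>) \<partial>M) - (\<integral>\<omega>. tent_interpolation K s g (\<lambda>i. V i \<omega>) \<partial>M)\<bar>
     \<le> L * real K / real s + 2 * C * (real K * m) / real s ^ 2"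
proof -
  interpret prob_space M by fact
  have C: "0 \<le> C" using gC[of undefined] by linarith
  have [measurable]: "tent s i \<in> borel_measurable borel" for s i
    by (rule borel_measurable_continuous_onI[OF continuous_on_tent])
  have [measurable]: "(\<lambda>\<omega>. tent_interpolation K s g (\<lambda>i. V i \<omega>)) \<in> borel_measurable M"
    unfolding tent_interpolation_def by measurable
  have [measurable]: "(\<lambda>\<omega>. g (\<lambda>i. V i \<omega>)) \<in> borel_measurable M"
    by (rule lipschitz_function_measurable[OF gC lip L V])
  have i1: "integrable M (\<lambda>\<omega>. g (\<lambda>i. V i \<omega>))"
    by (rule integrable_const_bound[of _ C]) (use gC in auto)
  have i2: "integrable M (\<lambda>\<omega>. tent_interpolation K s g (\<lambda>i. V i \<omega>))"
    by (rule integrable_const_bound[of _ C]) (use tent_interpolation_bound[OF gC] in auto)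
  have i3: "integrable M (\<lambda>\<omega>. \<Sum>i<K. (V i \<omega> / real s) ^ 2)"
    using sq by (auto simp: power_divide)
  have "\<bar>(\<integral>\<omega>. g (\<lambda>i. V i \<omega>) \<partial>M) - (\<integral>\<omega>. tent_interpolation K s g (\<lambda>i. V i \<omega>) \<partial>M)\<bar> =
      \<bar>\<integral>\<omega>. g (\<lambda>i. V i \<omega>) - tent_interpolation K s g (\<lambda>i. V i \<omega>) \<partial>M\<bar>"
    using i1 i2 by simp
  also have "\<dots> \<le> (\<integral>\<omega>. \<bar>g (\<lambda>i. V i \<omega>) - tent_interpolation K s g (\<lambda>i. V i \<omega>)\<bar> \<partial>M)"
    by (rule integral_abs_bound)
  also have "\<dots> \<le> (\<integral>\<omega>. L * real K / real s + 2 * C * (\<Sum>i<K. (V i \<omega> / real s) ^ 2) \<partial>M)"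
    using i1 i2 i3 by (intro integral_mono tent_interpolation_error[OF s gC lip L]) auto
  also have "\<dots> = L * real K / real s + 2 * C * (\<Sum>i<K. (\<integral>\<omega>. V i \<omega> ^ 2 \<partial>M) / real s ^ 2)"
    using i3 sq by (simp add: prob_space power_divide)
  also have "\<dots> \<le> L * real K / real s + 2 * C * (\<Sum>i<K. m / real s ^ 2)"
    using C m by (intro add_left_mono mult_left_mono sum_mono divide_right_mono) auto
  finally show ?thesis by simp
qed

text \<open>A linear combination of products of tents approximates a Lipschitz function up to an error that
  is controlled by second moments alone. The second moments control the mass far from the
  origin.\<close>

lemma lipschitz_convergence_from_products:
  fixes V :: "nat \<Rightarrow> nat \<Rightarrow> 'a \<Rightarrow> real" and G :: "nat \<Rightarrow> 'b \<Rightarrow> real"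
  assumes M: "prob_space M" and N: "prob_space N"
    and V [measurable]: "\<And>n i. V n i \<in> borel_measurable M" and G [measurable]: "\<And>i. G i \<in> borel_measurable N"
    and Vsq: "\<And>n i. integrable M (\<lambda>\<omega>. V n i \<omega> ^ 2)"
    and Vm: "\<And>i. i < K \<Longrightarrow> \<forall>\<^sub>F n in sequentially. (\<integral>\<omega>. V n i \<omega> ^ 2 \<partial>M) \<le> m"
    and Gsq: "\<And>i. integrable N (\<lambda>\<omega>. G i \<omega> ^ 2)"
    and Gm: "\<And>i. i < K \<Longrightarrow> (\<integral>\<omega>. G i \<omega> ^ 2 \<partial>N) \<le> m"
    and prods: "\<And>h. (\<And>j. continuous_on UNIV (h j)) \<Longrightarrow> (\<And>j x. 0 \<le> h j x \<and> h j x \<le> (1 :: real)) \<Longrightarrow>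
       (\<lambda>n. \<integral>\<omega>. (\<Prod>i<K. h i (V n i \<omega>)) \<partial>M) \<longlonglongrightarrow> (\<integral>\<omega>. (\<Prod>i<K. h i (G i \<omega>)) \<partial>N)"
    and gC: "\<And>v. \<bar>g v\<bar> \<le> C"
    and lip: "\<And>v w. \<bar>g v - g w\<bar> \<le> L * (\<Sum>i<K. \<bar>v i - w i\<bar>)" and L: "0 \<le> L"
  shows "(\<lambda>n. \<integral>\<omega>. g (\<lambda>i. V n i \<omega>) \<partial>M) \<longlonglongrightarrow> (\<integral>\<omega>. g (\<lambda>i. G i \<omega>) \<partial>N)"
proof -
  interpret M: prob_space M by fact
  interpret N: prob_space N by fact
  let ?err = "\<lambda>s. L * real K / real s + 2 * C * (real K * m) / real s ^ 2"
  have [measurable]: "tent s i \<in> borel_measurable borel" for s i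
    by (rule borel_measurable_continuous_onI[OF continuous_on_tent])
  have Mi: "integrable M (\<lambda>\<omega>. \<Prod>i<K. tent s (\<iota> i) (V n i \<omega>))" for s \<iota> n
    by (rule M.integrable_const_bound[of _ 1])
       (auto simp: abs_prod tent_nonneg tent_le_1 intro!: prod_le_1)
  have Ni: "integrable N (\<lambda>\<omega>. \<Prod>i<K. tent s (\<iota> i) (G i \<omega>))" for s \<iota>
    by (rule N.integrable_const_bound[of _ 1])
       (auto simp: abs_prod tent_nonneg tent_le_1 intro!: prod_le_1)
  have interp: "(\<lambda>n. \<integral>\<omega>. tent_interpolation K s g (\<lambda>i. V n i \<omega>) \<partial>M)
      \<longlonglongrightarrow> (\<integral>\<omega>. tent_interpolation K s g (\<lambda>i. G i \<omega>) \<partial>N)" for s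
  proof -
    have "(\<lambda>n. \<Sum>\<iota>\<in>grid K s. g (\<lambda>i. real (\<iota> i) / real s - real s) * (\<integral>\<omega>. (\<Prod>i<K. tent s (\<iota> i) (V n i \<omega>)) \<partial>M))
      \<longlonglongrightarrow> (\<Sum>\<iota>\<in>grid K s. g (\<lambda>i. real (\<iota> i) / real s - real s) * (\<integral>\<omega>. (\<Prod>i<K. tent s (\<iota> i) (G i \<omega>)) \<partial>N))"
      by (intro tendsto_sum tendsto_mult tendsto_const prods) (auto simp: continuous_on_tent tent_nonneg tent_le_1)
    then show ?thesis
      unfolding tent_interpolation_def using Mi Ni by simp
  qed
  show ?thesis
  proof (rule LIMSEQ_I)
    fix e :: real assume e: "0 < e"
    have "(\<lambda>s. ?err s) \<longlonglongrightarrow> 0 + 0"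
      by (intro tendsto_add lim_const_over_n real_tendsto_divide_at_top[OF tendsto_const]
          filterlim_pow_at_top filterlim_real_sequentially) auto
    then have "(\<lambda>s. ?err s) \<longlonglongrightarrow> 0" by simp
    then have "\<forall>\<^sub>F s in sequentially. ?err s < e / 3"
      by (rule order_tendstoD(2)) (use e in simp)
    then obtain s where s: "?err s < e / 3" "s > 0"
      using eventually_gt_at_top[of 0] eventually_conj eventually_happens by (metis (mono_tags, lifting) sequentially_bot)
    have "\<forall>\<^sub>F n in sequentially. norm ((\<integral>\<omega>. tent_interpolation K s g (\<lambda>i. V n i \<omega>) \<partial>M)
        - (\<integral>\<omega>. tent_interpolation K s g (\<lambda>i. G i \<omega>) \<partial>N)) < e / 3"
      using interp[of s, unfolded tendsto_iff dist_norm, rule_format, of "e / 3"] e by simp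
    moreover have "\<forall>\<^sub>F n in sequentially. \<forall>i\<in>{..<K}. (\<integral>\<omega>. V n i \<omega> ^ 2 \<partial>M) \<le> m"
      using Vm by (intro eventually_ball_finite) auto
    ultimately have "\<forall>\<^sub>F n in sequentially. norm ((\<integral>\<omega>. g (\<lambda>i. V n i \<omega>) \<partial>M) - (\<integral>\<omega>. g (\<lambda>i. G i \<omega>) \<partial>N)) < e"
    proof eventually_elim
      case (elim n)
      have "\<bar>(\<integral>\<omega>. g (\<lambda>i. V n i \<omega>) \<partial>M) - (\<integral>\<omega>. tent_interpolation K s g (\<lambda>i. V n i \<omega>) \<partial>M)\<bar> \<le> ?err s"
        using elim(2) by (intro expectation_tent_interpolation_error[OF M s(2) gC lip L] Vsq V) auto
      moreover have "\<bar>(\<integral>\<omega>. g (\<lambda>i. G i \<omega>) \<partial>N) - (\<integral>\<omega>. tent_interpolation K s g (\<lambda>i. G i \<omega>) \<partial>N)\<bar> \<le> ?err s"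
        by (intro expectation_tent_interpolation_error[OF N s(2) gC lip L] Gsq G Gm)
      ultimately show ?case using elim(1) s(1) unfolding real_norm_def by linarith
    qed
    then show "\<exists>no. \<forall>n\<ge>no. norm ((\<integral>\<omega>. g (\<lambda>i. V n i \<omega>) \<partial>M) - (\<integral>\<omega>. g (\<lambda>i. G i \<omega>) \<partial>N)) < e"
      unfolding eventually_sequentially .
  qed
qed

section \<open>Paths and locally uniform semicontinuity\<close>

lemma restrict_tendsto_at_right:
  fixes x :: "real \<Rightarrow> real"
  assumes "0 \<le> t" "(x \<longlongrightarrow> x t) (at_right t)"
  shows "((\<lambda>t\<in>{0..}. x t) \<longlongrightarrow> (\<lambda>t\<in>{0..}. x t) t) (at_right t)"
proof -
  have "\<forall>\<^sub>F s in at_right t. x s = (\<lambda>t\<in>{0..}. x t) s"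
    using eventually_at_right_less[of t] by eventually_elim (use assms(1) in auto)
  then show ?thesis using assms by (simp add: Lim_transform_eventually)
qed

lemma restrict_tendsto_at_left:
  fixes x :: "real \<Rightarrow> real"
  assumes "0 < t" "(x \<longlongrightarrow> l) (at_left t)"
  shows "((\<lambda>t\<in>{0..}. x t) \<longlongrightarrow> l) (at_left t)"
proof -
  have "\<forall>\<^sub>F s in at_left t. x s = (\<lambda>t\<in>{0..}. x t) s"
    using eventually_at_left_real[OF assms(1)] by eventually_elim auto
  then show ?thesis using assms Lim_transform_eventually by blast
qed

lemma skorokhod_spaceI:
  fixes x :: "real \<Rightarrow> real"
  assumes "\<And>t. 0 \<le> t \<Longrightarrow> (x \<longlongrightarrow> x t) (at_right t)" "\<And>t. 0 < t \<Longrightarrow> \<exists>l. (x \<longlongrightarrow> l) (at_left t)"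
  shows "(\<lambda>t\<in>{0..}. x t) \<in> skorokhod_space"
  using assms restrict_tendsto_at_right[of _ x] restrict_tendsto_at_left[of _ x]
  unfolding skorokhod_space_def by blast

lemma continuous_path_in_skorokhod_space:
  fixes x :: "real \<Rightarrow> real"
  assumes "continuous_on {0..} x"
  shows "(\<lambda>t\<in>{0..}. x t) \<in> skorokhod_space"
proof (rule skorokhod_spaceI)
  fix t :: real assume t: "0 \<le> t"
  have "(x \<longlongrightarrow> x t) (at t within {0..})"
    using assms t by (simp add: continuous_on_def)
  then show "(x \<longlongrightarrow> x t) (at_right t)"
    by (rule tendsto_within_subset) (use t in auto)
next
  fix t :: real assume t: "0 < t"
  have "continuous_on {0<..} x" by (rule continuous_on_subset[OF assms]) auto
  then have "isCont x t" using t by (simp add: continuous_on_eq_continuous_at)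
  then have "(x \<longlongrightarrow> x t) (at_left t)"
    unfolding isCont_def by (rule tendsto_within_subset) auto
  then show "\<exists>l. (x \<longlongrightarrow> l) (at_left t)" by blast
qed

text \<open>Just before \<open>t\<close>, the integer part of an increasing continuous function equals
  \<open>\<lceil>\<phi> t\<rceil> - 1\<close>.\<close>

lemma floor_path_in_skorokhod_space:
  fixes \<phi> c :: "real \<Rightarrow> real" and F :: "int \<Rightarrow> real"
  assumes \<phi>: "\<And>t. isCont \<phi> t" "strict_mono \<phi>" and c: "\<And>t. isCont c t" "\<And>t. c t \<noteq> 0"
  shows "(\<lambda>t\<in>{0..}. F \<lfloor>\<phi> t\<rfloor> / c t) \<in> skorokhod_space"
proof (rule skorokhod_spaceI)
  fix t :: real
  have "\<forall>\<^sub>F s in at_right t. \<phi> s < real_of_int (\<lfloor>\<phi> t\<rfloor> + 1)"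
    by (rule order_tendstoD(2)[OF tendsto_within_subset[OF \<phi>(1)[unfolded isCont_def]]]) auto
  then have "\<forall>\<^sub>F s in at_right t. F \<lfloor>\<phi> t\<rfloor> / c s = F \<lfloor>\<phi> s\<rfloor> / c s"
    using eventually_at_right_less[of t]
  proof eventually_elim
    case (elim s)
    have "\<phi> t < \<phi> s" using \<phi>(2) elim by (simp add: strict_mono_def)
    then have "\<lfloor>\<phi> s\<rfloor> = \<lfloor>\<phi> t\<rfloor>" using elim by (intro floor_unique) linarith+
    then show ?case by simp
  qed
  moreover have "((\<lambda>s. F \<lfloor>\<phi> t\<rfloor> / c s) \<longlongrightarrow> F \<lfloor>\<phi> t\<rfloor> / c t) (at_right t)"
    by (intro tendsto_divide tendsto_const tendsto_within_subset[OF c(1)[unfolded isCont_def]] c) auto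
  ultimately show "((\<lambda>t. F \<lfloor>\<phi> t\<rfloor> / c t) \<longlongrightarrow> F \<lfloor>\<phi> t\<rfloor> / c t) (at_right t)"
    by (rule Lim_transform_eventually[rotated])
next
  fix t :: real assume t: "0 < t"
  have "\<forall>\<^sub>F s in at_left t. \<phi> s > real_of_int (\<lceil>\<phi> t\<rceil> - 1)"
  proof (rule order_tendstoD(1)[OF tendsto_within_subset[OF \<phi>(1)[unfolded isCont_def]]])
    show "real_of_int (\<lceil>\<phi> t\<rceil> - 1) < \<phi> t" using ceiling_correct[of "\<phi> t"] by simp
  qed simp
  then have "\<forall>\<^sub>F s in at_left t. F (\<lceil>\<phi> t\<rceil> - 1) / c s = F \<lfloor>\<phi> s\<rfloor> / c s"
    using eventually_at_left_real[OF t]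
  proof eventually_elim
    case (elim s)
    have "\<phi> s < \<phi> t" using \<phi>(2) elim by (simp add: strict_mono_def)
    then have "\<lfloor>\<phi> s\<rfloor> = \<lceil>\<phi> t\<rceil> - 1" using elim by (intro floor_unique) linarith+
    then show ?case by simp
  qed
  moreover have "((\<lambda>s. F (\<lceil>\<phi> t\<rceil> - 1) / c s) \<longlongrightarrow> F (\<lceil>\<phi> t\<rceil> - 1) / c t) (at_left t)"
    by (intro tendsto_divide tendsto_const tendsto_within_subset[OF c(1)[unfolded isCont_def]] c) auto
  ultimately have "((\<lambda>t. F \<lfloor>\<phi> t\<rfloor> / c t) \<longlongrightarrow> F (\<lceil>\<phi> t\<rceil> - 1) / c t) (at_left t)"
    by (rule Lim_transform_eventually[rotated])
  then show "\<exists>l. ((\<lambda>t. F \<lfloor>\<phi> t\<rfloor> / c t) \<longlongrightarrow> l) (at_left t)" by (rule exI)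
qed

text \<open>Holding the value from the left end of each grid interval makes the path right-continuous, hence
  an element of the Skorokhod space.\<close>

definition grid_path :: "nat \<Rightarrow> (nat \<Rightarrow> real) \<Rightarrow> real \<Rightarrow> real" where
  "grid_path m v = (\<lambda>t\<in>{0..}. v (nat \<lfloor>real m * t\<rfloor>))"

lemma grid_path_in_skorokhod_space: "m > 0 \<Longrightarrow> grid_path m v \<in> skorokhod_space"
  using floor_path_in_skorokhod_space[of "\<lambda>t. real m * t" "\<lambda>_. 1" "\<lambda>i. v (nat i)"]
  by (simp add: grid_path_def strict_mono_def)

text \<open>Semicontinuity with respect to uniform convergence on compact intervals. The topology of this
  convergence is finer than Skorokhod's, since the identity is an admissible time change.\<close>

definition lsc_at :: "((real \<Rightarrow> real) \<Rightarrow> real) \<Rightarrow> (real \<Rightarrow> real) \<Rightarrow> bool" where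
  "lsc_at f x \<longleftrightarrow> (\<forall>\<eta>>0. \<exists>T. \<exists>\<epsilon>>0. \<forall>y\<in>skorokhod_space.
     (\<forall>t\<in>{0..T}. \<bar>y t - x t\<bar> < \<epsilon>) \<longrightarrow> f x - \<eta> < f y)"

lemma skorokhod_open_locally_uniform:
  assumes "openin skorokhod_topology U" "x \<in> U"
  shows "\<exists>T. \<exists>\<epsilon>>0. \<forall>y\<in>skorokhod_space. (\<forall>t\<in>{0..T}. \<bar>y t - x t\<bar> < \<epsilon>) \<longrightarrow> y \<in> U"
proof -
  obtain T \<epsilon> where T: "\<epsilon> > 0" "skorokhod_nbhd x T \<epsilon> \<subseteq> U"
    using assms unfolding openin_skorokhod_topology by blast
  have "id \<in> time_changes" by (auto simp: time_changes_def strict_mono_on_def)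
  then have "y \<in> skorokhod_nbhd x T \<epsilon>"
    if "y \<in> skorokhod_space" "\<forall>t\<in>{0..T}. \<bar>y t - x t\<bar> < \<epsilon>" for y
    using that T(1) unfolding skorokhod_nbhd_def by (auto intro!: bexI[of _ id])
  then show ?thesis using T by blast
qed

lemma lsc_at_indicator_open:
  assumes "openin skorokhod_topology U"
  shows "lsc_at (indicator U) x"
proof (cases "x \<in> U")
  case True
  then show ?thesis
    using skorokhod_open_locally_uniform[OF assms True] unfolding lsc_at_def by fastforce
next
  case False
  show ?thesis unfolding lsc_at_def
    using False by (intro allI impI exI[of _ 0] exI[of _ 1] conjI ballI)
      (auto simp: indicator_def)
qed

lemma lsc_at_continuous:
  assumes f: "continuous_map skorokhod_topology euclideanreal f" and x: "x \<in> skorokhod_space"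
  shows "lsc_at f x"
  unfolding lsc_at_def
proof (intro allI impI)
  fix \<eta> :: real assume \<eta>: "\<eta> > 0"
  have "openin skorokhod_topology {y \<in> topspace skorokhod_topology. f y \<in> {f x - \<eta><..}}"
    by (rule openin_continuous_map_preimage[OF f]) simp
  from skorokhod_open_locally_uniform[OF this, of x] x \<eta>
  show "\<exists>T. \<exists>\<epsilon>>0. \<forall>y\<in>skorokhod_space. (\<forall>t\<in>{0..T}. \<bar>y t - x t\<bar> < \<epsilon>) \<longrightarrow> f x - \<eta> < f y"
    by (simp add: topspace_skorokhod_topology)
qed

section \<open>Lipschitz envelopes\<close>

text \<open>The largest minorant of \<open>f\<close> that is Lipschitz with constant \<open>k\<close> for the uniform distance on
  \<open>[0, k]\<close>.\<close>

definition lipschitz_envelope :: "((real \<Rightarrow> real) \<Rightarrow> real) \<Rightarrow> nat \<Rightarrow> (real \<Rightarrow> real) \<Rightarrow> real" where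
  "lipschitz_envelope f k x = Inf {f y + real k * e | y e.
     y \<in> skorokhod_space \<and> 0 \<le> e \<and> (\<forall>t\<in>{0..real k}. \<bar>x t - y t\<bar> \<le> e)}"

context
  fixes f :: "(real \<Rightarrow> real) \<Rightarrow> real" and C :: real
  assumes f_bound: "\<And>y. y \<in> skorokhod_space \<Longrightarrow> \<bar>f y\<bar> \<le> C"
begin

lemma envelope_lower:
  assumes "y \<in> skorokhod_space" "0 \<le> e" "\<And>t. t \<in> {0..real k} \<Longrightarrow> \<bar>x t - y t\<bar> \<le> e"
  shows "lipschitz_envelope f k x \<le> f y + real k * e"
  unfolding lipschitz_envelope_def
proof (rule cInf_lower)
  show "bdd_below {f y + real k * e | y e.
     y \<in> skorokhod_space \<and> 0 \<le> e \<and> (\<forall>t\<in>{0..real k}. \<bar>x t - y t\<bar> \<le> e)}"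
  proof (rule bdd_belowI[of _ "- C"], safe)
    fix y :: "real \<Rightarrow> real" and e :: real assume "y \<in> skorokhod_space" "0 \<le> e"
    then have "- C \<le> f y" "0 \<le> real k * e" using f_bound[of y] by auto
    then show "- C \<le> f y + real k * e" by linarith
  qed
qed (use assms in blast)

lemma envelope_greatest:
  assumes "x \<in> skorokhod_space"
    and "\<And>y e. y \<in> skorokhod_space \<Longrightarrow> 0 \<le> e \<Longrightarrow> (\<And>t. t \<in> {0..real k} \<Longrightarrow> \<bar>x t - y t\<bar> \<le> e) \<Longrightarrow>
       z \<le> f y + real k * e"
  shows "z \<le> lipschitz_envelope f k x"
  unfolding lipschitz_envelope_def
proof (rule cInf_greatest)
  have "f x + real k * 0 \<in> {f y + real k * e | y e.
     y \<in> skorokhod_space \<and> 0 \<le> e \<and> (\<forall>t\<in>{0..real k}. \<bar>x t - y t\<bar> \<le> e)}"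
    using assms(1) by (intro CollectI exI[of _ x] exI[of _ 0]) auto
  then show "{f y + real k * e | y e.
     y \<in> skorokhod_space \<and> 0 \<le> e \<and> (\<forall>t\<in>{0..real k}. \<bar>x t - y t\<bar> \<le> e)} \<noteq> {}" by blast
qed (use assms(2) in blast)

lemma envelope_le: "x \<in> skorokhod_space \<Longrightarrow> lipschitz_envelope f k x \<le> f x"
  using envelope_lower[of x 0 k x] by simp

lemma envelope_ge: "x \<in> skorokhod_space \<Longrightarrow> - C \<le> lipschitz_envelope f k x"
proof (rule envelope_greatest)
  fix y :: "real \<Rightarrow> real" and e :: real assume "y \<in> skorokhod_space" "0 \<le> e"
  then have "- C \<le> f y" "0 \<le> real k * e" using f_bound[of y] by auto
  then show "- C \<le> f y + real k * e" by linarith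
qed

lemma envelope_bound: "x \<in> skorokhod_space \<Longrightarrow> \<bar>lipschitz_envelope f k x\<bar> \<le> C"
  using envelope_le[of x k] envelope_ge[of x k] f_bound[of x] by linarith

lemma envelope_lipschitz_le:
  assumes "x \<in> skorokhod_space" "x' \<in> skorokhod_space" "0 \<le> \<eta>"
    and "\<And>t. t \<in> {0..real k} \<Longrightarrow> \<bar>x t - x' t\<bar> \<le> \<eta>"
  shows "lipschitz_envelope f k x' \<le> lipschitz_envelope f k x + real k * \<eta>"
proof -
  have "lipschitz_envelope f k x' - real k * \<eta> \<le> lipschitz_envelope f k x"
  proof (rule envelope_greatest[OF assms(1)])
    fix y :: "real \<Rightarrow> real" and e :: real
    assume y: "y \<in> skorokhod_space" "0 \<le> e" "\<And>t. t \<in> {0..real k} \<Longrightarrow> \<bar>x t - y t\<bar> \<le> e"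
    have "lipschitz_envelope f k x' \<le> f y + real k * (e + \<eta>)"
    proof (rule envelope_lower[OF y(1)])
      fix t assume "t \<in> {0..real k}"
      then show "\<bar>x' t - y t\<bar> \<le> e + \<eta>" using y(3)[of t] assms(4)[of t] by linarith
    qed (use y assms in simp)
    then show "lipschitz_envelope f k x' - real k * \<eta> \<le> f y + real k * e"
      by (simp add: algebra_simps)
  qed
  then show ?thesis by simp
qed

lemma envelope_lipschitz:
  assumes "x \<in> skorokhod_space" "x' \<in> skorokhod_space" "0 \<le> \<eta>"
    and "\<And>t. t \<in> {0..real k} \<Longrightarrow> \<bar>x t - x' t\<bar> \<le> \<eta>"
  shows "\<bar>lipschitz_envelope f k x - lipschitz_envelope f k x'\<bar> \<le> real k * \<eta>"
proof -
  have "lipschitz_envelope f k x \<le> lipschitz_envelope f k x' + real k * \<eta>"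
    using assms by (intro envelope_lipschitz_le) (simp_all add: abs_minus_commute)
  moreover have "lipschitz_envelope f k x' \<le> lipschitz_envelope f k x + real k * \<eta>"
    by (rule envelope_lipschitz_le[OF assms])
  ultimately show ?thesis by linarith
qed

text \<open>A competitor at distance at least \<open>\<epsilon>\<close> costs \<open>k \<epsilon>\<close>, which eventually exceeds the
  oscillation of \<open>f\<close>. Hence only paths close to \<open>x\<close> compete.\<close>

lemma envelope_limit:
  assumes x: "x \<in> skorokhod_space" and lsc: "lsc_at f x"
  shows "(\<lambda>k. lipschitz_envelope f k x) \<longlonglongrightarrow> f x"
proof (rule LIMSEQ_I)
  fix r :: real assume r: "0 < r"
  obtain T \<epsilon> where \<epsilon>: "\<epsilon> > 0" and
    near: "\<And>y. y \<in> skorokhod_space \<Longrightarrow> (\<And>t. t \<in> {0..T} \<Longrightarrow> \<bar>y t - x t\<bar> < \<epsilon>) \<Longrightarrow> f x - r / 2 < f y"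
    using lsc r unfolding lsc_at_def by (metis half_gt_zero)
  define k0 where "k0 = nat \<lceil>max T (2 * C / \<epsilon>)\<rceil>"
  show "\<exists>no. \<forall>k\<ge>no. norm (lipschitz_envelope f k x - f x) < r"
  proof (intro exI allI impI)
    fix k assume "k0 \<le> k"
    then have "max T (2 * C / \<epsilon>) \<le> real k" unfolding k0_def by linarith
    then have T: "T \<le> real k" and "2 * C / \<epsilon> \<le> real k" by auto
    then have kC: "2 * C \<le> real k * \<epsilon>" using \<epsilon> by (simp add: pos_divide_le_eq)
    have "f x - r / 2 \<le> lipschitz_envelope f k x"
    proof (rule envelope_greatest[OF x])
      fix y :: "real \<Rightarrow> real" and e :: real
      assume y: "y \<in> skorokhod_space" "0 \<le> e" "\<And>t. t \<in> {0..real k} \<Longrightarrow> \<bar>x t - y t\<bar> \<le> e"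
      show "f x - r / 2 \<le> f y + real k * e"
      proof (cases "e < \<epsilon>")
        case True
        have "f x - r / 2 < f y"
        proof (rule near[OF y(1)])
          fix t assume "t \<in> {0..T}"
          then show "\<bar>y t - x t\<bar> < \<epsilon>" using y(3)[of t] T True by auto
        qed
        moreover have "0 \<le> real k * e" using y by simp
        ultimately show ?thesis by linarith
      next
        case False
        then have "real k * \<epsilon> \<le> real k * e" by (intro mult_left_mono) auto
        then show ?thesis using kC f_bound[OF x] f_bound[OF y(1)] r by linarith
      qed
    qed
    then show "norm (lipschitz_envelope f k x - f x) < r"
      using envelope_le[OF x, of k] r by simp
  qed
qed

lemma envelope_grid_lipschitz:
  assumes m: "m > 0"
  shows "\<bar>lipschitz_envelope f k (grid_path m v) - lipschitz_envelope f k (grid_path m w)\<bar>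
     \<le> real k * (\<Sum>j<Suc (m * k). \<bar>v j - w j\<bar>)"
proof (intro envelope_lipschitz grid_path_in_skorokhod_space m)
  fix t assume t: "t \<in> {0..real k}"
  have "real m * t \<le> real (m * k)" using t by (simp add: mult_left_mono)
  then have "nat \<lfloor>real m * t\<rfloor> < Suc (m * k)" using t by linarith
  then have "\<bar>v (nat \<lfloor>real m * t\<rfloor>) - w (nat \<lfloor>real m * t\<rfloor>)\<bar> \<le> (\<Sum>j<Suc (m * k). \<bar>v j - w j\<bar>)"
    by (intro member_le_sum) auto
  then show "\<bar>grid_path m v t - grid_path m w t\<bar> \<le> (\<Sum>j<Suc (m * k). \<bar>v j - w j\<bar>)"
    using t by (simp add: grid_path_def)
qed (auto intro: sum_nonneg)

lemma envelope_increments_lipschitz: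
  assumes m: "m > 0"
  shows "\<bar>lipschitz_envelope f k (grid_path m (\<lambda>j. \<Sum>i<j. v i)) -
          lipschitz_envelope f k (grid_path m (\<lambda>j. \<Sum>i<j. w i))\<bar> \<le> real k * (\<Sum>i<m * k. \<bar>v i - w i\<bar>)"
proof (intro envelope_lipschitz grid_path_in_skorokhod_space m)
  fix t assume t: "t \<in> {0..real k}"
  have "real m * t \<le> real (m * k)" using t by (simp add: mult_left_mono)
  then have j: "nat \<lfloor>real m * t\<rfloor> \<le> m * k" using t by linarith
  let ?j = "nat \<lfloor>real m * t\<rfloor>"
  have "\<bar>(\<Sum>i<?j. v i) - (\<Sum>i<?j. w i)\<bar> \<le> (\<Sum>i<?j. \<bar>v i - w i\<bar>)"
    unfolding sum_subtractf[symmetric] by (rule sum_abs)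
  also have "\<dots> \<le> (\<Sum>i<m * k. \<bar>v i - w i\<bar>)" using j by (intro sum_mono2) auto
  finally show "\<bar>grid_path m (\<lambda>j. \<Sum>i<j. v i) t - grid_path m (\<lambda>j. \<Sum>i<j. w i) t\<bar> \<le> (\<Sum>i<m * k. \<bar>v i - w i\<bar>)"
    using t by (simp add: grid_path_def)
qed (auto intro: sum_nonneg)

lemma envelope_grid_limit:
  assumes x: "continuous_on {0..} x"
  shows "(\<lambda>m. lipschitz_envelope f k (grid_path (Suc m) (\<lambda>j. x (real j / real (Suc m)))))
     \<longlonglongrightarrow> lipschitz_envelope f k (\<lambda>t\<in>{0..}. x t)"
proof (rule LIMSEQ_I)
  fix r :: real assume r: "0 < r"
  define \<eta> where "\<eta> = r / (real k + 1)"
  have \<eta>: "0 < \<eta>" "real k * \<eta> < r" using r by (auto simp: \<eta>_def field_simps)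
  have "uniformly_continuous_on {0..real k} x"
    by (rule compact_uniformly_continuous[OF continuous_on_subset[OF x]]) auto
  then obtain \<delta> where \<delta>: "\<delta> > 0"
    "\<And>s t. s \<in> {0..real k} \<Longrightarrow> t \<in> {0..real k} \<Longrightarrow> \<bar>s - t\<bar> < \<delta> \<Longrightarrow> \<bar>x s - x t\<bar> < \<eta>"
    unfolding uniformly_continuous_on_def dist_real_def using \<eta>(1) by metis
  obtain n0 where n0: "1 / \<delta> < real n0" using reals_Archimedean2 by blast
  show "\<exists>no. \<forall>m\<ge>no. norm (lipschitz_envelope f k (grid_path (Suc m) (\<lambda>j. x (real j / real (Suc m))))
     - lipschitz_envelope f k (\<lambda>t\<in>{0..}. x t)) < r"
  proof (intro exI allI impI)
    fix m assume "n0 \<le> m"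
    then have "1 / \<delta> < real (Suc m)" using n0 by linarith
    then have m: "1 / real (Suc m) < \<delta>" using \<delta>(1) by (simp add: field_simps)
    have "\<bar>lipschitz_envelope f k (grid_path (Suc m) (\<lambda>j. x (real j / real (Suc m))))
      - lipschitz_envelope f k (\<lambda>t\<in>{0..}. x t)\<bar> \<le> real k * \<eta>"
    proof (intro envelope_lipschitz grid_path_in_skorokhod_space continuous_path_in_skorokhod_space x)
      fix t assume t: "t \<in> {0..real k}"
      let ?s = "real (nat \<lfloor>real (Suc m) * t\<rfloor>) / real (Suc m)"
      have fl: "0 \<le> real (Suc m) * t" using t by simp
      have s1: "real (nat \<lfloor>real (Suc m) * t\<rfloor>) \<le> real (Suc m) * t"
        and s2: "real (Suc m) * t - 1 < real (nat \<lfloor>real (Suc m) * t\<rfloor>)" using fl by linarith+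
      have "?s \<le> t" using s1 by (simp add: pos_divide_le_eq mult.commute)
      moreover have "t - 1 / real (Suc m) < ?s"
        using divide_strict_right_mono[OF s2, of "real (Suc m)"] by (simp add: diff_divide_distrib del: of_nat_Suc)
      moreover have "0 \<le> ?s" by simp
      ultimately have "\<bar>x ?s - x t\<bar> < \<eta>" using t m by (intro \<delta>(2)) auto
      then show "\<bar>grid_path (Suc m) (\<lambda>j. x (real j / real (Suc m))) t - (\<lambda>t\<in>{0..}. x t) t\<bar> \<le> \<eta>"
        using t by (simp add: grid_path_def)
    qed (use \<eta> in auto)
    then show "norm (lipschitz_envelope f k (grid_path (Suc m) (\<lambda>j. x (real j / real (Suc m))))
     - lipschitz_envelope f k (\<lambda>t\<in>{0..}. x t)) < r" using \<eta>(2) by simp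
  qed
qed

lemma envelope_grid_measurable:
  assumes m: "m > 0" and V: "\<And>j. V j \<in> borel_measurable N"
  shows "(\<lambda>\<omega>. lipschitz_envelope f k (grid_path m (\<lambda>j. V j \<omega>))) \<in> borel_measurable N"
  by (rule lipschitz_function_measurable[where g = "\<lambda>v. lipschitz_envelope f k (grid_path m v)",
        OF envelope_bound[OF grid_path_in_skorokhod_space[OF m]] envelope_grid_lipschitz[OF m] _ V]) simp

lemma envelope_continuous_path_measurable:
  assumes Y: "\<And>t. 0 \<le> t \<Longrightarrow> Y t \<in> borel_measurable N"
    and cont: "\<And>\<omega>. \<omega> \<in> space N \<Longrightarrow> continuous_on {0..} (\<lambda>t. Y t \<omega>)"
  shows "(\<lambda>\<omega>. lipschitz_envelope f k (\<lambda>t\<in>{0..}. Y t \<omega>)) \<in> borel_measurable N"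
  by (rule borel_measurable_LIMSEQ_real[OF envelope_grid_limit[OF cont] envelope_grid_measurable])
     (auto intro: Y)

lemma lsc_continuous_path_measurable:
  assumes Y: "\<And>t. 0 \<le> t \<Longrightarrow> Y t \<in> borel_measurable N"
    and cont: "\<And>\<omega>. \<omega> \<in> space N \<Longrightarrow> continuous_on {0..} (\<lambda>t. Y t \<omega>)"
    and lsc: "\<And>x. x \<in> skorokhod_space \<Longrightarrow> lsc_at f x"
  shows "(\<lambda>\<omega>. f (\<lambda>t\<in>{0..}. Y t \<omega>)) \<in> borel_measurable N"
  by (rule borel_measurable_LIMSEQ_real[OF envelope_limit envelope_continuous_path_measurable[OF Y cont]])
     (auto intro: lsc continuous_path_in_skorokhod_space cont)

end

section \<open>Random elements of the Skorokhod space\<close>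

lemma measurable_borel_ofI:
  assumes "\<And>\<omega>. \<omega> \<in> space M \<Longrightarrow> X \<omega> \<in> topspace \<T>"
    and "\<And>U. openin \<T> U \<Longrightarrow> {\<omega>\<in>space M. X \<omega> \<in> U} \<in> sets M"
  shows "X \<in> M \<rightarrow>\<^sub>M borel_of \<T>"
  unfolding borel_of_def
proof (rule measurable_measure_of)
  show "X -` U \<inter> space M \<in> sets M" if "U \<in> {U. openin \<T> U}" for U
    using assms(2)[of U] that by (simp add: vimage_def Int_def conj_commute)
qed (use assms(1) openin_subset in auto)

lemma continuous_map_borel_of_measurable:
  fixes f :: "'c \<Rightarrow> real"
  assumes "continuous_map \<T> euclideanreal f"
  shows "f \<in> borel_measurable (borel_of \<T>)"
proof (rule borel_measurableI)
  have s: "space (borel_of \<T>) = topspace \<T>" by (simp add: borel_of_def openin_subset space_measure_of_conv)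
  fix S :: "real set" assume "open S"
  then have "openin \<T> {x \<in> topspace \<T>. f x \<in> S}"
    by (intro openin_continuous_map_preimage[OF assms]) simp
  then have "{x \<in> topspace \<T>. f x \<in> S} \<in> sets (borel_of \<T>)"
    unfolding borel_of_def using openin_subset by (subst sets_measure_of) auto
  moreover have "f -` S \<inter> space (borel_of \<T>) = {x \<in> topspace \<T>. f x \<in> S}" using s by auto
  ultimately show "f -` S \<inter> space (borel_of \<T>) \<in> sets (borel_of \<T>)" by simp
qed

text \<open>Skorokhod open sets are open for locally uniform convergence, so their indicators are limits
  of envelopes, and these depend measurably on a continuous path.\<close>

lemma continuous_path_measurable:
  assumes Y: "\<And>t. 0 \<le> t \<Longrightarrow> Y t \<in> borel_measurable N"
    and cont: "\<And>\<omega>. \<omega> \<in> space N \<Longrightarrow> continuous_on {0..} (\<lambda>t. Y t \<omega>)"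
  shows "(\<lambda>\<omega>. \<lambda>t\<in>{0..}. Y t \<omega>) \<in> N \<rightarrow>\<^sub>M borel_of skorokhod_topology"
proof (rule measurable_borel_ofI)
  fix U assume U: "openin skorokhod_topology U"
  have "(\<lambda>\<omega>. indicator U (\<lambda>t\<in>{0..}. Y t \<omega>) :: real) \<in> borel_measurable N"
    by (rule lsc_continuous_path_measurable[where C = 1, OF _ Y cont lsc_at_indicator_open[OF U]])
       (auto simp: indicator_def)
  then have "(\<lambda>\<omega>. indicator U (\<lambda>t\<in>{0..}. Y t \<omega>) :: real) -` {1} \<inter> space N \<in> sets N"
    by (rule measurable_sets) simp
  moreover have "(\<lambda>\<omega>. indicator U (\<lambda>t\<in>{0..}. Y t \<omega>) :: real) -` {1} \<inter> space N =
      {\<omega> \<in> space N. (\<lambda>t\<in>{0..}. Y t \<omega>) \<in> U}"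
    by (auto simp: indicator_def)
  ultimately show "{\<omega> \<in> space N. (\<lambda>t\<in>{0..}. Y t \<omega>) \<in> U} \<in> sets N" by simp
qed (use continuous_path_in_skorokhod_space[OF cont] in \<open>simp add: topspace_skorokhod_topology\<close>)

text \<open>A path that on each bounded interval is determined by finitely many discrete variables takes
  its values in an open set exactly when one of countably many cylinder events occurs.\<close>

lemma discrete_path_measurable:
  fixes S :: "nat \<Rightarrow> 'a \<Rightarrow> int" and X :: "'a \<Rightarrow> real \<Rightarrow> real"
  assumes S: "\<And>n. S n \<in> M \<rightarrow>\<^sub>M count_space UNIV"
    and D: "\<And>\<omega>. \<omega> \<in> space M \<Longrightarrow> X \<omega> \<in> skorokhod_space"
    and dep: "\<And>T. \<exists>J. \<forall>\<omega>\<in>space M. \<forall>\<omega>'\<in>space M. (\<forall>j\<le>J. S j \<omega> = S j \<omega>') \<longrightarrow> (\<forall>t\<in>{0..T}. X \<omega> t = X \<omega>' t)"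
  shows "X \<in> M \<rightarrow>\<^sub>M borel_of skorokhod_topology"
proof (rule measurable_borel_ofI)
  fix U assume U: "openin skorokhod_topology U"
  define A where "A J = {\<omega>\<in>space M. \<forall>\<omega>'\<in>space M. (\<forall>j\<le>J. S j \<omega> = S j \<omega>') \<longrightarrow> X \<omega>' \<in> U}" for J
  have A: "A J \<in> sets M" for J
  proof -
    define c where "c l = {\<omega>\<in>space M. \<forall>j\<in>{..J}. S j \<omega> = l ! j}" for l :: "int list"
    have c: "c l \<in> sets M" for l
    proof -
      have "S j -` {l ! j} \<inter> space M \<in> sets M" for j by (rule measurable_sets[OF S]) simp
      then have "{\<omega>\<in>space M. S j \<omega> = l ! j} \<in> sets M" for j
        by (simp add: vimage_def Int_def conj_commute)
      then show ?thesis unfolding c_def by (intro sets.sets_Collect_finite_All) auto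
    qed
    have "A J = (\<Union>l\<in>{l. c l \<subseteq> A J}. c l)"
    proof (intro equalityI subsetI)
      fix \<omega> assume w: "\<omega> \<in> A J"
      let ?l = "map (\<lambda>j. S j \<omega>) [0..<Suc J]"
      have nth: "?l ! j = S j \<omega>" if "j \<le> J" for j using that by (simp del: upt_Suc)
      have "\<omega> \<in> c ?l" using w nth unfolding c_def A_def by auto
      moreover have "c ?l \<subseteq> A J" using w nth unfolding c_def A_def by auto
      ultimately show "\<omega> \<in> (\<Union>l\<in>{l. c l \<subseteq> A J}. c l)" by blast
    qed auto
    also have "\<dots> \<in> sets M" using c by (intro sets.countable_UN' countableI_type) auto
    finally show ?thesis .
  qed
  have "{\<omega> \<in> space M. X \<omega> \<in> U} = (\<Union>J. A J)"
  proof (intro equalityI subsetI)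
    fix \<omega> assume "\<omega> \<in> {\<omega> \<in> space M. X \<omega> \<in> U}"
    then have w: "\<omega> \<in> space M" "X \<omega> \<in> U" by auto
    obtain T \<epsilon> where T: "\<epsilon> > 0" "\<And>y. y \<in> skorokhod_space \<Longrightarrow> (\<And>t. t \<in> {0..T} \<Longrightarrow> \<bar>y t - X \<omega> t\<bar> < \<epsilon>) \<Longrightarrow> y \<in> U"
      using skorokhod_open_locally_uniform[OF U w(2)] by blast
    obtain J where J: "\<forall>\<omega>\<in>space M. \<forall>\<omega>'\<in>space M. (\<forall>j\<le>J. S j \<omega> = S j \<omega>') \<longrightarrow> (\<forall>t\<in>{0..T}. X \<omega> t = X \<omega>' t)"
      using dep[of T] by blast
    have "X \<omega>' \<in> U" if "\<omega>' \<in> space M" "\<forall>j\<le>J. S j \<omega> = S j \<omega>'" for \<omega>'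
      by (rule T(2)[OF D[OF that(1)]]) (use J w that T(1) in \<open>metis abs_zero diff_self\<close>)
    then show "\<omega> \<in> (\<Union>J. A J)" using w unfolding A_def by blast
  qed (auto simp: A_def)
  then show "{\<omega> \<in> space M. X \<omega> \<in> U} \<in> sets M" using A by auto
qed (use D in \<open>simp add: topspace_skorokhod_topology\<close>)

section \<open>A criterion for convergence to a continuous process\<close>

text \<open>The test function is bounded below by its envelope, which is almost the same at the path and at
  its grid approximation. On grid paths the envelope is a Lipschitz function of finitely many
  increments, so its expectation converges. Letting the grid become finer and then the Lipschitz
  constant grow recovers the test function at the limit process. Only a lower bound for the limit
  inferior results, but the same bound for the negative of a continuous function gives convergence.\<close>

lemma skorokhod_liminf_criterion:
  fixes X :: "nat \<Rightarrow> 'a \<Rightarrow> real \<Rightarrow> real" and Y :: "real \<Rightarrow> 'b \<Rightarrow> real"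
    and V :: "nat \<Rightarrow> nat \<Rightarrow> nat \<Rightarrow> 'a \<Rightarrow> real"
  assumes M: "prob_space M" and N: "prob_space N"
    and XD: "\<And>n \<omega>. \<omega> \<in> space M \<Longrightarrow> X n \<omega> \<in> skorokhod_space"
    and Y: "\<And>t. 0 \<le> t \<Longrightarrow> Y t \<in> borel_measurable N"
    and cont: "\<And>\<omega>. \<omega> \<in> space N \<Longrightarrow> continuous_on {0..} (\<lambda>t. Y t \<omega>)"
    and Y0: "AE \<omega> in N. Y 0 \<omega> = 0"
    and Ysq: "\<And>s t. 0 \<le> s \<Longrightarrow> s < t \<Longrightarrow> integrable N (\<lambda>\<omega>. (Y t \<omega> - Y s \<omega>) ^ 2)"
    and V [measurable]: "\<And>m n i. V m n i \<in> borel_measurable M"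
    and Vsq: "\<And>m n i. integrable M (\<lambda>\<omega>. V m n i \<omega> ^ 2)"
    and Vm: "\<And>m i. m > 0 \<Longrightarrow> \<exists>c. \<forall>\<^sub>F n in sequentially. (\<integral>\<omega>. V m n i \<omega> ^ 2 \<partial>M) \<le> c"
    and fdd: "\<And>m K h. m > 0 \<Longrightarrow> (\<And>j. continuous_on UNIV (h j)) \<Longrightarrow> (\<And>j x. 0 \<le> h j x \<and> h j x \<le> (1 :: real)) \<Longrightarrow>
       (\<lambda>n. \<integral>\<omega>. (\<Prod>i<K. h i (V m n i \<omega>)) \<partial>M)
         \<longlonglongrightarrow> (\<integral>\<omega>. (\<Prod>i<K. h i (Y (real (Suc i) / real m) \<omega> - Y (real i / real m) \<omega>)) \<partial>N)"
    and osc: "\<And>T \<epsilon>. 0 < \<epsilon> \<Longrightarrow> \<forall>\<^sub>F m in sequentially. \<forall>\<^sub>F n in sequentially. \<exists>A\<in>sets M. measure M A \<le> \<epsilon> \<and>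
       (\<forall>\<omega>\<in>space M - A. \<forall>t\<in>{0..real T}. \<bar>X n \<omega> t - (\<Sum>i<nat \<lfloor>real m * t\<rfloor>. V m n i \<omega>)\<bar> \<le> \<epsilon>)"
    and fC: "\<And>y. y \<in> skorokhod_space \<Longrightarrow> \<bar>f y\<bar> \<le> C"
    and lsc: "\<And>x. x \<in> skorokhod_space \<Longrightarrow> lsc_at f x"
    and fX [measurable]: "\<And>n. (\<lambda>\<omega>. f (X n \<omega>)) \<in> borel_measurable M"
    and r: "0 < r"
  shows "\<forall>\<^sub>F n in sequentially. (\<integral>\<omega>. f (\<lambda>t\<in>{0..}. Y t \<omega>) \<partial>N) - r < (\<integral>\<omega>. f (X n \<omega>) \<partial>M)"
proof -
  interpret M: prob_space M by fact
  interpret N: prob_space N by fact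
  let ?Y = "\<lambda>\<omega>. \<lambda>t\<in>{0..}. Y t \<omega>"
  let ?env = "lipschitz_envelope f"
  have YD: "?Y \<omega> \<in> skorokhod_space" if "\<omega> \<in> space N" for \<omega>
    using continuous_path_in_skorokhod_space[OF cont[OF that]] .
  have C: "0 \<le> C" using fC[OF grid_path_in_skorokhod_space[of 1 undefined]] by simp
  have "(\<lambda>k. \<integral>\<omega>. ?env k (?Y \<omega>) \<partial>N) \<longlonglongrightarrow> (\<integral>\<omega>. f (?Y \<omega>) \<partial>N)"
    using lsc_continuous_path_measurable[OF fC Y cont lsc] envelope_continuous_path_measurable[OF fC Y cont]
      envelope_limit[OF fC YD lsc[OF YD]] envelope_bound[OF fC YD]
    by (intro integral_dominated_convergence[where w = "\<lambda>_. C"]) auto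
  then have "\<forall>\<^sub>F k in sequentially. (\<integral>\<omega>. f (?Y \<omega>) \<partial>N) - r / 4 < (\<integral>\<omega>. ?env k (?Y \<omega>) \<partial>N)"
    by (rule order_tendstoD(1)) (use r in simp)
  then obtain k where k: "(\<integral>\<omega>. f (?Y \<omega>) \<partial>N) - r / 4 < (\<integral>\<omega>. ?env k (?Y \<omega>) \<partial>N)"
    using eventually_happens[of _ sequentially] by auto
  \<comment> \<open>The envelope loses \<open>k \<epsilon>\<close> by the distance of the paths and \<open>2 C \<epsilon>\<close> on the
    exceptional event.\<close>
  define \<epsilon> where "\<epsilon> = r / (4 * (real k + 2 * C + 1))"
  have \<epsilon>: "0 < \<epsilon>" "(real k + 2 * C) * \<epsilon> < r / 4"
    using r C by (auto simp: \<epsilon>_def field_simps)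
  let ?G = "\<lambda>m \<omega>. ?env k (grid_path m (\<lambda>j. Y (real j / real m) \<omega>))"
  have G_meas: "?G (Suc m) \<in> borel_measurable N" for m
    by (rule envelope_grid_measurable[OF fC]) (auto intro: Y)
  have "(\<lambda>m. \<integral>\<omega>. ?G (Suc m) \<omega> \<partial>N) \<longlonglongrightarrow> (\<integral>\<omega>. ?env k (?Y \<omega>) \<partial>N)"
    using envelope_continuous_path_measurable[OF fC Y cont] G_meas
      envelope_grid_limit[OF fC cont] envelope_bound[OF fC grid_path_in_skorokhod_space]
    by (intro integral_dominated_convergence[where w = "\<lambda>_. C"]) auto
  then have "\<forall>\<^sub>F m in sequentially. (\<integral>\<omega>. ?env k (?Y \<omega>) \<partial>N) - r / 4 < (\<integral>\<omega>. ?G (Suc m) \<omega> \<partial>N)"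
    by (rule order_tendstoD(1)) (use r in simp)
  moreover have "\<forall>\<^sub>F m in sequentially. \<forall>\<^sub>F n in sequentially. \<exists>A\<in>sets M. measure M A \<le> \<epsilon> \<and>
       (\<forall>\<omega>\<in>space M - A. \<forall>t\<in>{0..real k}. \<bar>X n \<omega> t - (\<Sum>i<nat \<lfloor>real (Suc m) * t\<rfloor>. V (Suc m) n i \<omega>)\<bar> \<le> \<epsilon>)"
    using osc[OF \<epsilon>(1), of k] by (subst eventually_sequentially_Suc)
  ultimately have "\<forall>\<^sub>F m in sequentially. (\<integral>\<omega>. ?env k (?Y \<omega>) \<partial>N) - r / 4 < (\<integral>\<omega>. ?G (Suc m) \<omega> \<partial>N) \<and>
     (\<forall>\<^sub>F n in sequentially. \<exists>A\<in>sets M. measure M A \<le> \<epsilon> \<and>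
       (\<forall>\<omega>\<in>space M - A. \<forall>t\<in>{0..real k}. \<bar>X n \<omega> t - (\<Sum>i<nat \<lfloor>real (Suc m) * t\<rfloor>. V (Suc m) n i \<omega>)\<bar> \<le> \<epsilon>))"
    by (rule eventually_conj)
  then obtain m' where m': "(\<integral>\<omega>. ?env k (?Y \<omega>) \<partial>N) - r / 4 < (\<integral>\<omega>. ?G (Suc m') \<omega> \<partial>N)"
    "\<forall>\<^sub>F n in sequentially. \<exists>A\<in>sets M. measure M A \<le> \<epsilon> \<and>
       (\<forall>\<omega>\<in>space M - A. \<forall>t\<in>{0..real k}. \<bar>X n \<omega> t - (\<Sum>i<nat \<lfloor>real (Suc m') * t\<rfloor>. V (Suc m') n i \<omega>)\<bar> \<le> \<epsilon>)"
    using eventually_happens[of _ sequentially] by auto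
  define m where "m = Suc m'"
  have m: "m > 0" by (simp add: m_def)
  define g where "g v = ?env k (grid_path m (\<lambda>j. \<Sum>i<j. v i))" for v
  let ?I = "\<lambda>i \<omega>. Y (real (Suc i) / real m) \<omega> - Y (real i / real m) \<omega>"
  have gC: "\<bar>g v\<bar> \<le> C" for v
    unfolding g_def by (rule envelope_bound[OF fC grid_path_in_skorokhod_space[OF m]])
  have glip: "\<bar>g v - g w\<bar> \<le> real k * (\<Sum>i<m * k. \<bar>v i - w i\<bar>)" for v w
    unfolding g_def by (rule envelope_increments_lipschitz[OF fC m])
  have telescope: "(\<Sum>i<j. ?I i \<omega>) = Y (real j / real m) \<omega> - Y 0 \<omega>" for j \<omega>
    using sum_lessThan_telescope[of "\<lambda>i. Y (real i / real m) \<omega>" j] by simp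
  have gI: "(\<integral>\<omega>. g (\<lambda>i. ?I i \<omega>) \<partial>N) = (\<integral>\<omega>. ?G m \<omega> \<partial>N)"
  proof (rule integral_cong_AE)
    show "(\<lambda>\<omega>. g (\<lambda>i. ?I i \<omega>)) \<in> borel_measurable N"
      by (rule lipschitz_function_measurable[OF gC glip]) (auto intro!: Y borel_measurable_diff)
    show "?G m \<in> borel_measurable N" using G_meas[of m'] by (simp add: m_def)
    show "AE \<omega> in N. g (\<lambda>i. ?I i \<omega>) = ?G m \<omega>"
      using Y0 by eventually_elim (simp only: g_def telescope diff_zero)
  qed
  \<comment> \<open>The finitely many relevant second moments have a common bound \<open>b\<close>.\<close>
  obtain c where c: "\<And>i. \<forall>\<^sub>F n in sequentially. (\<integral>\<omega>. V m n i \<omega> ^ 2 \<partial>M) \<le> c i"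
    using Vm[OF m] by metis
  have Isq: "integrable N (\<lambda>\<omega>. ?I i \<omega> ^ 2)" for i
    using m by (intro Ysq) (auto simp: divide_strict_right_mono)
  define b where "b = (\<Sum>i<m * k. \<bar>c i\<bar>) + (\<Sum>i<m * k. \<integral>\<omega>. ?I i \<omega> ^ 2 \<partial>N)"
  have nonneg: "0 \<le> (\<Sum>i<m * k. \<bar>c i\<bar>)" "0 \<le> (\<Sum>i<m * k. \<integral>\<omega>. ?I i \<omega> ^ 2 \<partial>N)"
    by (auto intro!: sum_nonneg)
  have "(\<lambda>n. \<integral>\<omega>. g (\<lambda>i. V m n i \<omega>) \<partial>M) \<longlonglongrightarrow> (\<integral>\<omega>. g (\<lambda>i. ?I i \<omega>) \<partial>N)"
  proof (rule lipschitz_convergence_from_products[OF M N _ _ Vsq _ Isq _ fdd[OF m] gC glip])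
    fix i assume i: "i < m * k"
    have "\<bar>c i\<bar> \<le> (\<Sum>i<m * k. \<bar>c i\<bar>)" using i by (intro member_le_sum) auto
    then have "c i \<le> b" using nonneg unfolding b_def by linarith
    then show "\<forall>\<^sub>F n in sequentially. (\<integral>\<omega>. V m n i \<omega> ^ 2 \<partial>M) \<le> b"
      using c[of i] by (auto elim: eventually_mono)
    have "(\<integral>\<omega>. ?I i \<omega> ^ 2 \<partial>N) \<le> (\<Sum>i<m * k. \<integral>\<omega>. ?I i \<omega> ^ 2 \<partial>N)"
      using i by (intro member_le_sum) auto
    then show "(\<integral>\<omega>. ?I i \<omega> ^ 2 \<partial>N) \<le> b" using nonneg unfolding b_def by linarith
  qed (auto intro!: Y borel_measurable_diff)
  then have "\<forall>\<^sub>F n in sequentially. (\<integral>\<omega>. ?G m \<omega> \<partial>N) - r / 4 < (\<integral>\<omega>. g (\<lambda>i. V m n i \<omega>) \<partial>M)"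
    unfolding gI by (rule order_tendstoD(1)) (use r in simp)
  moreover have "\<forall>\<^sub>F n in sequentially. \<exists>A\<in>sets M. measure M A \<le> \<epsilon> \<and>
       (\<forall>\<omega>\<in>space M - A. \<forall>t\<in>{0..real k}. \<bar>X n \<omega> t - (\<Sum>i<nat \<lfloor>real m * t\<rfloor>. V m n i \<omega>)\<bar> \<le> \<epsilon>)"
    using m'(2) by (simp only: m_def)
  ultimately show ?thesis
  proof eventually_elim
    case (elim n)
    then obtain A where A: "A \<in> sets M" "measure M A \<le> \<epsilon>"
      and close: "\<And>\<omega> t. \<omega> \<in> space M - A \<Longrightarrow> t \<in> {0..real k} \<Longrightarrow>
        \<bar>X n \<omega> t - (\<Sum>i<nat \<lfloor>real m * t\<rfloor>. V m n i \<omega>)\<bar> \<le> \<epsilon>" by blast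
    have ig: "integrable M (\<lambda>\<omega>. g (\<lambda>i. V m n i \<omega>))"
      by (rule M.integrable_const_bound[of _ C])
         (use gC lipschitz_function_measurable[OF gC glip, of "V m n" M] in auto)
    have iF: "integrable M (\<lambda>\<omega>. f (X n \<omega>))"
      by (rule M.integrable_const_bound[of _ C]) (use fC[OF XD] in auto)
    have iA: "integrable M (indicator A :: 'a \<Rightarrow> real)"
      by (rule integrable_real_indicator[OF A(1)]) (simp add: M.emeasure_eq_measure)
    have "(\<integral>\<omega>. g (\<lambda>i. V m n i \<omega>) - real k * \<epsilon> - 2 * C * indicator A \<omega> \<partial>M) \<le> (\<integral>\<omega>. f (X n \<omega>) \<partial>M)"
    proof (intro integral_mono iF Bochner_Integration.integrable_diff ig integrable_mult_right iA)
      fix \<omega> assume w: "\<omega> \<in> space M"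
      show "g (\<lambda>i. V m n i \<omega>) - real k * \<epsilon> - 2 * C * indicator A \<omega> \<le> f (X n \<omega>)"
      proof (cases "\<omega> \<in> A")
        case True
        have "0 \<le> real k * \<epsilon>" using \<epsilon> by simp
        then show ?thesis using True gC[of "\<lambda>i. V m n i \<omega>"] fC[OF XD[OF w], of n] by simp
      next
        case False
        have "\<bar>g (\<lambda>i. V m n i \<omega>) - ?env k (X n \<omega>)\<bar> \<le> real k * \<epsilon>"
          unfolding g_def
        proof (rule envelope_lipschitz[OF fC grid_path_in_skorokhod_space[OF m] XD[OF w]])
          fix t assume t: "t \<in> {0..real k}"
          then show "\<bar>grid_path m (\<lambda>j. \<Sum>i<j. V m n i \<omega>) t - X n \<omega> t\<bar> \<le> \<epsilon>"
            using close[of \<omega> t] w False by (simp add: grid_path_def abs_minus_commute)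
        qed (auto intro: less_imp_le[OF \<epsilon>(1)])
        moreover have "?env k (X n \<omega>) \<le> f (X n \<omega>)" by (rule envelope_le[OF fC XD[OF w]])
        ultimately show ?thesis using False by simp
      qed
    qed simp
    also have "(\<integral>\<omega>. g (\<lambda>i. V m n i \<omega>) - real k * \<epsilon> - 2 * C * indicator A \<omega> \<partial>M) =
        (\<integral>\<omega>. g (\<lambda>i. V m n i \<omega>) \<partial>M) - real k * \<epsilon> - 2 * C * measure M A"
      using ig iA sets.sets_into_space[OF A(1)] by (simp add: M.prob_space Int_absorb2)
    finally have "(\<integral>\<omega>. g (\<lambda>i. V m n i \<omega>) \<partial>M) - real k * \<epsilon> - 2 * C * measure M A \<le> (\<integral>\<omega>. f (X n \<omega>) \<partial>M)" .
    moreover have "2 * C * measure M A \<le> 2 * C * \<epsilon>" using A C by (intro mult_left_mono) auto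
    ultimately show ?case
      using elim(1) m'(1) k \<epsilon>(2) unfolding m_def[symmetric] by (simp add: algebra_simps)
  qed
qed

section \<open>Gaussian laws\<close>

abbreviation normal_law :: "real \<Rightarrow> real measure" where
  "normal_law \<sigma> \<equiv> density lborel (normal_density 0 \<sigma>)"

lemma real_distribution_normal_law: "0 < \<sigma> \<Longrightarrow> real_distribution (normal_law \<sigma>)"
  using prob_space_normal_density[of \<sigma> 0]
  by (simp add: real_distribution_def real_distribution_axioms_def)

lemma char_normal_law:
  assumes "0 < \<sigma>"
  shows "char (normal_law \<sigma>) u = of_real (exp (- (u\<^sup>2 * \<sigma>\<^sup>2) / 2))"
proof -
  interpret P: prob_space std_normal_distribution
    using real_dist_normal_dist by (simp add: real_distribution_def)
  have "distributed std_normal_distribution lborel (\<lambda>x. x) std_normal_density"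
    by (simp add: distributed_def distr_id2)
  from P.normal_density_affine[OF this, of \<sigma> 0] assms
  have "distributed std_normal_distribution lborel (\<lambda>x. \<sigma> * x) (normal_density 0 \<sigma>)" by simp
  then have "normal_law \<sigma> = distr std_normal_distribution lborel (\<lambda>x. \<sigma> * x)"
    by (simp add: distributed_def)
  then have "char (normal_law \<sigma>) u = (\<integral>x. iexp (u * (\<sigma> * x)) \<partial>std_normal_distribution)"
    unfolding char_def by (simp add: integral_distr)
  also have "\<dots> = char std_normal_distribution (u * \<sigma>)"
    unfolding char_def by (simp add: mult.assoc)
  finally show ?thesis
    unfolding char_std_normal_distribution by (simp add: power_mult_distrib)
qed

lemma integral_normal_law:
  fixes h :: "real \<Rightarrow> real"
  assumes N: "prob_space N" and X: "distributed N lborel X (normal_density 0 \<sigma>)"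
    and [measurable]: "h \<in> borel_measurable borel"
  shows "(\<integral>x. h x \<partial>normal_law \<sigma>) = (\<integral>\<omega>. h (X \<omega>) \<partial>N)"
proof -
  have "(\<integral>x. h x \<partial>normal_law \<sigma>) = (\<integral>x. normal_density 0 \<sigma> x * h x \<partial>lborel)"
    by (subst integral_density) auto
  also have "\<dots> = (\<integral>\<omega>. h (X \<omega>) \<partial>N)"
    by (rule distributed_integral[OF X]) auto
  finally show ?thesis .
qed

context standard_brownian_motion
begin

lemma scaled_increment_normal:
  assumes "0 \<le> s" "s < t" "0 < \<sigma>"
  shows "distributed N lborel (\<lambda>\<omega>. \<sigma> * B t \<omega> - \<sigma> * B s \<omega>) (normal_density 0 (\<sigma> * sqrt (t - s)))"
  using normal_density_affine[OF B_increment_normal[OF assms(1,2)], of \<sigma> 0] assms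
  by (simp add: right_diff_distrib)

lemma scaled_increment_sq_integrable:
  assumes "0 \<le> s" "s < t" "0 < \<sigma>"
  shows "integrable N (\<lambda>\<omega>. (\<sigma> * B t \<omega> - \<sigma> * B s \<omega>) ^ 2)"
proof -
  have "0 < \<sigma> * sqrt (t - s)" using assms by simp
  from integrable_normal_moment[OF this, of 0 2]
  have "integrable lborel (\<lambda>x. normal_density 0 (\<sigma> * sqrt (t - s)) x * x ^ 2)" by simp
  then show ?thesis
    by (subst (asm) distributed_integrable[OF scaled_increment_normal[OF assms]]) auto
qed

lemma expectation_prod_increments:
  assumes m: "m > 0" and \<sigma>: "0 < \<sigma>"
    and h: "\<And>j. continuous_on UNIV (h j)" "\<And>j x. 0 \<le> h j x \<and> h j x \<le> (1 :: real)"
  shows "expectation (\<lambda>\<omega>. \<Prod>i<K. h i (\<sigma> * B (real (Suc i) / real m) \<omega> - \<sigma> * B (real i / real m) \<omega>)) =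
         (\<Prod>i<K. \<integral>x. h i x \<partial>normal_law (\<sigma> / sqrt (real m)))"
proof -
  let ?I = "\<lambda>i \<omega>. B (real (Suc i) / real m) \<omega> - B (real i / real m) \<omega>"
  have [measurable]: "h j \<in> borel_measurable borel" for j
    by (rule borel_measurable_continuous_onI[OF h(1)])
  have "mono (\<lambda>i. real i / real m)" by (intro monoI divide_right_mono) auto
  then have "indep_vars (\<lambda>_. borel) (\<lambda>i \<omega>. ?I i \<omega>) {..<K}"
    by (intro B_indep_increments) auto
  then have ind: "indep_vars (\<lambda>_. borel) (\<lambda>i \<omega>. h i (\<sigma> * ?I i \<omega>)) {..<K}"
    by (rule indep_vars_compose2) auto
  have eq: "\<sigma> * B t \<omega> - \<sigma> * B s \<omega> = \<sigma> * (B t \<omega> - B s \<omega>)" for s t \<omega>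
    by (simp add: right_diff_distrib)
  have le: "0 \<le> real i / real m" "real i / real m < real (Suc i) / real m" for i
    using m by (auto simp: divide_strict_right_mono)
  have [measurable]: "random_variable borel (\<lambda>\<omega>. \<sigma> * B (real (Suc i) / real m) \<omega> - \<sigma> * B (real i / real m) \<omega>)" for i
    using scaled_increment_normal[OF le \<sigma>, of i] by (auto simp: distributed_def)
  have int: "integrable N (\<lambda>\<omega>. h i (\<sigma> * ?I i \<omega>))" for i
  proof (rule integrable_const_bound[of _ 1])
    show "(\<lambda>\<omega>. h i (\<sigma> * ?I i \<omega>)) \<in> borel_measurable N" unfolding eq[symmetric] by measurable
  qed (use h(2) in auto)
  have "expectation (\<lambda>\<omega>. \<Prod>i<K. h i (\<sigma> * ?I i \<omega>)) = (\<Prod>i<K. expectation (\<lambda>\<omega>. h i (\<sigma> * ?I i \<omega>)))"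
    by (rule indep_vars_lebesgue_integral[OF _ ind int]) simp
  also have "\<dots> = (\<Prod>i<K. \<integral>x. h i x \<partial>normal_law (\<sigma> / sqrt (real m)))"
  proof (rule prod.cong[OF refl])
    fix i
    have "real (Suc i) / real m - real i / real m = 1 / real m"
      by (simp add: add_divide_distrib)
    then have sd: "\<sigma> * sqrt (real (Suc i) / real m - real i / real m) = \<sigma> / sqrt (real m)"
      by (simp only:) (simp add: real_sqrt_divide)
    from scaled_increment_normal[OF le \<sigma>, of i] have
      "distributed N lborel (\<lambda>\<omega>. \<sigma> * B (real (Suc i) / real m) \<omega> - \<sigma> * B (real i / real m) \<omega>)
        (normal_density 0 (\<sigma> / sqrt (real m)))" unfolding sd .
    from integral_normal_law[OF prob_space_axioms this, of "h i"]
    show "expectation (\<lambda>\<omega>. h i (\<sigma> * ?I i \<omega>)) = (\<integral>x. h i x \<partial>normal_law (\<sigma> / sqrt (real m)))"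
      unfolding eq by simp
  qed
  finally show ?thesis unfolding eq .
qed

end

section \<open>The critical walk as a martingale\<close>

locale critical_elephant_random_walk = dynamic_elephant_random_walk M p q \<alpha> \<beta>s S
  for M :: "'a measure" and p q :: real and \<alpha> \<beta>s :: "nat \<Rightarrow> real" and S :: "nat \<Rightarrow> 'a \<Rightarrow> int" +
  fixes \<beta> :: real
  assumes \<alpha>_critical: "\<And>n. n \<ge> 1 \<Longrightarrow> \<alpha> n = 1 / (4 * p - 2)"
    and \<beta>_limit: "\<beta>s \<longlonglongrightarrow> \<beta>"
    and regime: "(3 / 4 \<le> p \<and> p < 1) \<or> (p = 1 \<and> 0 < \<beta> \<and> \<beta> < 1)"
begin

definition step :: "nat \<Rightarrow> 'a \<Rightarrow> real" where
  "step j \<omega> = real_of_int (increment S j \<omega>)"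

definition drift :: "nat \<Rightarrow> real" where
  "drift j = (1 - 1 / (4 * p - 2)) * (2 * \<beta>s j - 1)"

definition limit_drift :: real where
  "limit_drift = (1 - 1 / (4 * p - 2)) * (2 * \<beta> - 1)"

definition cond_mean :: "nat \<Rightarrow> 'a \<Rightarrow> real" where
  "cond_mean j \<omega> = (if j \<le> 1 then expectation (step 1)
     else real_of_int (S (j - 1) \<omega>) / (2 * real (j - 1)) + drift j)"

text \<open>Dividing the innovation by the growth factor turns the centered walk into a martingale. At time
  zero there is no innovation.\<close>

definition noise :: "nat \<Rightarrow> 'a \<Rightarrow> real" where
  "noise j \<omega> = (if j = 0 then 0 else (step j \<omega> - cond_mean j \<omega>) / critical_growth j)"

lemma p_bounds: "3 / 4 \<le> p" "p \<le> 1"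
  using regime by auto

lemma drift_weight_bounds: "0 \<le> 1 - 1 / (4 * p - 2)" "1 - 1 / (4 * p - 2) \<le> 1 / 2"
  using p_bounds by (auto simp: field_simps)

lemma drift_bound: "1 \<le> j \<Longrightarrow> \<bar>drift j\<bar> \<le> 1 / 2"
proof -
  assume "1 \<le> j"
  then have "\<bar>2 * \<beta>s j - 1\<bar> \<le> 1" using \<beta>_range[of j] by auto
  then have "\<bar>1 - 1 / (4 * p - 2)\<bar> * \<bar>2 * \<beta>s j - 1\<bar> \<le> 1 / 2 * 1"
    using drift_weight_bounds by (intro mult_mono) auto
  then show ?thesis by (simp add: drift_def abs_mult)
qed

lemma drift_limit: "drift \<longlonglongrightarrow> limit_drift"
  unfolding drift_def[abs_def] limit_drift_def by (intro tendsto_intros \<beta>_limit)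

lemma limit_variance_eq: "limit_variance \<beta> p = 1 - (2 * limit_drift) ^ 2"
  by (simp add: limit_variance_def limit_drift_def power_mult_distrib)

text \<open>For \<open>p < 1\<close> the memory weight is strictly larger than one half, and for \<open>p = 1\<close> it equals one
  half but then \<open>\<beta>\<close> lies strictly between 0 and 1. This is why the limit variance is positive.\<close>

lemma limit_drift_bound: "\<bar>2 * limit_drift\<bar> < 1"
proof -
  let ?g = "1 - 1 / (4 * p - 2)"
  have \<beta>01: "0 \<le> \<beta>" "\<beta> \<le> 1"
    by (rule LIMSEQ_le_const[OF \<beta>_limit], use \<beta>_range in auto)
       (rule LIMSEQ_le_const2[OF \<beta>_limit], use \<beta>_range in auto)
  show ?thesis
  proof (cases "p < 1")
    case True
    have "?g < 1 / 2" using p_bounds True by (simp add: field_simps)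
    moreover have "\<bar>?g\<bar> * \<bar>2 * \<beta> - 1\<bar> \<le> \<bar>?g\<bar> * 1" using \<beta>01 by (intro mult_left_mono) auto
    ultimately show ?thesis
      using drift_weight_bounds by (simp add: limit_drift_def abs_mult)
  next
    case False
    then have "p = 1" "0 < \<beta>" "\<beta> < 1" using regime by auto
    then have "2 * limit_drift = 2 * \<beta> - 1" unfolding limit_drift_def by simp
    then show ?thesis using \<open>0 < \<beta>\<close> \<open>\<beta> < 1\<close> by linarith
  qed
qed

lemma limit_variance_pos: "0 < limit_variance \<beta> p"
  and limit_variance_le_1: "limit_variance \<beta> p \<le> 1"
proof -
  show "0 < limit_variance \<beta> p"
    unfolding limit_variance_eq using limit_drift_bound abs_square_less_1[of "2 * limit_drift"]
    by linarith
  show "limit_variance \<beta> p \<le> 1" unfolding limit_variance_eq by simp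
qed

lemma step_abs: "1 \<le> j \<Longrightarrow> \<omega> \<in> space M \<Longrightarrow> \<bar>step j \<omega>\<bar> = 1"
  using increment_range[of j \<omega>] by (auto simp: step_def)

lemma S_Suc: "real_of_int (S (Suc j) \<omega>) = real_of_int (S j \<omega>) + step (Suc j) \<omega>"
  by (simp add: step_def increment_def)

lemma S_bound: "\<omega> \<in> space M \<Longrightarrow> \<bar>real_of_int (S j \<omega>)\<bar> \<le> real j"
proof (induction j)
  case (Suc j)
  then show ?case using step_abs[of "Suc j" \<omega>] unfolding S_Suc by simp
qed (simp add: S_0)

lemma S_sum: "\<omega> \<in> space M \<Longrightarrow> real_of_int (S j \<omega>) = (\<Sum>i\<in>{1..j}. step i \<omega>)"
  by (induction j) (auto simp: S_0 S_Suc)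

lemma S_borel [measurable]: "(\<lambda>\<omega>. real_of_int (S j \<omega>)) \<in> borel_measurable M"
  using measurable_compose[OF S_measurable[of j], of real_of_int borel] by simp

lemma step_borel [measurable]: "step j \<in> borel_measurable M"
  unfolding step_def[abs_def] increment_def by simp

lemma integrable_S: "integrable M (\<lambda>\<omega>. real_of_int (S j \<omega>))"
  by (rule integrable_const_bound[of _ "real j"]) (use S_bound in auto)

lemma integrable_step: "1 \<le> j \<Longrightarrow> integrable M (step j)"
  by (rule integrable_const_bound[of _ 1]) (use step_abs in auto)

lemma expectation_step_1_bound: "\<bar>expectation (step 1)\<bar> \<le> 1"
proof -
  have "\<bar>expectation (step 1)\<bar> \<le> expectation (\<lambda>\<omega>. \<bar>step 1 \<omega>\<bar>)" by (rule integral_abs_bound)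
  also have "\<dots> = expectation (\<lambda>_. 1)"
    by (intro Bochner_Integration.integral_cong) (use step_abs in auto)
  finally show ?thesis by (simp add: prob_space)
qed

lemma cond_mean_bound: "\<omega> \<in> space M \<Longrightarrow> \<bar>cond_mean j \<omega>\<bar> \<le> 1"
proof (cases "j \<le> 1")
  case False
  assume w: "\<omega> \<in> space M"
  have "\<bar>real_of_int (S (j - 1) \<omega>) / (2 * real (j - 1))\<bar> \<le> 1 / 2"
    using S_bound[OF w, of "j - 1"] False by (simp add: abs_mult field_simps)
  moreover have "\<bar>drift j\<bar> \<le> 1 / 2" using drift_bound[of j] False by simp
  moreover have "\<bar>a + b\<bar> \<le> 1" if "\<bar>a\<bar> \<le> 1 / 2" "\<bar>b\<bar> \<le> 1 / 2" for a b :: real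
    using that by linarith
  ultimately show ?thesis using False by (simp only: cond_mean_def if_False)
qed (use expectation_step_1_bound in \<open>simp add: cond_mean_def\<close>)

lemma noise_bound: "\<omega> \<in> space M \<Longrightarrow> \<bar>noise j \<omega>\<bar> \<le> 2 / critical_growth j"
proof (cases "j = 0")
  case False
  assume w: "\<omega> \<in> space M"
  have "\<bar>step j \<omega> - cond_mean j \<omega>\<bar> \<le> 2"
    using step_abs[of j, OF _ w] cond_mean_bound[OF w, of j] False by simp
  then show ?thesis
    using False critical_growth_pos[of j] by (simp add: noise_def abs_divide divide_right_mono)
qed (use critical_growth_pos[of 0] in \<open>simp add: noise_def\<close>)

lemma space_history: "space (history M S j) = space M"
  by (auto simp: history_def space_measure_of_conv)

lemma sets_history: "sets (history M S j) =
    sigma_sets (space M) (\<Union>i\<in>{1..j}. {increment S i -` A \<inter> space M | A. A \<in> sets (count_space UNIV)})"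
  unfolding history_def by (rule sets_measure_of) auto

lemma increment_measurable: "increment S i \<in> M \<rightarrow>\<^sub>M count_space UNIV"
proof -
  have [measurable]: "S j \<in> M \<rightarrow>\<^sub>M count_space UNIV" for j by (rule S_measurable)
  show ?thesis unfolding increment_def[abs_def] by measurable
qed

lemma history_subset: "sets (history M S j) \<subseteq> sets M"
  unfolding sets_history
  by (rule sets.sigma_sets_subset) (auto intro!: measurable_sets[OF increment_measurable])

lemma history_mono: "i \<le> j \<Longrightarrow> sets (history M S i) \<subseteq> sets (history M S j)"
  unfolding sets_history by (rule sigma_sets_mono') fastforce

lemma step_history: "1 \<le> i \<Longrightarrow> i \<le> j \<Longrightarrow> step i \<in> borel_measurable (history M S j)"
proof -
  assume i: "1 \<le> i" "i \<le> j"
  have "increment S i \<in> history M S j \<rightarrow>\<^sub>M count_space UNIV"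
  proof (rule measurableI)
    fix A :: "int set" assume "A \<in> sets (count_space UNIV)"
    then show "increment S i -` A \<inter> space (history M S j) \<in> sets (history M S j)"
      unfolding space_history sets_history using i by (intro sigma_sets.Basic UN_I[of i]) auto
  qed simp
  then show ?thesis
    unfolding step_def[abs_def] by (rule measurable_compose) simp
qed

lemma S_history:
  assumes "i \<le> j"
  shows "(\<lambda>\<omega>. real_of_int (S i \<omega>)) \<in> borel_measurable (history M S j)"
proof -
  have "(\<lambda>\<omega>. \<Sum>k\<in>{1..i}. step k \<omega>) \<in> borel_measurable (history M S j)"
    using assms by (intro borel_measurable_sum step_history) auto
  then show ?thesis
    by (rule measurable_cong[THEN iffD1, rotated]) (simp add: space_history S_sum)
qed

lemma cond_mean_adapted: "bounded_adapted (history M S j) (cond_mean (Suc j))"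
proof (rule bounded_adaptedI)
  show "cond_mean (Suc j) \<in> borel_measurable (history M S j)"
    using S_history[of j j] unfolding cond_mean_def[abs_def] by (cases "j = 0") auto
qed (use cond_mean_bound space_history in auto)

lemma noise_adapted: "noise j \<in> borel_measurable (history M S j)"
proof (cases j)
  case (Suc i)
  have "cond_mean (Suc i) \<in> borel_measurable (history M S (Suc i))"
    using bounded_adapted_mono[OF cond_mean_adapted[of i], where G = "history M S (Suc i)"] history_mono[of i "Suc i"]
    by (simp add: space_history bounded_adapted_def)
  then show ?thesis
    using step_history[of "Suc i" "Suc i"] unfolding Suc noise_def[abs_def] by simp
qed (simp add: noise_def[abs_def])

lemma finite_measure_subalgebra_history: "finite_measure_subalgebra M (history M S j)"
  by unfold_locales (use space_history history_subset in \<open>simp add: subalgebra_def\<close>)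

lemma history_0_trivial:
  assumes "Z \<in> borel_measurable (history M S 0)" "\<omega> \<in> space M" "\<omega>' \<in> space M"
  shows "Z \<omega> = (Z \<omega>' :: real)"
proof -
  have "Z -` {Z \<omega>} \<inter> space (history M S 0) \<in> sets (history M S 0)"
    by (rule measurable_sets[OF assms(1)]) simp
  then have "Z -` {Z \<omega>} \<inter> space M \<in> {{}, space M}"
    unfolding space_history sets_history by (simp add: sigma_sets_empty_eq)
  moreover have "\<omega> \<in> Z -` {Z \<omega>} \<inter> space M" using assms(2) by simp
  ultimately have "Z -` {Z \<omega>} \<inter> space M = space M" by blast
  then have "\<omega>' \<in> Z -` {Z \<omega>}" using assms(3) by blast
  then show ?thesis by simp
qed

text \<open>For the first step the past is trivial, so a variable of the past is constant. For later steps
  this is the defining property of the conditional expectation, combined with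
  \<open>\<alpha> (2 p - 1) = 1 / 2\<close>.\<close>

lemma noise_orthogonal:
  assumes Z: "bounded_adapted (history M S j) Z"
  shows "expectation (\<lambda>\<omega>. Z \<omega> * noise (Suc j) \<omega>) = 0"
proof (cases "j = 0")
  case True
  obtain \<omega>0 where w0: "\<omega>0 \<in> space M" using not_empty by auto
  have "expectation (\<lambda>\<omega>. Z \<omega> * noise (Suc j) \<omega>) = expectation (\<lambda>\<omega>. Z \<omega>0 * (step 1 \<omega> - expectation (step 1)))"
  proof (rule Bochner_Integration.integral_cong[OF refl])
    fix \<omega> assume w: "\<omega> \<in> space M"
    have "Z \<omega> = Z \<omega>0"
      by (rule history_0_trivial[OF _ w w0]) (use Z True in \<open>simp add: bounded_adapted_def\<close>)
    then show "Z \<omega> * noise (Suc j) \<omega> = Z \<omega>0 * (step 1 \<omega> - expectation (step 1))"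
      using True by (simp add: noise_def cond_mean_def)
  qed
  also have "\<dots> = 0" using integrable_step[of 1] by (simp add: prob_space)
  finally show ?thesis .
next
  case False
  interpret H: finite_measure_subalgebra M "history M S j" by (rule finite_measure_subalgebra_history)
  have Zm: "Z \<in> borel_measurable (history M S j)" using Z by (simp add: bounded_adapted_def)
  have ZM: "bounded_adapted M Z" and cM: "bounded_adapted M (cond_mean (Suc j))"
    using bounded_adapted_mono[OF Z, where G = M] bounded_adapted_mono[OF cond_mean_adapted, where G = M] history_subset
    by (simp_all add: space_history)
  have bounded_int: "integrable M W" if "bounded_adapted M W" for W
    using that unfolding bounded_adapted_def by (auto intro!: integrable_const_bound AE_I2)
  have sM: "bounded_adapted M (step (Suc j))"
    by (rule bounded_adaptedI[where C = 1]) (use step_abs in auto)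
  have i1: "integrable M (\<lambda>\<omega>. Z \<omega> * step (Suc j) \<omega>)"
    by (rule bounded_int[OF bounded_adapted_mult[OF ZM sM]])
  have i2: "integrable M (\<lambda>\<omega>. Z \<omega> * cond_mean (Suc j) \<omega>)"
    by (rule bounded_int[OF bounded_adapted_mult[OF ZM cM]])
  have \<alpha>: "\<alpha> (Suc j) * (2 * p - 1) = 1 / 2"
    using \<alpha>_critical[of "Suc j"] p_bounds by (simp add: field_simps)
  have "AE \<omega> in M. real_cond_exp M (history M S j) (step (Suc j)) \<omega> = cond_mean (Suc j) \<omega>"
  proof -
    have "AE \<omega> in M. real_cond_exp M (history M S j) (\<lambda>\<omega>. real_of_int (increment S (Suc j) \<omega>)) \<omega> =
        \<alpha> (Suc j) * (2 * p - 1) / real j * real_of_int (S j \<omega>) + (1 - \<alpha> (Suc j)) * (2 * \<beta>s (Suc j) - 1)"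
      using cond_exp_next[of j] False by simp
    then show ?thesis
    proof eventually_elim
      case (elim \<omega>)
      have "1 - \<alpha> (Suc j) = 1 - 1 / (4 * p - 2)" using \<alpha>_critical[of "Suc j"] by simp
      then have "(1 - \<alpha> (Suc j)) * (2 * \<beta>s (Suc j) - 1) = drift (Suc j)" by (simp only: drift_def)
      moreover have "1 / 2 / real j * real_of_int (S j \<omega>) = real_of_int (S j \<omega>) / (2 * real j)" by simp
      ultimately show ?case
        using elim False unfolding \<alpha> by (simp add: step_def[abs_def] cond_mean_def)
    qed
  qed
  then have "AE \<omega> in M. Z \<omega> * real_cond_exp M (history M S j) (step (Suc j)) \<omega> = Z \<omega> * cond_mean (Suc j) \<omega>"
    by (auto elim!: eventually_mono)
  then have "expectation (\<lambda>\<omega>. Z \<omega> * cond_mean (Suc j) \<omega>) =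
      expectation (\<lambda>\<omega>. Z \<omega> * real_cond_exp M (history M S j) (step (Suc j)) \<omega>)"
    using H.real_cond_exp_intg(1)[OF i1 Zm step_borel] i2
    by (intro integral_cong_AE) (auto elim!: eventually_mono)
  also have "\<dots> = expectation (\<lambda>\<omega>. Z \<omega> * step (Suc j) \<omega>)"
    by (rule H.real_cond_exp_intg(2)[OF i1 Zm step_borel])
  finally have "expectation (\<lambda>\<omega>. (Z \<omega> * step (Suc j) \<omega> - Z \<omega> * cond_mean (Suc j) \<omega>) / critical_growth (Suc j)) = 0"
    using i1 i2 by simp
  moreover have "(\<lambda>\<omega>. (Z \<omega> * step (Suc j) \<omega> - Z \<omega> * cond_mean (Suc j) \<omega>) / critical_growth (Suc j)) =
      (\<lambda>\<omega>. Z \<omega> * noise (Suc j) \<omega>)"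
    by (auto simp: noise_def field_simps)
  ultimately show ?thesis by simp
qed

sublocale bounded_martingale_differences M "history M S" noise "\<lambda>j. 2 / critical_growth j"
  by unfold_locales
    (use space_history history_subset history_mono noise_adapted noise_bound noise_orthogonal in auto)

definition cond_var :: "nat \<Rightarrow> 'a \<Rightarrow> real" where
  "cond_var j \<omega> = (1 - cond_mean j \<omega> ^ 2) / critical_growth j ^ 2"

lemma cond_var_adapted: "bounded_adapted (history M S j) (cond_var (Suc j))"
proof -
  have eq: "cond_var (Suc j) = (\<lambda>\<omega>. (1 + (- 1) * cond_mean (Suc j) \<omega> ^ 2) * (1 / critical_growth (Suc j) ^ 2))"
    by (auto simp: cond_var_def)
  show ?thesis unfolding eq by (intro bounded_adapted_intros cond_mean_adapted)
qed

text \<open>Since the steps have modulus one, the square of the noise differs from the conditional variance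
  by a predictable multiple of the noise itself.\<close>

lemma expectation_noise_sq:
  assumes Z: "bounded_adapted (history M S j) Z"
  shows "expectation (\<lambda>\<omega>. Z \<omega> * noise (Suc j) \<omega> ^ 2) = expectation (\<lambda>\<omega>. Z \<omega> * cond_var (Suc j) \<omega>)"
proof -
  let ?a = "critical_growth (Suc j)"
  let ?W = "\<lambda>\<omega>. Z \<omega> * (cond_mean (Suc j) \<omega> * (- 2 / ?a))"
  have W: "bounded_adapted (history M S j) ?W" by (intro bounded_adapted_intros Z cond_mean_adapted)
  have i1: "integrable M (\<lambda>\<omega>. Z \<omega> * cond_var (Suc j) \<omega>)"
    by (rule integrable_adapted[OF bounded_adapted_mult[OF Z cond_var_adapted]])
  have i2: "integrable M (\<lambda>\<omega>. ?W \<omega> * noise (Suc j) \<omega>)"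
    by (rule integrable_adapted[OF bounded_adapted_mult[OF adapted_mono[OF W] adapted_d], of "Suc j"]) auto
  have "expectation (\<lambda>\<omega>. Z \<omega> * noise (Suc j) \<omega> ^ 2) =
      expectation (\<lambda>\<omega>. Z \<omega> * cond_var (Suc j) \<omega> + ?W \<omega> * noise (Suc j) \<omega>)"
  proof (rule Bochner_Integration.integral_cong[OF refl])
    fix \<omega> assume w: "\<omega> \<in> space M"
    define x c where "x = step (Suc j) \<omega>" and "c = cond_mean (Suc j) \<omega>"
    have "x ^ 2 = 1" using step_abs[of "Suc j" \<omega>] w by (metis x_def le_add1 one_power2 plus_1_eq_Suc power2_abs)
    then have "(x - c) ^ 2 = (1 - c ^ 2) + c * (- 2) * (x - c)"
      by (simp add: power2_eq_square algebra_simps)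
    then have "((x - c) / ?a) ^ 2 = (1 - c ^ 2) / ?a ^ 2 + c * (- 2) * (x - c) / ?a ^ 2"
      by (simp only: power_divide add_divide_distrib)
    moreover have "c * (- 2) * y / ?a ^ 2 = (c * (- 2 / ?a)) * (y / ?a)" for y
      by (simp add: power2_eq_square)
    ultimately have "((x - c) / ?a) ^ 2 = (1 - c ^ 2) / ?a ^ 2 + (c * (- 2 / ?a)) * ((x - c) / ?a)"
      by (simp only:)
    then have "noise (Suc j) \<omega> ^ 2 = cond_var (Suc j) \<omega> + (c * (- 2 / ?a)) * noise (Suc j) \<omega>"
      by (simp add: noise_def cond_var_def x_def c_def)
    then show "Z \<omega> * noise (Suc j) \<omega> ^ 2 = Z \<omega> * cond_var (Suc j) \<omega> + ?W \<omega> * noise (Suc j) \<omega>"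
      by (simp only: distrib_left c_def mult.assoc)
  qed
  then show ?thesis using i1 i2 noise_orthogonal[OF W] by simp
qed

lemma expectation_S_Suc:
  assumes "1 \<le> j"
  shows "expectation (\<lambda>\<omega>. real_of_int (S (Suc j) \<omega>)) =
    (1 + 1 / (2 * real j)) * expectation (\<lambda>\<omega>. real_of_int (S j \<omega>)) + drift (Suc j)"
proof -
  have "expectation (\<lambda>\<omega>. 1 * noise (Suc j) \<omega>) = 0"
    by (rule noise_orthogonal[OF bounded_adapted_const])
  then have "expectation (\<lambda>\<omega>. real_of_int (S (Suc j) \<omega>)) =
     expectation (\<lambda>\<omega>. real_of_int (S (Suc j) \<omega>) - critical_growth (Suc j) * noise (Suc j) \<omega>)"
    using integrable_S integrable_adapted[OF adapted_d[OF order_refl, of "Suc j"]] by simp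
  also have "\<dots> = expectation (\<lambda>\<omega>. (1 + 1 / (2 * real j)) * real_of_int (S j \<omega>) + drift (Suc j))"
  proof (rule Bochner_Integration.integral_cong[OF refl])
    fix \<omega>
    have "critical_growth (Suc j) * noise (Suc j) \<omega> = step (Suc j) \<omega> - cond_mean (Suc j) \<omega>"
      using critical_growth_pos[of "Suc j"] by (simp add: noise_def)
    moreover have "cond_mean (Suc j) \<omega> = real_of_int (S j \<omega>) / (2 * real j) + drift (Suc j)"
      using assms by (simp add: cond_mean_def)
    ultimately show "real_of_int (S (Suc j) \<omega>) - critical_growth (Suc j) * noise (Suc j) \<omega> =
        (1 + 1 / (2 * real j)) * real_of_int (S j \<omega>) + drift (Suc j)"
      by (simp add: S_Suc algebra_simps)
  qed
  also have "\<dots> = (1 + 1 / (2 * real j)) * expectation (\<lambda>\<omega>. real_of_int (S j \<omega>)) + drift (Suc j)"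
    using integrable_S[of j] by (simp add: prob_space)
  finally show ?thesis .
qed

text \<open>Criticality means that the centered walk obeys the recursion of \<open>critical_growth\<close> up to the
  innovation, so variation of constants applies.\<close>

lemma centered_walk:
  assumes "1 \<le> j" "\<omega> \<in> space M"
  shows "real_of_int (S j \<omega>) - expectation (\<lambda>\<omega>. real_of_int (S j \<omega>)) = critical_growth j * block 0 j \<omega>"
  using assms(1)
proof (induction j rule: dec_induct)
  case base
  have S1: "real_of_int (S 1 \<omega>) = step 1 \<omega>" if "\<omega> \<in> space M" for \<omega>
    using S_0[OF that] S_Suc[of 0 \<omega>] by simp
  then have "expectation (\<lambda>\<omega>. real_of_int (S 1 \<omega>)) = expectation (step 1)"
    by (intro Bochner_Integration.integral_cong) auto
  moreover have "noise 1 \<omega> = step 1 \<omega> - expectation (step 1)"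
    by (simp add: noise_def cond_mean_def)
  ultimately show ?case using S1[OF assms(2)] block_Suc[of 0 0 \<omega>] by simp
next
  case (step j)
  let ?E = "\<lambda>j. expectation (\<lambda>\<omega>. real_of_int (S j \<omega>))"
  have "real_of_int (S (Suc j) \<omega>) =
      real_of_int (S j \<omega>) + cond_mean (Suc j) \<omega> + critical_growth (Suc j) * noise (Suc j) \<omega>"
    using critical_growth_pos[of "Suc j"] by (simp add: S_Suc noise_def)
  also have "cond_mean (Suc j) \<omega> = real_of_int (S j \<omega>) / (2 * real j) + drift (Suc j)"
    using step(1) by (simp add: cond_mean_def)
  finally have "real_of_int (S (Suc j) \<omega>) - ?E (Suc j) =
      (1 + 1 / (2 * real j)) * (real_of_int (S j \<omega>) - ?E j) + critical_growth (Suc j) * noise (Suc j) \<omega>"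
    unfolding expectation_S_Suc[OF step(1)] by (simp add: algebra_simps)
  also have "(1 + 1 / (2 * real j)) * (real_of_int (S j \<omega>) - ?E j) = critical_growth (Suc j) * block 0 j \<omega>"
    unfolding step.IH critical_growth_Suc[OF step(1)] by simp
  finally show ?case by (simp add: block_Suc distrib_left)
qed

section \<open>Convergence of the conditional variances\<close>

text \<open>The normalized mean solves a contracting linear recursion whose fixed point is twice the
  drift.\<close>

lemma mean_limit: "(\<lambda>n. expectation (\<lambda>\<omega>. real_of_int (S n \<omega>)) / real n) \<longlonglongrightarrow> 2 * limit_drift"
proof -
  let ?E = "\<lambda>j. expectation (\<lambda>\<omega>. real_of_int (S j \<omega>))"
  define z where "z n = \<bar>?E n / real n - 2 * limit_drift\<bar>" for n
  have "z \<longlonglongrightarrow> 0"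
  proof (rule perturbed_recursion_null[where \<delta> = "\<lambda>n. \<bar>drift n - limit_drift\<bar>"])
    fix n :: nat assume n: "1 \<le> n"
    then have n0: "real n > 0" by simp
    have "?E (Suc n) / real (Suc n) - 2 * limit_drift =
      (1 - 1 / (2 * (real n + 1))) * (?E n / real n - 2 * limit_drift) + (drift (Suc n) - limit_drift) / (real n + 1)"
      unfolding expectation_S_Suc[OF n] using n0
      by (simp add: divide_simps) (simp add: algebra_simps)
    then have "z (Suc n) \<le> \<bar>(1 - 1 / (2 * (real n + 1))) * (?E n / real n - 2 * limit_drift)\<bar> +
        \<bar>(drift (Suc n) - limit_drift) / (real n + 1)\<bar>"
      unfolding z_def by (simp only: abs_triangle_ineq)
    also have "\<dots> = (1 - 1 / (2 * (real n + 1))) * z n + \<bar>drift (Suc n) - limit_drift\<bar> / (real n + 1)"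
      unfolding z_def abs_mult abs_divide by simp
    finally show "z (Suc n) \<le> (1 - 1 / (2 * (real n + 1))) * z n + \<bar>drift (Suc n) - limit_drift\<bar> / (real n + 1)" .
  next
    show "(\<lambda>n. \<bar>drift n - limit_drift\<bar>) \<longlonglongrightarrow> 0"
      using drift_limit by (simp add: LIM_zero_iff tendsto_rabs_zero_iff)
  qed (simp add: z_def)
  then show ?thesis unfolding z_def[abs_def] tendsto_rabs_zero_iff LIM_zero_iff .
qed

lemma block_sq_expectation:
  assumes "N \<le> K"
  shows "expectation (\<lambda>\<omega>. block N K \<omega> ^ 2) \<le> 4 * (\<Sum>i\<in>{N<..K}. 1 / critical_growth i ^ 2)"
  using second_moment[OF assms] by (simp add: power_divide sum_distrib_left)

text \<open>The variance of the walk at time \<open>n\<close> is at most of order \<open>n ln n\<close>, which is negligible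
  compared with \<open>n\<^sup>2\<close>.\<close>

lemma mean_deviation_limit:
  "(\<lambda>n. expectation (\<lambda>\<omega>. \<bar>real_of_int (S n \<omega>) - expectation (\<lambda>\<omega>. real_of_int (S n \<omega>))\<bar>) / real n) \<longlonglongrightarrow> 0"
proof (rule Lim_null_comparison)
  let ?V = "\<lambda>n. \<Sum>j=1..n. 1 / critical_growth j ^ 2"
  have "(\<lambda>n. sqrt (4 * (critical_growth n ^ 2 / real n) * (?V n / ln (real n)) * (ln (real n) / real n)))
    \<longlonglongrightarrow> sqrt (4 * growth_constant * (1 / growth_constant) * 0)"
  proof (intro tendsto_real_sqrt tendsto_mult tendsto_const critical_growth_sq_limit)
    have "(\<lambda>j. 1 / (critical_growth j ^ 2 / real j)) \<longlonglongrightarrow> 1 / growth_constant"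
      using growth_constant_bounds by (intro tendsto_divide tendsto_const critical_growth_sq_limit) auto
    from logarithmic_average[OF this]
    have "(\<lambda>N. (\<Sum>j=1..N. 1 / (critical_growth j ^ 2 / real j) / real j) / ln (real N)) \<longlonglongrightarrow> 1 / growth_constant" .
    moreover have "(\<Sum>j=1..N. 1 / (critical_growth j ^ 2 / real j) / real j) = ?V N" for N
      by (intro sum.cong) auto
    ultimately show "(\<lambda>n. ?V n / ln (real n)) \<longlonglongrightarrow> 1 / growth_constant" by simp
    show "(\<lambda>n. ln (real n) / real n) \<longlonglongrightarrow> 0"
      by (rule lim_ln_over_n)
  qed
  then show "(\<lambda>n. sqrt (4 * (critical_growth n ^ 2 / real n) * (?V n / ln (real n)) * (ln (real n) / real n)))
    \<longlonglongrightarrow> 0" by simp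
  show "\<forall>\<^sub>F n in sequentially.
     norm (expectation (\<lambda>\<omega>. \<bar>real_of_int (S n \<omega>) - expectation (\<lambda>\<omega>. real_of_int (S n \<omega>))\<bar>) / real n)
     \<le> sqrt (4 * (critical_growth n ^ 2 / real n) * (?V n / ln (real n)) * (ln (real n) / real n))"
    using eventually_gt_at_top[of 1]
  proof eventually_elim
    case (elim n)
    let ?D = "\<lambda>\<omega>. \<bar>real_of_int (S n \<omega>) - expectation (\<lambda>\<omega>. real_of_int (S n \<omega>))\<bar>"
    let ?X = "\<lambda>\<omega>. \<bar>critical_growth n * block 0 n \<omega>\<bar>"
    have int: "integrable M (\<lambda>\<omega>. block 0 n \<omega>)" "integrable M (\<lambda>\<omega>. block 0 n \<omega> ^ 2)"
      by (rule integrable_adapted[of n], intro bounded_adapted_intros adapted_block)+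
    have D: "expectation ?D = expectation ?X"
      using centered_walk[of n] elim by (intro Bochner_Integration.integral_cong) auto
    have "0 \<le> variance ?X" by (rule variance_positive)
    also have "variance ?X = expectation (\<lambda>\<omega>. ?X \<omega> ^ 2) - (expectation ?X) ^ 2"
      using int by (intro variance_eq) (auto simp: power_mult_distrib)
    finally have "(expectation ?D) ^ 2 \<le> critical_growth n ^ 2 * expectation (\<lambda>\<omega>. block 0 n \<omega> ^ 2)"
      unfolding D using int by (simp add: power_mult_distrib)
    also have "\<dots> \<le> critical_growth n ^ 2 * (4 * ?V n)"
      using block_sq_expectation[of 0 n] by (intro mult_left_mono) (auto simp: atLeastSucAtMost_greaterThanAtMost)
    finally have "(expectation ?D) ^ 2 / real n ^ 2 \<le> critical_growth n ^ 2 * (4 * ?V n) / real n ^ 2"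
      by (intro divide_right_mono) auto
    moreover have "0 < ln (real n)" "0 < real n" using elim by auto
    then have "critical_growth n ^ 2 * (4 * ?V n) / real n ^ 2 =
        4 * (critical_growth n ^ 2 / real n) * (?V n / ln (real n)) * (ln (real n) / real n)"
      by (simp add: power2_eq_square)
    ultimately have "(expectation ?D / real n) ^ 2 \<le>
        4 * (critical_growth n ^ 2 / real n) * (?V n / ln (real n)) * (ln (real n) / real n)"
      by (simp add: power_divide)
    then have "\<bar>expectation ?D / real n\<bar> \<le>
        sqrt (4 * (critical_growth n ^ 2 / real n) * (?V n / ln (real n)) * (ln (real n) / real n))"
      by (metis real_sqrt_abs real_sqrt_le_iff)
    then show ?case by simp
  qed
qed

text \<open>The conditional mean of a step is half the empirical mean of the walk plus the drift, hence tends
  to twice the limit drift.\<close>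

lemma cond_var_limit:
  "(\<lambda>j. expectation (\<lambda>\<omega>. \<bar>(1 - cond_mean j \<omega> ^ 2) - limit_variance \<beta> p\<bar>)) \<longlonglongrightarrow> 0"
proof -
  let ?E = "\<lambda>n. expectation (\<lambda>\<omega>. real_of_int (S n \<omega>))"
  let ?D = "\<lambda>n. expectation (\<lambda>\<omega>. \<bar>real_of_int (S n \<omega>) - ?E n\<bar>)"
  let ?B = "\<lambda>n. ?D n / real n + \<bar>?E n / real n - 2 * limit_drift\<bar> + 2 * \<bar>drift (Suc n) - limit_drift\<bar>"
  have "(\<lambda>n. expectation (\<lambda>\<omega>. \<bar>(1 - cond_mean (Suc n) \<omega> ^ 2) - limit_variance \<beta> p\<bar>)) \<longlonglongrightarrow> 0"
  proof (rule Lim_null_comparison)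
    have "?B \<longlonglongrightarrow> 0 + 0 + 2 * 0"
      using mean_limit LIMSEQ_Suc[OF drift_limit]
      by (intro tendsto_intros mean_deviation_limit) (simp_all add: LIM_zero_iff tendsto_rabs_zero_iff)
    then show "?B \<longlonglongrightarrow> 0" by simp
    show "\<forall>\<^sub>F n in sequentially.
      norm (expectation (\<lambda>\<omega>. \<bar>(1 - cond_mean (Suc n) \<omega> ^ 2) - limit_variance \<beta> p\<bar>)) \<le> ?B n"
      using eventually_gt_at_top[of 0]
    proof eventually_elim
      case (elim n)
      have int: "integrable M (\<lambda>\<omega>. \<bar>real_of_int (S n \<omega>) - ?E n\<bar>)"
        using integrable_S[of n] by simp
      have cvar: "bounded_adapted (history M S n) (\<lambda>\<omega>. 1 + (- 1) * cond_mean (Suc n) \<omega> ^ 2 + (- limit_variance \<beta> p))"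
        by (intro bounded_adapted_intros cond_mean_adapted)
      have "expectation (\<lambda>\<omega>. \<bar>(1 - cond_mean (Suc n) \<omega> ^ 2) - limit_variance \<beta> p\<bar>) \<le>
        expectation (\<lambda>\<omega>. \<bar>real_of_int (S n \<omega>) - ?E n\<bar> / real n +
           (\<bar>?E n / real n - 2 * limit_drift\<bar> + 2 * \<bar>drift (Suc n) - limit_drift\<bar>))"
      proof (rule integral_mono)
        show "integrable M (\<lambda>\<omega>. \<bar>(1 - cond_mean (Suc n) \<omega> ^ 2) - limit_variance \<beta> p\<bar>)"
          using integrable_adapted[OF cvar] by simp
        fix \<omega> assume w: "\<omega> \<in> space M"
        let ?s = "real_of_int (S n \<omega>)"
        define c l where "c = cond_mean (Suc n) \<omega>" and "l = 2 * limit_drift"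
        have c1: "\<bar>c\<bar> \<le> 1" unfolding c_def by (rule cond_mean_bound[OF w])
        have l1: "\<bar>l\<bar> \<le> 1" unfolding l_def using limit_drift_bound by simp
        have "\<bar>(1 - c ^ 2) - limit_variance \<beta> p\<bar> = \<bar>(l + c) * (l - c)\<bar>"
          unfolding limit_variance_eq l_def[symmetric] by (simp add: power2_eq_square algebra_simps)
        also have "\<dots> \<le> 2 * \<bar>l - c\<bar>"
          unfolding abs_mult using c1 l1 by (intro mult_right_mono) auto
        also have "l - c = - ((?s - ?E n) / (2 * real n) + (?E n / real n - l) / 2 + (drift (Suc n) - limit_drift))"
          using elim by (simp add: c_def l_def cond_mean_def field_simps)
        also have "2 * \<bar>\<dots>\<bar> \<le> 2 * (\<bar>(?s - ?E n) / (2 * real n)\<bar> + \<bar>(?E n / real n - l) / 2\<bar> + \<bar>drift (Suc n) - limit_drift\<bar>)"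
        proof -
          have "2 * \<bar>- (x + y + z)\<bar> \<le> 2 * (\<bar>x\<bar> + \<bar>y\<bar> + \<bar>z\<bar>)" for x y z :: real
            using order_trans[OF abs_triangle_ineq add_right_mono[OF abs_triangle_ineq], of x y z]
            by (simp only: abs_minus_cancel mult_left_mono zero_le_numeral)
          then show ?thesis .
        qed
        also have "\<dots> = \<bar>?s - ?E n\<bar> / real n + (\<bar>?E n / real n - l\<bar> + 2 * \<bar>drift (Suc n) - limit_drift\<bar>)"
          by (simp add: abs_divide)
        finally show "\<bar>(1 - cond_mean (Suc n) \<omega> ^ 2) - limit_variance \<beta> p\<bar> \<le>
            \<bar>?s - ?E n\<bar> / real n + (\<bar>?E n / real n - 2 * limit_drift\<bar> + 2 * \<bar>drift (Suc n) - limit_drift\<bar>)"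
          by (simp add: c_def l_def)
      qed (use int in simp)
      also have "\<dots> = ?B n" using int by (simp add: prob_space)
      finally show ?case by (simp add: integral_nonneg_AE)
    qed
  qed
  then show ?thesis by (rule LIMSEQ_imp_Suc)
qed

end

context critical_elephant_random_walk
begin

section \<open>Limit laws of the blocks\<close>

text \<open>At frequencies of order \<open>(ln n)\<^bsup>-1/2\<^esup>\<close> all error terms in the characteristic function
  estimate of a block vanish in the limit: the conditional variances converge in mean, so the
  weighted sum of their errors is of smaller order than \<open>ln n\<close>, and the cubic and quartic terms
  carry at least an additional factor \<open>(ln n)\<^bsup>-1/2\<^esup>\<close>.\<close>

lemma block_char_limit:
  fixes c :: "nat \<Rightarrow> real" and Z :: "nat \<Rightarrow> 'a \<Rightarrow> real"
  assumes NK: "\<And>n. N n \<le> K n" and Kt: "\<And>n. K n \<le> power_time n t" and t: "0 \<le> t"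
    and l: "(\<lambda>n. (\<Sum>j\<in>{N n<..K n}. 1 / critical_growth j ^ 2) / ln (real n)) \<longlonglongrightarrow> l"
    and c: "c \<longlonglongrightarrow> c'"
    and Z: "\<And>n. bounded_adapted (history M S (N n)) (Z n)" "\<And>n \<omega>. \<omega> \<in> space M \<Longrightarrow> \<bar>Z n \<omega>\<bar> \<le> 1"
  shows "(\<lambda>n. expectation (\<lambda>\<omega>. of_real (Z n \<omega>) * iexp (u * (c n / sqrt (ln (real n)) * block (N n) (K n) \<omega>)))
            - of_real (expectation (Z n)) * of_real (exp (- (u\<^sup>2 * (c'\<^sup>2 * limit_variance \<beta> p * l)) / 2))) \<longlonglongrightarrow> 0"
proof -
  let ?lv = "limit_variance \<beta> p" and ?a = critical_growth
  define \<theta> where "\<theta> n = u * c n / sqrt (ln (real n))" for n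
  define s where "s n = (\<Sum>j\<in>{N n<..K n}. 1 / ?a j ^ 2)" for n
  define err where "err j = expectation (\<lambda>\<omega>. \<bar>(1 - cond_mean j \<omega> ^ 2) - ?lv\<bar>)" for j
  define Err where "Err n = (\<Sum>j=1..power_time n t. err j / ?a j ^ 2) / ln (real n)" for n
  define V where "V n = (\<Sum>j=1..power_time n t. 1 / ?a j ^ 2) / ln (real n)" for n
  let ?E = "\<lambda>n. expectation (\<lambda>\<omega>. of_real (Z n \<omega>) * iexp (\<theta> n * block (N n) (K n) \<omega>))"
  let ?G = "\<lambda>n. exp (- (\<theta> n)\<^sup>2 * (?lv * s n) / 2)"
  let ?bound = "\<lambda>n. (u * c n)\<^sup>2 / 2 * Err n + (4 / 3 * \<bar>u * c n\<bar> ^ 3 / sqrt (ln (real n)) +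
      (u * c n) ^ 4 / 8 / ln (real n)) * V n"
  have err0: "0 \<le> err j" for j unfolding err_def by (intro integral_nonneg_AE) auto
  have a1: "1 \<le> ?a j" for j by (rule critical_growth_ge_1)
  have est: "cmod (?E n - of_real (?G n * expectation (Z n))) \<le> ?bound n" if n: "1 < n" for n
  proof -
    have ln0: "0 < ln (real n)" using n by simp
    have cv: "expectation (\<lambda>\<omega>. \<bar>cond_var j \<omega> - ?lv / ?a j ^ 2\<bar>) = err j / ?a j ^ 2" for j
    proof -
      have "\<bar>cond_var j \<omega> - ?lv / ?a j ^ 2\<bar> = \<bar>(1 - cond_mean j \<omega> ^ 2) - ?lv\<bar> / ?a j ^ 2" for \<omega>
        unfolding cond_var_def diff_divide_distrib[symmetric] abs_divide by simp
      then show ?thesis by (simp add: err_def)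
    qed
    have "cmod (?E n - of_real (exp (- (\<theta> n)\<^sup>2 * (\<Sum>j\<in>{N n<..K n}. ?lv / ?a j ^ 2) / 2) * expectation (Z n)))
      \<le> (\<Sum>j\<in>{N n<..K n}. (\<theta> n)\<^sup>2 * expectation (\<lambda>\<omega>. \<bar>cond_var j \<omega> - ?lv / ?a j ^ 2\<bar>) / 2
            + \<bar>\<theta> n\<bar> ^ 3 * (2 / ?a j) ^ 3 / 6 + \<theta> n ^ 4 * (?lv / ?a j ^ 2)\<^sup>2 / 8)"
      by (rule block_char_estimate[OF NK Z cond_var_adapted expectation_noise_sq])
         (use limit_variance_pos in auto)
    also have "(\<Sum>j\<in>{N n<..K n}. ?lv / ?a j ^ 2) = ?lv * s n"
      by (simp add: s_def sum_distrib_left)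
    also have "(\<Sum>j\<in>{N n<..K n}. (\<theta> n)\<^sup>2 * expectation (\<lambda>\<omega>. \<bar>cond_var j \<omega> - ?lv / ?a j ^ 2\<bar>) / 2
            + \<bar>\<theta> n\<bar> ^ 3 * (2 / ?a j) ^ 3 / 6 + \<theta> n ^ 4 * (?lv / ?a j ^ 2)\<^sup>2 / 8)
       \<le> (\<Sum>j\<in>{N n<..K n}. (\<theta> n)\<^sup>2 / 2 * (err j / ?a j ^ 2) +
            (4 / 3 * \<bar>\<theta> n\<bar> ^ 3 + \<theta> n ^ 4 / 8) * (1 / ?a j ^ 2))"
    proof (rule sum_mono)
      fix j
      have 1: "(2 / ?a j) ^ 3 / 6 \<le> 4 / 3 * (1 / ?a j ^ 2)"
      proof -
        have "1 / ?a j ^ 3 \<le> 1 / ?a j ^ 2"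
          using a1[of j] by (intro divide_left_mono power_increasing) auto
        then show ?thesis by (simp add: power_divide)
      qed
      have 2: "(?lv / ?a j ^ 2)\<^sup>2 \<le> 1 / ?a j ^ 2"
      proof -
        have "?lv / ?a j ^ 2 \<le> 1 / ?a j ^ 2" using limit_variance_le_1 by (intro divide_right_mono) auto
        moreover have "1 / ?a j ^ 2 \<le> 1" using a1[of j] by (simp add: one_le_power)
        moreover have "0 \<le> ?lv / ?a j ^ 2" using limit_variance_pos by simp
        ultimately show ?thesis
          unfolding power2_eq_square by (metis mult_left_le order_trans mult.commute)
      qed
      have "\<bar>\<theta> n\<bar> ^ 3 * ((2 / ?a j) ^ 3 / 6) \<le> \<bar>\<theta> n\<bar> ^ 3 * (4 / 3 * (1 / ?a j ^ 2))"
        using 1 by (intro mult_left_mono) auto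
      moreover have "\<theta> n ^ 4 * (?lv / ?a j ^ 2)\<^sup>2 \<le> \<theta> n ^ 4 * (1 / ?a j ^ 2)"
        using 2 by (intro mult_left_mono) auto
      ultimately show "(\<theta> n)\<^sup>2 * expectation (\<lambda>\<omega>. \<bar>cond_var j \<omega> - ?lv / ?a j ^ 2\<bar>) / 2
            + \<bar>\<theta> n\<bar> ^ 3 * (2 / ?a j) ^ 3 / 6 + \<theta> n ^ 4 * (?lv / ?a j ^ 2)\<^sup>2 / 8
        \<le> (\<theta> n)\<^sup>2 / 2 * (err j / ?a j ^ 2) + (4 / 3 * \<bar>\<theta> n\<bar> ^ 3 + \<theta> n ^ 4 / 8) * (1 / ?a j ^ 2)"
        unfolding cv by (simp add: algebra_simps)
    qed
    also have "\<dots> \<le> (\<Sum>j\<in>{1..power_time n t}. (\<theta> n)\<^sup>2 / 2 * (err j / ?a j ^ 2) +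
            (4 / 3 * \<bar>\<theta> n\<bar> ^ 3 + \<theta> n ^ 4 / 8) * (1 / ?a j ^ 2))"
      using Kt[of n] err0 by (intro sum_mono2) auto
    also have "\<dots> = (\<theta> n)\<^sup>2 / 2 * (Err n * ln (real n)) + (4 / 3 * \<bar>\<theta> n\<bar> ^ 3 + \<theta> n ^ 4 / 8) * (V n * ln (real n))"
      unfolding sum.distrib sum_distrib_left[symmetric] Err_def V_def using ln0 by simp
    also have "\<dots> = ?bound n"
    proof -
      define L where "L = sqrt (ln (real n))"
      have L: "L > 0" and L2: "ln (real n) = L ^ 2" using ln0 by (auto simp: L_def)
      have "(\<theta> n)\<^sup>2 * ln (real n) = (u * c n)\<^sup>2"
        unfolding \<theta>_def L2 using L by (simp add: power_divide)
      moreover have "\<bar>\<theta> n\<bar> ^ 3 * ln (real n) = \<bar>u * c n\<bar> ^ 3 / sqrt (ln (real n))"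
        unfolding \<theta>_def L2 using L by (simp add: abs_divide power_divide power2_eq_square power3_eq_cube)
      moreover have "\<theta> n ^ 4 * ln (real n) = (u * c n) ^ 4 / ln (real n)"
        unfolding \<theta>_def L2 using L by (simp add: power_divide power2_eq_square power4_eq_xxxx)
      moreover have "(\<theta> n)\<^sup>2 / 2 * (Err n * ln (real n)) + (4 / 3 * \<bar>\<theta> n\<bar> ^ 3 + \<theta> n ^ 4 / 8) * (V n * ln (real n)) =
        ((\<theta> n)\<^sup>2 * ln (real n)) / 2 * Err n + (4 / 3 * (\<bar>\<theta> n\<bar> ^ 3 * ln (real n)) + (\<theta> n ^ 4 * ln (real n)) / 8) * V n"
        by (simp add: algebra_simps)
      ultimately show ?thesis by (simp only: times_divide_eq_right divide_divide_eq_left mult.commute)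
    qed
    finally show ?thesis .
  qed
  have lnT: "filterlim (\<lambda>n. sqrt (ln (real n))) at_top sequentially"
    by (rule filterlim_compose[OF sqrt_at_top ln_at_top_seq])
  have "err \<longlonglongrightarrow> 0" unfolding err_def[abs_def] by (rule cond_var_limit)
  from sum_inverse_growth_sq[OF this t] have Err: "Err \<longlonglongrightarrow> 0" unfolding Err_def[abs_def] by simp
  have V: "V \<longlonglongrightarrow> 1 * t / growth_constant"
    unfolding V_def[abs_def] by (rule sum_inverse_growth_sq[OF tendsto_const t])
  have "?bound \<longlonglongrightarrow> (u * c')\<^sup>2 / 2 * 0 + (0 + 0) * (1 * t / growth_constant)"
  proof (intro tendsto_add tendsto_mult[OF _ Err] tendsto_mult[OF _ V])
    show "(\<lambda>n. (u * c n)\<^sup>2 / 2) \<longlonglongrightarrow> (u * c')\<^sup>2 / 2" by (intro tendsto_intros c) simp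
    have "(\<lambda>n. 4 / 3 * \<bar>u * c n\<bar> ^ 3) \<longlonglongrightarrow> 4 / 3 * \<bar>u * c'\<bar> ^ 3" by (intro tendsto_intros c)
    then show "(\<lambda>n. 4 / 3 * \<bar>u * c n\<bar> ^ 3 / sqrt (ln (real n))) \<longlonglongrightarrow> 0"
      by (rule real_tendsto_divide_at_top[OF _ lnT])
    have "(\<lambda>n. (u * c n) ^ 4 / 8) \<longlonglongrightarrow> (u * c') ^ 4 / 8" by (intro tendsto_intros c) simp
    then show "(\<lambda>n. (u * c n) ^ 4 / 8 / ln (real n)) \<longlonglongrightarrow> 0"
      by (rule real_tendsto_divide_at_top[OF _ ln_at_top_seq])
  qed
  then have b0: "?bound \<longlonglongrightarrow> 0" by simp
  have e0: "(\<lambda>n. ?E n - of_real (?G n * expectation (Z n))) \<longlonglongrightarrow> 0"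
    by (rule Lim_null_comparison[OF eventually_mono[OF eventually_gt_at_top[of 1] est] b0])
  let ?g = "exp (- (u\<^sup>2 * (c'\<^sup>2 * ?lv * l)) / 2)"
  have "(\<lambda>n. exp (- ((u * c n)\<^sup>2 * (?lv * (s n / ln (real n)))) / 2)) \<longlonglongrightarrow> exp (- ((u * c')\<^sup>2 * (?lv * l)) / 2)"
    using l unfolding s_def[symmetric] by (intro tendsto_intros c) auto
  moreover have "\<forall>\<^sub>F n in sequentially. exp (- ((u * c n)\<^sup>2 * (?lv * (s n / ln (real n)))) / 2) = ?G n"
    using eventually_gt_at_top[of 1]
    by eventually_elim (simp add: \<theta>_def power_divide power_mult_distrib)
  ultimately have "?G \<longlonglongrightarrow> exp (- ((u * c')\<^sup>2 * (?lv * l)) / 2)"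
    by (rule Lim_transform_eventually)
  then have G: "(\<lambda>n. ?G n - ?g) \<longlonglongrightarrow> 0"
    by (simp add: LIM_zero_iff power_mult_distrib mult_ac)
  have "(\<lambda>n. (?G n - ?g) * expectation (Z n)) \<longlonglongrightarrow> 0"
  proof (rule Lim_null_comparison[OF _ tendsto_rabs_zero[OF G]], intro always_eventually allI)
    fix n
    have "\<bar>expectation (Z n)\<bar> \<le> expectation (\<lambda>\<omega>. \<bar>Z n \<omega>\<bar>)" by (rule integral_abs_bound)
    also have "\<dots> \<le> expectation (\<lambda>_. 1)"
      using integrable_adapted[OF Z(1)] Z(2) by (intro integral_mono) auto
    finally have "\<bar>expectation (Z n)\<bar> \<le> 1" by (simp add: prob_space)
    then show "norm ((?G n - ?g) * expectation (Z n)) \<le> \<bar>?G n - ?g\<bar>"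
      unfolding real_norm_def abs_mult by (rule mult_left_le) simp
  qed
  then have "(\<lambda>n. complex_of_real ((?G n - ?g) * expectation (Z n))) \<longlonglongrightarrow> of_real 0"
    by (rule tendsto_of_real)
  from tendsto_add[OF e0 this]
  moreover have "w - complex_of_real (a * z) + complex_of_real ((a - b) * z) = w - of_real z * of_real b" for w a b z
    by (simp add: algebra_simps)
  ultimately have "(\<lambda>n. ?E n - of_real (expectation (Z n)) * of_real ?g) \<longlonglongrightarrow> 0"
    by (simp only: of_real_0 add_0)
  moreover have "\<theta> n * x = u * (c n / sqrt (ln (real n)) * x)" for n x
    by (simp add: \<theta>_def)
  ultimately show ?thesis by simp
qed

lemma block_sum_limit:
  assumes "0 \<le> s" "s \<le> t"
  shows "(\<lambda>n. (\<Sum>j\<in>{power_time n s<..power_time n t}. 1 / critical_growth j ^ 2) / ln (real n))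
     \<longlonglongrightarrow> (t - s) / growth_constant"
proof -
  let ?f = "\<lambda>j. 1 / critical_growth j ^ 2"
  have eq: "(\<Sum>j\<in>{power_time n s<..power_time n t}. ?f j) =
     (\<Sum>j=1..power_time n t. ?f j) - (\<Sum>j=1..power_time n s. ?f j)" for n
  proof -
    have le: "power_time n s \<le> power_time n t" using assms by (intro power_time_mono)
    have "{1..power_time n t} = {1..power_time n s} \<union> {power_time n s<..power_time n t}"
      using le by auto
    then have "(\<Sum>j=1..power_time n t. ?f j) = (\<Sum>j\<in>{1..power_time n s} \<union> {power_time n s<..power_time n t}. ?f j)"
      by (simp only:)
    also have "\<dots> = (\<Sum>j=1..power_time n s. ?f j) + (\<Sum>j\<in>{power_time n s<..power_time n t}. ?f j)"
      by (rule sum.union_disjoint) auto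
    finally show ?thesis by (simp only: add_diff_cancel_left')
  qed
  have "(\<lambda>n. (\<Sum>j=1..power_time n t. ?f j) / ln (real n) - (\<Sum>j=1..power_time n s. ?f j) / ln (real n))
     \<longlonglongrightarrow> 1 * t / growth_constant - 1 * s / growth_constant"
    using assms by (intro tendsto_diff sum_inverse_growth_sq tendsto_const) auto
  then show ?thesis unfolding eq by (simp add: diff_divide_distrib)
qed

text \<open>The asymptotic increment of the normalized path over the \<open>i\<close>th interval of mesh \<open>1 / m\<close>. The
  ratio of the growth to the square root is already replaced by its limit.\<close>

definition scaled_block :: "nat \<Rightarrow> nat \<Rightarrow> nat \<Rightarrow> 'a \<Rightarrow> real" where
  "scaled_block m n i \<omega> = sqrt growth_constant / sqrt (ln (real n)) *
     block (power_time n (real i / real m)) (power_time n (real (Suc i) / real m)) \<omega>"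

lemma grid_time_mono: "i \<le> j \<Longrightarrow> power_time n (real i / real m) \<le> power_time n (real j / real m)"
  by (intro power_time_mono divide_right_mono) auto

lemma scaled_block_adapted:
  assumes "i < j"
  shows "bounded_adapted (history M S (power_time n (real j / real m))) (scaled_block m n i)"
proof -
  have "bounded_adapted (history M S (power_time n (real (Suc i) / real m))) (scaled_block m n i)"
    unfolding scaled_block_def[abs_def] by (intro bounded_adapted_intros adapted_block)
  then show ?thesis by (rule adapted_mono) (use assms in \<open>intro grid_time_mono, simp\<close>)
qed

lemma scaled_block_measurable [measurable]: "scaled_block m n i \<in> borel_measurable M"
  using adapted_M[OF scaled_block_adapted[of i "Suc i" n m]] by (simp add: bounded_adapted_def)

lemma scaled_block_sq_integrable: "integrable M (\<lambda>\<omega>. scaled_block m n i \<omega> ^ 2)"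
  by (rule integrable_adapted[OF bounded_adapted_power[OF scaled_block_adapted[of i "Suc i" n m]]]) simp

lemma scaled_block_second_moment:
  assumes m: "m > 0"
  shows "\<exists>c. \<forall>\<^sub>F n in sequentially. expectation (\<lambda>\<omega>. scaled_block m n i \<omega> ^ 2) \<le> c"
proof -
  let ?V = "\<lambda>n. (\<Sum>j\<in>{power_time n (real i / real m)<..power_time n (real (Suc i) / real m)}. 1 / critical_growth j ^ 2) / ln (real n)"
  have "?V \<longlonglongrightarrow> (real (Suc i) / real m - real i / real m) / growth_constant"
    by (rule block_sum_limit) (auto intro: divide_right_mono)
  then have "Bseq ?V" by (intro convergent_imp_Bseq convergentI)
  then obtain b where b: "\<And>n. \<bar>?V n\<bar> \<le> b" unfolding Bseq_def real_norm_def by blast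
  have "\<forall>\<^sub>F n in sequentially. expectation (\<lambda>\<omega>. scaled_block m n i \<omega> ^ 2) \<le> growth_constant * (4 * b)"
    using eventually_gt_at_top[of 1]
  proof eventually_elim
    case (elim n)
    let ?N = "power_time n (real i / real m)" and ?K = "power_time n (real (Suc i) / real m)"
    have ln0: "0 < ln (real n)" using elim by simp
    have "expectation (\<lambda>\<omega>. scaled_block m n i \<omega> ^ 2) =
        growth_constant / ln (real n) * expectation (\<lambda>\<omega>. block ?N ?K \<omega> ^ 2)"
      unfolding scaled_block_def using ln0 growth_constant_bounds
      by (simp add: power_mult_distrib power_divide)
    also have "\<dots> \<le> growth_constant / ln (real n) * (4 * (\<Sum>j\<in>{?N<..?K}. 1 / critical_growth j ^ 2))"
      using ln0 growth_constant_bounds by (intro mult_left_mono block_sq_expectation grid_time_mono) auto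
    also have "\<dots> = growth_constant * (4 * ?V n)" by simp
    also have "\<dots> \<le> growth_constant * (4 * b)"
      by (intro mult_left_mono abs_le_D1[OF b]) (use growth_constant_bounds in auto)
    finally show ?case .
  qed
  then show ?thesis by blast
qed

lemma scaled_block_products:
  assumes m: "m > 0"
    and h: "\<And>j. continuous_on UNIV (h j)" "\<And>j x. 0 \<le> h j x \<and> h j x \<le> (1 :: real)"
  shows "(\<lambda>n. expectation (\<lambda>\<omega>. \<Prod>i<K. h i (scaled_block m n i \<omega>)))
     \<longlonglongrightarrow> (\<Prod>i<K. \<integral>x. h i x \<partial>normal_law (sqrt (limit_variance \<beta> p) / sqrt (real m)))"
proof (rule product_convergence[OF scaled_block_measurable _ _ h])
  have \<sigma>: "0 < sqrt (limit_variance \<beta> p) / sqrt (real m)" using limit_variance_pos m by simp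
  show "real_distribution (normal_law (sqrt (limit_variance \<beta> p) / sqrt (real m)))"
    by (rule real_distribution_normal_law[OF \<sigma>])
  fix h :: "nat \<Rightarrow> real \<Rightarrow> real" and i :: nat and u :: real
  assume h: "\<And>j. continuous_on UNIV (h j)" "\<And>j x. 0 \<le> h j x \<and> h j x \<le> 1"
  define Z where "Z n \<omega> = (\<Prod>j<i. h j (scaled_block m n j \<omega>))" for n \<omega>
  have Z: "bounded_adapted (history M S (power_time n (real i / real m))) (Z n)" for n
    unfolding Z_def[abs_def]
  proof (intro bounded_adapted_prod bounded_adaptedI[where C = 1])
    fix j assume "j \<in> {..<i}"
    then have [measurable]: "scaled_block m n j \<in> borel_measurable (history M S (power_time n (real i / real m)))"
      using scaled_block_adapted[of j i n m] by (simp add: bounded_adapted_def)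
    have [measurable]: "h j \<in> borel_measurable borel"
      by (rule borel_measurable_continuous_onI[OF h(1)])
    show "(\<lambda>\<omega>. h j (scaled_block m n j \<omega>)) \<in> borel_measurable (history M S (power_time n (real i / real m)))"
      by measurable
  qed (use h(2) in auto)
  have Z1: "\<bar>Z n \<omega>\<bar> \<le> 1" for n \<omega>
    unfolding Z_def using h(2) by (auto simp: abs_prod intro!: prod_le_1)
  have diff: "real (Suc i) / real m - real i / real m = 1 / real m"
    by (simp add: add_divide_distrib)
  have "(\<lambda>n. expectation (\<lambda>\<omega>. of_real (Z n \<omega>) * iexp (u * (sqrt growth_constant / sqrt (ln (real n)) *
        block (power_time n (real i / real m)) (power_time n (real (Suc i) / real m)) \<omega>)))
     - of_real (expectation (Z n)) * of_real (exp (- (u\<^sup>2 * ((sqrt growth_constant)\<^sup>2 * limit_variance \<beta> p *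
        ((real (Suc i) / real m - real i / real m) / growth_constant))) / 2))) \<longlonglongrightarrow> 0"
    by (rule block_char_limit[OF grid_time_mono order_refl _ block_sum_limit tendsto_const Z Z1])
       (auto intro: divide_right_mono)
  also have "(sqrt growth_constant)\<^sup>2 * limit_variance \<beta> p *
        ((real (Suc i) / real m - real i / real m) / growth_constant) = (sqrt (limit_variance \<beta> p) / sqrt (real m))\<^sup>2"
    unfolding diff using growth_constant_bounds limit_variance_pos by (simp add: power_divide)
  finally show "(\<lambda>n. expectation (\<lambda>\<omega>. of_real (\<Prod>j<i. h j (scaled_block m n j \<omega>)) * iexp (u * scaled_block m n i \<omega>))
      - of_real (expectation (\<lambda>\<omega>. \<Prod>j<i. h j (scaled_block m n j \<omega>))) *
        char (normal_law (sqrt (limit_variance \<beta> p) / sqrt (real m))) u) \<longlonglongrightarrow> 0"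
    unfolding char_normal_law[OF \<sigma>] Z_def scaled_block_def .
qed

section \<open>The normalized path\<close>

lemma normalized_path_eq:
  assumes "1 \<le> n" "0 \<le> t" "\<omega> \<in> space M"
  shows "normalized_path M S n \<omega> t =
    critical_growth (power_time n t) / sqrt (real n powr t) * (block 0 (power_time n t) \<omega> / sqrt (ln (real n)))"
  using centered_walk[OF power_time_ge_1[OF assms(1,2)] assms(3)] assms
  by (simp add: normalized_path_def real_sqrt_mult)

lemma normalized_path_in_skorokhod_space: "normalized_path M S n \<omega> \<in> skorokhod_space"
proof (cases "1 < n")
  case True
  then have n: "1 < real n" by simp
  have "(\<lambda>t\<in>{0..}. (\<lambda>z. real_of_int (S (nat z) \<omega>) - (\<integral>\<omega>'. real_of_int (S (nat z) \<omega>') \<partial>M)) \<lfloor>real n powr t\<rfloor>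
      / sqrt (real n powr t * ln (real n))) \<in> skorokhod_space"
  proof (rule floor_path_in_skorokhod_space)
    show "isCont (\<lambda>t. real n powr t) t" for t using n by (intro continuous_intros) auto
    show "strict_mono (\<lambda>t. real n powr t)" using n by (intro strict_monoI powr_less_mono) auto
    show "isCont (\<lambda>t. sqrt (real n powr t * ln (real n))) t" for t using n by (intro continuous_intros) auto
    show "sqrt (real n powr t * ln (real n)) \<noteq> 0" for t using n by simp
  qed
  then show ?thesis by (simp add: normalized_path_def)
next
  case False
  then have "n = 0 \<or> n = 1" by auto
  then have "normalized_path M S n \<omega> = (\<lambda>t\<in>{0..}. 0)"
    by (auto simp: normalized_path_def fun_eq_iff restrict_def)
  then show ?thesis using continuous_path_in_skorokhod_space[of "\<lambda>_. 0"] by simp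
qed

lemma normalized_path_measurable:
  "normalized_path M S n \<in> M \<rightarrow>\<^sub>M borel_of skorokhod_topology"
proof (rule discrete_path_measurable[OF S_measurable normalized_path_in_skorokhod_space])
  fix T :: real
  show "\<exists>J. \<forall>\<omega>\<in>space M. \<forall>\<omega>'\<in>space M. (\<forall>j\<le>J. S j \<omega> = S j \<omega>') \<longrightarrow>
      (\<forall>t\<in>{0..T}. normalized_path M S n \<omega> t = normalized_path M S n \<omega>' t)"
    by (rule exI[of _ "power_time n T"]) (auto simp: normalized_path_def power_time_mono)
qed

lemma growth_ratio_limit:
  "((\<lambda>y. critical_growth (nat \<lfloor>y\<rfloor>) / sqrt y) \<longlongrightarrow> sqrt growth_constant) at_top"
proof -
  have floor: "filterlim (\<lambda>y::real. nat \<lfloor>y\<rfloor>) at_top at_top"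
    by (intro filterlim_compose[OF filterlim_nat_sequentially] filterlim_floor_sequentially)
  have "((\<lambda>y::real. real (nat \<lfloor>y\<rfloor>) / y) \<longlongrightarrow> 1) at_top"
  proof (rule tendsto_sandwich[where f = "\<lambda>y. 1 - 1 / y" and h = "\<lambda>_. 1"])
    have "((\<lambda>y::real. 1 - 1 / y) \<longlongrightarrow> 1 - 0) at_top"
      by (intro tendsto_diff tendsto_const real_tendsto_divide_at_top[OF tendsto_const] filterlim_ident)
    then show "((\<lambda>y::real. 1 - 1 / y) \<longlongrightarrow> 1) at_top" by simp
    show "\<forall>\<^sub>F y in at_top. 1 - 1 / y \<le> real (nat \<lfloor>y\<rfloor>) / y"
      using eventually_gt_at_top[of "0::real"]
    proof eventually_elim
      case (elim y)
      have "y - 1 \<le> real (nat \<lfloor>y\<rfloor>)" by linarith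
      then have "(y - 1) / y \<le> real (nat \<lfloor>y\<rfloor>) / y" using elim by (intro divide_right_mono) auto
      then show ?case using elim by (simp add: diff_divide_distrib)
    qed
    show "\<forall>\<^sub>F y in at_top. real (nat \<lfloor>y\<rfloor>) / y \<le> 1"
      using eventually_gt_at_top[of "0::real"]
      by eventually_elim (simp add: pos_divide_le_eq)
  qed simp
  from tendsto_mult[OF filterlim_compose[OF critical_growth_limit floor] tendsto_real_sqrt[OF this]]
  have "((\<lambda>y. critical_growth (nat \<lfloor>y\<rfloor>) / sqrt (real (nat \<lfloor>y\<rfloor>)) * sqrt (real (nat \<lfloor>y\<rfloor>) / y))
     \<longlongrightarrow> sqrt growth_constant) at_top" by simp
  moreover have "\<forall>\<^sub>F y in at_top. critical_growth (nat \<lfloor>y\<rfloor>) / sqrt (real (nat \<lfloor>y\<rfloor>)) * sqrt (real (nat \<lfloor>y\<rfloor>) / y) =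
      critical_growth (nat \<lfloor>y\<rfloor>) / sqrt y"
    using eventually_ge_at_top[of "1::real"]
  proof eventually_elim
    case (elim y)
    have "1 \<le> nat \<lfloor>y\<rfloor>" using elim by (simp add: le_nat_iff le_floor_iff)
    then have "0 < sqrt (real (nat \<lfloor>y\<rfloor>))" by (intro real_sqrt_gt_zero) linarith
    moreover have "a / s * (s / b) = a / b" if "0 < s" for a s b :: real using that by simp
    ultimately show ?case unfolding real_sqrt_divide by blast
  qed
  ultimately show ?thesis by (rule Lim_transform_eventually)
qed

lemma growth_ratio_difference_bound:
  assumes "1 \<le> y"
  shows "\<bar>critical_growth (nat \<lfloor>y\<rfloor>) / sqrt y - sqrt growth_constant\<bar> \<le> 2"
proof -
  let ?k = "nat \<lfloor>y\<rfloor>"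
  have k: "1 \<le> ?k" "real ?k \<le> y" using assms by (simp_all add: le_nat_iff le_floor_iff)
  have "critical_growth ?k ^ 2 / real ?k \<le> 2"
    by (rule order_trans[OF critical_growth_sq_bounds(2)[OF k(1)]]) simp
  moreover have "0 < real ?k" using k(1) by linarith
  ultimately have "critical_growth ?k ^ 2 \<le> 2 * real ?k" by (simp only: pos_divide_le_eq)
  also have "\<dots> \<le> 2 * y" using k(2) by simp
  finally have "(critical_growth ?k / sqrt y) ^ 2 \<le> 2 ^ 2"
    using assms by (simp add: power_divide pos_divide_le_eq)
  then have "critical_growth ?k / sqrt y \<le> 2" by (rule power2_le_imp_le) simp
  moreover have "0 \<le> critical_growth ?k / sqrt y" using critical_growth_pos[of ?k] assms by simp
  moreover have "sqrt growth_constant \<le> 2"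
    using growth_constant_bounds by (intro real_le_lsqrt) auto
  moreover have "0 \<le> sqrt growth_constant" using growth_constant_bounds by simp
  moreover have "\<bar>a - b\<bar> \<le> 2" if "a \<le> 2" "0 \<le> a" "b \<le> 2" "0 \<le> b" for a b :: real using that by linarith
  ultimately show ?thesis by blast
qed

text \<open>A block carries a fraction of about \<open>1 / m\<close> of the total variance, so by the fourth moment its
  maximum exceeds \<open>\<eta>\<close> with a probability of order \<open>1 / m\<^sup>2\<close>. A union bound over the order of \<open>m\<close>
  blocks is therefore still small. The constant is \<open>704 = 11 \<cdot> (4 \<cdot> 2)\<^sup>2\<close>: the factor \<open>4\<close> is
  the square of the bound 2 on the innovations and the factor \<open>2\<close> leaves room below the limit.\<close>

lemma block_oscillation_probability:
  assumes m: "m > 0" and \<eta>: "\<eta> > 0"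
  shows "\<forall>\<^sub>F n in sequentially.
    prob {\<omega>\<in>space M. \<exists>j\<in>{power_time n (real i / real m)..power_time n (real (Suc i) / real m)}.
      \<bar>block (power_time n (real i / real m)) j \<omega>\<bar> \<ge> \<eta> * sqrt (ln (real n))} \<le> 704 / (real m ^ 2 * \<eta> ^ 4)"
proof -
  let ?N = "\<lambda>n. power_time n (real i / real m)" and ?K = "\<lambda>n. power_time n (real (Suc i) / real m)"
  let ?V = "\<lambda>n. (\<Sum>j\<in>{?N n<..?K n}. 1 / critical_growth j ^ 2) / ln (real n)"
  have "?V \<longlonglongrightarrow> (real (Suc i) / real m - real i / real m) / growth_constant"
    by (rule block_sum_limit) (auto intro: divide_right_mono)
  moreover have "(real (Suc i) / real m - real i / real m) / growth_constant < 2 / real m"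
  proof -
    have "real (Suc i) / real m - real i / real m = 1 / real m" by (simp add: add_divide_distrib)
    moreover have "1 / real m / growth_constant \<le> 1 / real m / 1"
      using growth_constant_bounds by (intro divide_left_mono) auto
    moreover have "1 / real m < 2 / real m" using m by (simp add: divide_strict_right_mono)
    ultimately show ?thesis by simp
  qed
  ultimately have "\<forall>\<^sub>F n in sequentially. ?V n < 2 / real m" by (rule order_tendstoD(2))
  then show ?thesis
    using eventually_gt_at_top[of 1]
  proof eventually_elim
    case (elim n)
    define L where "L = ln (real n)"
    have L: "0 < L" using elim(2) by (simp add: L_def)
    let ?s = "\<Sum>j\<in>{?N n<..?K n}. 1 / critical_growth j ^ 2"
    let ?P = "prob {\<omega>\<in>space M. \<exists>j\<in>{?N n..?K n}. \<bar>block (?N n) j \<omega>\<bar> \<ge> \<eta> * sqrt L}"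
    have NK: "?N n \<le> ?K n" by (rule grid_time_mono) simp
    have s0: "0 \<le> ?s" by (intro sum_nonneg) auto
    have "?P * (\<eta> * sqrt L) ^ 4 \<le> expectation (\<lambda>\<omega>. block (?N n) (?K n) \<omega> ^ 4)"
      using \<eta> L by (intro maximal_inequality NK) simp
    also have "\<dots> \<le> 11 * (\<Sum>j\<in>{?N n<..?K n}. (2 / critical_growth j) ^ 2) ^ 2"
      by (rule fourth_moment[OF NK])
    also have "(\<Sum>j\<in>{?N n<..?K n}. (2 / critical_growth j) ^ 2) = 4 * ?s"
      by (simp add: power_divide sum_distrib_left)
    also have "11 * (4 * ?s) ^ 2 = 176 * ?s ^ 2" by (simp add: power_mult_distrib)
    also have "\<dots> \<le> 176 * (2 / real m * L) ^ 2"
      using elim(1) L s0 unfolding L_def[symmetric] by (intro mult_left_mono power_mono) (auto simp: pos_divide_less_eq)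
    also have "\<dots> = 704 / (real m ^ 2 * \<eta> ^ 4) * (\<eta> * sqrt L) ^ 4"
    proof -
      have "sqrt L ^ 4 = L ^ 2" using L by (simp add: power4_eq_xxxx power2_eq_square)
      then show ?thesis using \<eta> by (simp add: power_mult_distrib power_divide)
    qed
    finally show ?case
      unfolding L_def[symmetric] by (rule mult_right_le_imp_le) (use \<eta> L in simp)
  qed
qed

text \<open>On the event that no block moves by more than \<open>\<eta>\<close>, the path stays close to its grid
  approximation. For times in the first block the path itself is small, which makes up for the fact
  that the normalization has not yet reached its limit there.\<close>

lemma path_oscillation:
  assumes \<epsilon>: "0 < \<epsilon>"
  shows "\<forall>\<^sub>F m in sequentially. \<forall>\<^sub>F n in sequentially. \<exists>A\<in>sets M. measure M A \<le> \<epsilon> \<and>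
    (\<forall>\<omega>\<in>space M - A. \<forall>t\<in>{0..real T}.
       \<bar>normalized_path M S n \<omega> t - (\<Sum>i<nat \<lfloor>real m * t\<rfloor>. scaled_block m n i \<omega>)\<bar> \<le> \<epsilon>)"
proof -
  \<comment> \<open>In the end \<open>4 \<eta>\<close> is due to the normalization and \<open>2 \<eta>\<close> each to the initial value and to
    the movement inside the last block.\<close>
  define \<eta> where "\<eta> = \<epsilon> / 8"
  have \<eta>: "0 < \<eta>" using \<epsilon> by (simp add: \<eta>_def)
  let ?\<Gamma> = "sqrt growth_constant"
  have \<Gamma>: "0 \<le> ?\<Gamma>" "?\<Gamma> \<le> 2"
    using growth_constant_bounds real_sqrt_le_mono[of growth_constant "2 ^ 2"] by auto
  obtain m0 where m0: "704 * (real T + 1) / (\<epsilon> * \<eta> ^ 4) < real m0" using reals_Archimedean2 by blast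
  have "\<forall>\<^sub>F n in sequentially. \<exists>A\<in>sets M. measure M A \<le> \<epsilon> \<and>
    (\<forall>\<omega>\<in>space M - A. \<forall>t\<in>{0..real T}.
       \<bar>normalized_path M S n \<omega> t - (\<Sum>i<nat \<lfloor>real m * t\<rfloor>. scaled_block m n i \<omega>)\<bar> \<le> \<epsilon>)"
    if m: "Suc m0 \<le> m" for m
  proof -
    have mpos: "m > 0" using m by simp
    let ?N = "\<lambda>n i. power_time n (real i / real m)"
    let ?osc = "\<lambda>n i. {\<omega>\<in>space M. \<exists>j\<in>{?N n i..?N n (Suc i)}. \<bar>block (?N n i) j \<omega>\<bar> \<ge> \<eta> * sqrt (ln (real n))}"
    let ?K = "m * T + 1"
    define A where "A n = (\<Union>i\<in>{..<?K}. ?osc n i)" for n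
    define \<rho> where "\<rho> = 1 / (real (m * T) + 2)"
    have \<rho>: "0 < \<rho>" by (simp add: \<rho>_def add_nonneg_pos)
    have osc_sets: "?osc n i \<in> sets M" for n i
    proof -
      have [measurable]: "block k j \<in> borel_measurable M" for k j
        using adapted_M[OF adapted_block[of j k]] by (simp add: bounded_adapted_def)
      show ?thesis by measurable
    qed
    then have A: "A n \<in> sets M" for n unfolding A_def by auto
    have "\<forall>\<^sub>F n in sequentially. \<forall>i\<in>{..<?K}. prob (?osc n i) \<le> 704 / (real m ^ 2 * \<eta> ^ 4)"
      using block_oscillation_probability[OF mpos \<eta>] by (intro eventually_ball_finite) auto
    moreover have "\<forall>\<^sub>F n in sequentially. \<forall>y\<ge>real n powr (1 / real m).
        \<bar>critical_growth (nat \<lfloor>y\<rfloor>) / sqrt y - ?\<Gamma>\<bar> < \<rho>"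
    proof -
      have "\<forall>\<^sub>F y in at_top. \<bar>critical_growth (nat \<lfloor>y\<rfloor>) / sqrt y - ?\<Gamma>\<bar> < \<rho>"
        using growth_ratio_limit \<rho> unfolding tendsto_iff dist_real_def by simp
      then obtain y0 where y0: "\<And>y. y \<ge> y0 \<Longrightarrow> \<bar>critical_growth (nat \<lfloor>y\<rfloor>) / sqrt y - ?\<Gamma>\<bar> < \<rho>"
        unfolding eventually_at_top_linorder by blast
      have "filterlim (\<lambda>n. real (power_time n (1 / real m))) at_top sequentially"
        by (rule filterlim_compose[OF filterlim_real_sequentially power_time_at_top]) (use mpos in simp)
      then have "\<forall>\<^sub>F n in sequentially. y0 \<le> real (power_time n (1 / real m))"
        by (simp add: filterlim_at_top)
      then show ?thesis
      proof eventually_elim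
        case (elim n)
        then show ?case using y0 power_time_le[of n "1 / real m"] by (meson order_trans)
      qed
    qed
    moreover have "\<forall>\<^sub>F n in sequentially. 2 / \<eta> < sqrt (ln (real n))"
      using filterlim_compose[OF sqrt_at_top ln_at_top_seq] unfolding filterlim_at_top_dense by blast
    ultimately show ?thesis
      using eventually_gt_at_top[of 1]
    proof eventually_elim
      case (elim n)
      define L where "L = sqrt (ln (real n))"
      have L: "0 < L" "2 / \<eta> < L" using elim by (auto simp: L_def)
      then have d1: "2 / L < \<eta>" using \<eta> by (simp add: field_simps)
      have n1: "1 \<le> n" using elim by simp
      have "measure M (A n) \<le> (\<Sum>i<?K. prob (?osc n i))"
        unfolding A_def using osc_sets by (intro finite_measure_subadditive_finite) auto
      also have "\<dots> \<le> (\<Sum>i<?K. 704 / (real m ^ 2 * \<eta> ^ 4))" using elim(1) by (intro sum_mono) auto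
      also have "\<dots> = real ?K * (704 / (real m ^ 2 * \<eta> ^ 4))" by simp
      also have "\<dots> \<le> (real m * (real T + 1)) * (704 / (real m ^ 2 * \<eta> ^ 4))"
        using mpos by (intro mult_right_mono) (auto simp: algebra_simps)
      also have "\<dots> = 704 * (real T + 1) / \<eta> ^ 4 / real m"
        using mpos \<eta> by (simp add: field_simps power2_eq_square)
      also have "\<dots> \<le> \<epsilon>"
      proof -
        have "704 * (real T + 1) / (\<epsilon> * \<eta> ^ 4) \<le> real m" using m0 m by linarith
        then have "704 * (real T + 1) / \<eta> ^ 4 \<le> \<epsilon> * real m"
          using \<epsilon> \<eta> by (simp add: field_simps)
        then show ?thesis using mpos by (simp only: pos_divide_le_eq of_nat_0_less_iff)
      qed
      finally have PA: "measure M (A n) \<le> \<epsilon>" .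
      have "\<bar>normalized_path M S n \<omega> t - (\<Sum>i<nat \<lfloor>real m * t\<rfloor>. scaled_block m n i \<omega>)\<bar> \<le> \<epsilon>"
        if w: "\<omega> \<in> space M" "\<omega> \<notin> A n" and t: "0 \<le> t" "t \<le> real T" for \<omega> t
      proof -
        define J k where "J = nat \<lfloor>real m * t\<rfloor>" and "k = power_time n t"
        have mt: "0 \<le> real m * t" using t by simp
        have Jle: "real J \<le> real m * t" and Jgt: "real m * t < real (Suc J)"
          unfolding J_def using mt by linarith+
        have J1: "real J / real m \<le> t" and J2: "t \<le> real (Suc J) / real m"
          using Jle Jgt mpos by (simp_all add: pos_divide_le_eq pos_le_divide_eq mult.commute del: of_nat_Suc)
        have "real m * t \<le> real (m * T)" using t by (simp add: mult_left_mono)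
        then have "real J \<le> real (m * T)" using Jle by linarith
        then have "J \<le> m * T" by (simp only: of_nat_le_iff)
        then have JK: "J < ?K" by simp
        have N0: "?N n 0 = 1" using n1 by simp
        have Nk: "?N n J \<le> k" "k \<le> ?N n (Suc J)"
          unfolding k_def using J1 J2 by (auto intro: power_time_mono)
        have small: "\<bar>block (?N n i) j \<omega>\<bar> \<le> \<eta> * L" if "i < ?K" "?N n i \<le> j" "j \<le> ?N n (Suc i)" for i j
        proof (rule ccontr)
          assume "\<not> ?thesis"
          then have "\<eta> * sqrt (ln (real n)) \<le> \<bar>block (?N n i) j \<omega>\<bar>" unfolding L_def by simp
          moreover have "j \<in> {?N n i..?N n (Suc i)}" using that by (simp only: atLeastAtMost_iff)
          ultimately have "\<omega> \<in> ?osc n i" using w(1) by blast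
          then show False using w(2) that(1) unfolding A_def by blast
        qed
        have tele: "(\<Sum>i<j. block (?N n i) (?N n (Suc i)) \<omega>) = block (?N n 0) (?N n j) \<omega>" for j
        proof (induction j)
          case (Suc j)
          then show ?case
            using block_diff[of "?N n 0" "?N n j" "?N n (Suc j)" \<omega>] grid_time_mono[of 0 j n m]
              grid_time_mono[of j "Suc j" n m] by simp
        qed simp
        \<comment> \<open>The path is split at time one, where the grid starts, and at the last grid point before \<open>t\<close>.\<close>
        let ?b1 = "block 0 (?N n 0) \<omega>" and ?b2 = "block (?N n 0) (?N n J) \<omega>" and ?b3 = "block (?N n J) k \<omega>"
        have split: "block 0 k \<omega> = ?b1 + ?b2 + ?b3"
          using block_diff[of 0 "?N n 0" "?N n J" \<omega>] block_diff[of 0 "?N n J" k \<omega>]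
            grid_time_mono[of 0 J n m] Nk by simp
        have "\<bar>?b1\<bar> \<le> 2"
          unfolding N0 using noise_bound[OF w(1), of 1] block_Suc[of 0 0 \<omega>] by simp
        then have "\<bar>?b1\<bar> / L \<le> 2 / L" using L by (intro divide_right_mono) auto
        then have b1: "\<bar>?b1 / L\<bar> \<le> \<eta>" using d1 L by (simp add: abs_divide)
        have b3: "\<bar>?b3 / L\<bar> \<le> \<eta>"
          using small[OF JK Nk] L by (simp add: abs_divide pos_divide_le_eq)
        have "\<bar>?b2\<bar> \<le> (\<Sum>i<J. \<bar>block (?N n i) (?N n (Suc i)) \<omega>\<bar>)"
          unfolding tele[symmetric] by (rule sum_abs)
        also have "\<dots> \<le> (\<Sum>i<J. \<eta> * L)"
          using JK by (intro sum_mono small grid_time_mono) auto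
        finally have b2: "\<bar>?b2 / L\<bar> \<le> real J * \<eta>"
          using L by (simp add: abs_divide pos_divide_le_eq)
        have sum3: "\<bar>?b1 / L + ?b2 / L + ?b3 / L\<bar> \<le> real J * \<eta> + 2 * \<eta>"
        proof -
          have "\<bar>x + y + z\<bar> \<le> a + 2 * \<eta>" if "\<bar>x\<bar> \<le> \<eta>" "\<bar>y\<bar> \<le> a" "\<bar>z\<bar> \<le> \<eta>" for x y z a
            using that by linarith
          from this[OF b1 b2 b3] show ?thesis .
        qed
        define r where "r = critical_growth k / sqrt (real n powr t)"
        have X: "normalized_path M S n \<omega> t = r * (?b1 / L + ?b2 / L + ?b3 / L)"
          unfolding normalized_path_eq[OF n1 t(1) w(1)] k_def[symmetric] split r_def L_def
          by (simp add: add_divide_distrib)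
        have G: "(\<Sum>i<J. scaled_block m n i \<omega>) = ?\<Gamma> * (?b2 / L)"
          unfolding tele[symmetric] scaled_block_def L_def sum_divide_distrib sum_distrib_left by simp
        have main: "\<bar>r - ?\<Gamma>\<bar> * \<bar>?b1 / L + ?b2 / L + ?b3 / L\<bar> \<le> 4 * \<eta>"
        proof (cases "J = 0")
          case True
          then have "real J * \<eta> = 0" by simp
          then have "\<bar>?b1 / L + ?b2 / L + ?b3 / L\<bar> \<le> 2 * \<eta>" using sum3 by (simp only: add_0)
          moreover have "\<bar>r - ?\<Gamma>\<bar> \<le> 2"
            unfolding r_def k_def using n1 t by (intro growth_ratio_difference_bound ge_one_powr_ge_zero) auto
          ultimately have "\<bar>r - ?\<Gamma>\<bar> * \<bar>?b1 / L + ?b2 / L + ?b3 / L\<bar> \<le> 2 * (2 * \<eta>)"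
            by (intro mult_mono) auto
          then show ?thesis by simp
        next
          case False
          then have "1 / real m \<le> real J / real m" by (intro divide_right_mono) auto
          then have "real n powr (1 / real m) \<le> real n powr t"
            using J1 n1 by (intro powr_mono) auto
          then have "\<bar>r - ?\<Gamma>\<bar> \<le> \<rho>" unfolding r_def k_def using elim(2) by (simp add: less_imp_le)
          moreover have "\<bar>?b1 / L + ?b2 / L + ?b3 / L\<bar> \<le> (real (m * T) + 2) * \<eta>"
          proof -
            have "real J \<le> real (m * T)" using JK by linarith
            then have "real J * \<eta> \<le> real (m * T) * \<eta>" using \<eta> by (intro mult_right_mono) auto
            moreover have "(real (m * T) + 2) * \<eta> = real (m * T) * \<eta> + 2 * \<eta>" by (rule distrib_right)
            ultimately show ?thesis using sum3 by linarith
          qed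
          ultimately have "\<bar>r - ?\<Gamma>\<bar> * \<bar>?b1 / L + ?b2 / L + ?b3 / L\<bar> \<le> \<rho> * ((real (m * T) + 2) * \<eta>)"
            using \<rho> by (intro mult_mono) auto
          also have "\<dots> = \<eta>"
          proof -
            have "real (m * T) + 2 \<noteq> 0" by (metis add_nonneg_pos less_irrefl of_nat_0_le_iff zero_less_numeral)
            then show ?thesis by (simp add: \<rho>_def del: of_nat_mult)
          qed
          finally show ?thesis using \<eta> by linarith
        qed
        have decompose: "a * (x + y + z) - b * y = (a - b) * (x + y + z) + b * x + b * z" for a b x y z :: real
          by (simp add: algebra_simps)
        have bound: "\<bar>x + y + z\<bar> \<le> 4 * \<eta> + 2 * \<eta> + 2 * \<eta>"
          if "\<bar>x\<bar> \<le> 4 * \<eta>" "\<bar>y\<bar> \<le> 2 * \<eta>" "\<bar>z\<bar> \<le> 2 * \<eta>" for x y z :: real using that by linarith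
        have \<Gamma>_mult: "\<bar>?\<Gamma> * x\<bar> \<le> 2 * \<eta>" if "\<bar>x\<bar> \<le> \<eta>" for x
          unfolding abs_mult using \<Gamma> that by (intro mult_mono) auto
        have "\<bar>normalized_path M S n \<omega> t - (\<Sum>i<J. scaled_block m n i \<omega>)\<bar> \<le> 4 * \<eta> + 2 * \<eta> + 2 * \<eta>"
          unfolding X G decompose by (rule bound[OF main[folded abs_mult] \<Gamma>_mult[OF b1] \<Gamma>_mult[OF b3]])
        then show ?thesis unfolding J_def \<eta>_def by simp
      qed
      then show ?case using A PA by (intro bexI[of _ "A n"]) auto
    qed
  qed
  then show ?thesis unfolding eventually_sequentially by blast
qed

section \<open>The two limit theorems\<close>

lemma functional_limit:
  assumes "standard_brownian_motion N B"
  shows "converges_in_distribution skorokhod_topology M (normalized_path M S)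
     N (\<lambda>\<omega>. \<lambda>t\<in>{0..}. sqrt (limit_variance \<beta> p) * B t \<omega>)"
proof -
  interpret B: standard_brownian_motion N B by fact
  define \<sigma> where "\<sigma> = sqrt (limit_variance \<beta> p)"
  have \<sigma>: "0 < \<sigma>" using limit_variance_pos by (simp add: \<sigma>_def)
  let ?X = "normalized_path M S" and ?Y = "\<lambda>\<omega>. \<lambda>t\<in>{0..}. \<sigma> * B t \<omega>"
  have Ym: "(\<lambda>\<omega>. \<sigma> * B t \<omega>) \<in> borel_measurable N" if "0 \<le> t" for t
    using B.B_measurable[OF that] by simp
  have Yc: "continuous_on {0..} (\<lambda>t. \<sigma> * B t \<omega>)" if "\<omega> \<in> space N" for \<omega>
    by (intro continuous_intros B.B_continuous[OF that])
  have liminf: "\<forall>\<^sub>F n in sequentially. (\<integral>\<omega>. f (?Y \<omega>) \<partial>N) - r < (\<integral>\<omega>. f (?X n \<omega>) \<partial>M)"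
    if f: "continuous_map skorokhod_topology euclideanreal f"
      and C: "\<And>y. y \<in> skorokhod_space \<Longrightarrow> \<bar>f y\<bar> \<le> C" and r: "0 < r" for f :: "(real \<Rightarrow> real) \<Rightarrow> real" and C r
  proof (rule skorokhod_liminf_criterion[where V = scaled_block and Y = "\<lambda>t \<omega>. \<sigma> * B t \<omega>" and C = C])
    show "prob_space M" "prob_space N" by unfold_locales
    show "AE \<omega> in N. \<sigma> * B 0 \<omega> = 0" using B.B_0 by eventually_elim simp
    show "(\<lambda>\<omega>. f (?X n \<omega>)) \<in> borel_measurable M" for n
      by (rule measurable_compose[OF normalized_path_measurable continuous_map_borel_of_measurable[OF f]])
    fix m K :: nat and h :: "nat \<Rightarrow> real \<Rightarrow> real"
    assume mh: "m > 0" "\<And>j. continuous_on UNIV (h j)" "\<And>j x. 0 \<le> h j x \<and> h j x \<le> 1"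
    show "(\<lambda>n. \<integral>\<omega>. (\<Prod>i<K. h i (scaled_block m n i \<omega>)) \<partial>M) \<longlonglongrightarrow>
      (\<integral>\<omega>. (\<Prod>i<K. h i (\<sigma> * B (real (Suc i) / real m) \<omega> - \<sigma> * B (real i / real m) \<omega>)) \<partial>N)"
      unfolding B.expectation_prod_increments[OF mh(1) \<sigma> mh(2,3)]
      using scaled_block_products[OF mh] by (simp add: \<sigma>_def)
  qed (use r C normalized_path_in_skorokhod_space Ym Yc B.scaled_increment_sq_integrable[OF _ _ \<sigma>]
        scaled_block_sq_integrable scaled_block_second_moment path_oscillation lsc_at_continuous[OF f] in auto)
  have "(\<lambda>n. \<integral>\<omega>. f (?X n \<omega>) \<partial>M) \<longlonglongrightarrow> (\<integral>\<omega>. f (?Y \<omega>) \<partial>N)"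
    if f: "continuous_map skorokhod_topology euclideanreal f" and b: "bounded (f ` topspace skorokhod_topology)"
    for f :: "(real \<Rightarrow> real) \<Rightarrow> real"
  proof (rule LIMSEQ_I)
    obtain C where C: "\<And>y. y \<in> skorokhod_space \<Longrightarrow> \<bar>f y\<bar> \<le> C"
      using b unfolding bounded_iff topspace_skorokhod_topology by auto
    fix r :: real assume r: "0 < r"
    have f': "continuous_map skorokhod_topology euclideanreal (\<lambda>x. - f x)"
      using f by (rule continuous_map_minus)
    have "\<forall>\<^sub>F n in sequentially. (\<integral>\<omega>. - f (?Y \<omega>) \<partial>N) - r < (\<integral>\<omega>. - f (?X n \<omega>) \<partial>M)"
      by (rule liminf[OF f', of C]) (use C r in auto)
    moreover have "\<forall>\<^sub>F n in sequentially. (\<integral>\<omega>. f (?Y \<omega>) \<partial>N) - r < (\<integral>\<omega>. f (?X n \<omega>) \<partial>M)"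
      by (rule liminf[OF f C r])
    ultimately have "\<forall>\<^sub>F n in sequentially. norm ((\<integral>\<omega>. f (?X n \<omega>) \<partial>M) - (\<integral>\<omega>. f (?Y \<omega>) \<partial>N)) < r"
      by eventually_elim (simp add: abs_less_iff)
    then show "\<exists>no. \<forall>n\<ge>no. norm ((\<integral>\<omega>. f (?X n \<omega>) \<partial>M) - (\<integral>\<omega>. f (?Y \<omega>) \<partial>N)) < r"
      unfolding eventually_sequentially .
  qed
  then show ?thesis
    unfolding converges_in_distribution_def \<sigma>_def[symmetric]
    using normalized_path_measurable continuous_path_measurable[OF Ym Yc] by blast
qed

text \<open>The whole walk up to time \<open>n\<close> is treated as a single block.\<close>

lemma one_dimensional_limit:
  "weak_conv_m
     (\<lambda>n. distr M borel (\<lambda>\<omega>. (real_of_int (S n \<omega>) - (\<integral>\<omega>'. real_of_int (S n \<omega>') \<partial>M)) / sqrt (real n * ln (real n))))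
     (normal_law (sqrt (limit_variance \<beta> p)))"
proof (rule levy_continuity)
  let ?W = "\<lambda>n \<omega>. (real_of_int (S n \<omega>) - (\<integral>\<omega>'. real_of_int (S n \<omega>') \<partial>M)) / sqrt (real n * ln (real n))"
  have \<sigma>: "0 < sqrt (limit_variance \<beta> p)" using limit_variance_pos by simp
  show "real_distribution (distr M borel (?W n))" for n by (rule real_distribution_distr) measurable
  show "real_distribution (normal_law (sqrt (limit_variance \<beta> p)))"
    by (rule real_distribution_normal_law[OF \<sigma>])
  fix u
  let ?c = "\<lambda>n. critical_growth n / sqrt (real n)"
  have W: "?W n \<omega> = ?c n / sqrt (ln (real n)) * block 0 n \<omega>" if "\<omega> \<in> space M" for n \<omega>
    using centered_walk[of n \<omega>] that by (cases "n = 0") (simp_all add: real_sqrt_mult)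
  have pt: "power_time n 1 = n" for n by simp
  have sum: "(\<lambda>n. (\<Sum>j\<in>{0<..n}. 1 / critical_growth j ^ 2) / ln (real n)) \<longlonglongrightarrow> 1 / growth_constant"
    using sum_inverse_growth_sq[of "\<lambda>_. 1" 1 1] unfolding pt
    by (simp add: atLeastSucAtMost_greaterThanAtMost)
  have "(\<lambda>n. expectation (\<lambda>\<omega>. of_real 1 * iexp (u * (?c n / sqrt (ln (real n)) * block 0 n \<omega>)))
     - of_real (expectation (\<lambda>_. 1)) * of_real (exp (- (u\<^sup>2 * ((sqrt growth_constant)\<^sup>2 * limit_variance \<beta> p * (1 / growth_constant))) / 2)))
     \<longlonglongrightarrow> 0"
    by (rule block_char_limit[where t = 1, OF _ _ _ sum critical_growth_limit bounded_adapted_const])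
       (simp_all add: pt)
  moreover have sd: "(sqrt growth_constant)\<^sup>2 * limit_variance \<beta> p * (1 / growth_constant) = (sqrt (limit_variance \<beta> p))\<^sup>2"
    using growth_constant_bounds limit_variance_pos by simp
  ultimately have "(\<lambda>n. expectation (\<lambda>\<omega>. of_real 1 * iexp (u * (?c n / sqrt (ln (real n)) * block 0 n \<omega>)))
     - of_real (expectation (\<lambda>_. 1)) * of_real (exp (- (u\<^sup>2 * (sqrt (limit_variance \<beta> p))\<^sup>2) / 2))) \<longlonglongrightarrow> 0"
    by (simp only:)
  then have "(\<lambda>n. expectation (\<lambda>\<omega>. iexp (u * (?c n / sqrt (ln (real n)) * block 0 n \<omega>))))
     \<longlonglongrightarrow> of_real (exp (- (u\<^sup>2 * (sqrt (limit_variance \<beta> p))\<^sup>2) / 2))"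
    unfolding LIM_zero_iff by (simp only: of_real_1 mult_1 lebesgue_integral_const prob_space scaleR_one)
  moreover have "char (distr M borel (?W n)) u = expectation (\<lambda>\<omega>. iexp (u * (?c n / sqrt (ln (real n)) * block 0 n \<omega>)))" for n
  proof -
    have "char (distr M borel (?W n)) u = expectation (\<lambda>\<omega>. iexp (u * ?W n \<omega>))"
      unfolding char_def by (rule integral_distr) measurable
    also have "\<dots> = expectation (\<lambda>\<omega>. iexp (u * (?c n / sqrt (ln (real n)) * block 0 n \<omega>)))"
      by (rule Bochner_Integration.integral_cong) (use W in auto)
    finally show ?thesis .
  qed
  ultimately show "(\<lambda>n. char (distr M borel (?W n)) u) \<longlonglongrightarrow> char (normal_law (sqrt (limit_variance \<beta> p))) u"
    unfolding char_normal_law[OF \<sigma>] by (simp only:)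
qed

end

theorem theorem1p2:
  fixes M :: "'a measure" and p q \<beta> :: real and \<alpha> \<beta>s :: "nat \<Rightarrow> real"
    and S :: "nat \<Rightarrow> 'a \<Rightarrow> int"
  assumes "dynamic_elephant_random_walk M p q \<alpha> \<beta>s S"
    and "\<And>n. n \<ge> 1 \<Longrightarrow> \<alpha> n = 1 / (4 * p - 2)"
    and "\<beta>s \<longlonglongrightarrow> \<beta>"
    and "(3 / 4 \<le> p \<and> p < 1) \<or> (p = 1 \<and> 0 < \<beta> \<and> \<beta> < 1)"
  shows "(\<forall>(N :: 'b measure) B. standard_brownian_motion N B \<longrightarrow>
            converges_in_distribution skorokhod_topology
              M (normalized_path M S)
              N (\<lambda>\<omega>. \<lambda>t\<in>{0..}. sqrt (limit_variance \<beta> p) * B t \<omega>))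
       \<and> weak_conv_m
            (\<lambda>n. distr M borel
               (\<lambda>\<omega>. (real_of_int (S n \<omega>) - (\<integral>\<omega>'. real_of_int (S n \<omega>') \<partial>M))
                     / sqrt (real n * ln (real n))))
            (density lborel (normal_density 0 (sqrt (limit_variance \<beta> p))))"
proof -
  interpret critical_elephant_random_walk M p q \<alpha> \<beta>s S \<beta>
    using assms by (simp add: critical_elephant_random_walk_def critical_elephant_random_walk_axioms_def)
  show ?thesis using functional_limit one_dimensional_limit by blast
qed

end
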